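(* Let $\alpha>0$, let $\ell_0\ge4$ be an integer, let $0<c<1/7$, and let $(\xi_t)_{t\in\mathbb Z}$ be iid Rademacher variables. Define processes $V_A,V_B$ on $\mathbb Z$ by $$V_A(t)^\alpha=1+c(2\xi_{t-1}+\xi_{t-2}+4\xi_{t-3}),\qquad V_B(t)^\alpha=1+c(\xi_t+4\xi_{t-2}+2\xi_{t-3}).$$ For $\bullet\in\{A,B\}$ let $X^\bullet=(X_1^\bullet,X_2^\bullet)$ be the finite moving average with volatility $V=V_\bullet$ defined in the context, with innovations independent of $(\xi_t)$. Then: (a) $V_A$ and $V_B$ are positive, bounded and strictly stationary, satisfy $\mathbb E\{V(0)^\alpha\}=1$ and $\mathbb E\{V(0)^{2\alpha}\}<\infty$, and have the same one-time law; and the scalar path-tail measure of every row $X_i^\bullet$, $i\in\{1,2\}$, is the same for both models. (b) The anchor masses satisfy $$p_{(0,0)}^A=p_{(0,0)}^B=\ell_0^2+(49\ell_0-44)c^2,\qquad p_{(0,2)}^A-p_{(0,2)}^B=\begin{cases}2c^2,&\ell_0=4,\\4c^2,&\ell_0\ge5.\end{cases}$$ (c) For every $T\in\mathbb N=\{1,2,\dots\}$, $$H_2^A(T)=H_2^B(T)=\ell_0^2+(49\ell_0-44)c^2+(T-1)(2\ell_0-1+49c^2).$$ Thus the scalar path-tail measures together with the simultaneous-exceedance tail masses on every consecutive finite window do not determine the relative-anchor tail masses $p_{(0,\ell)}$.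
   Context: Model. Given a positive strictly stationary process $V$ on $\mathbb Z$ with $\mathbb E\{V(0)^\alpha\}=1$, $\mathbb E\{V(0)^{2\alpha}\}<\infty$, and, independently of $V$, mutually independent standard $\alpha$-Pareto variables $(\eta_{i,s})_{i\in\{1,2\},s\in\mathbb Z}$ ($\mathbb P\{\eta_{i,s}>x\}=x^{-\alpha}$, $x\ge1$), put $X_i(t)=\sum_{j=0}^{\ell_0-1}V(t-j)\eta_{i,t-j}$, $i\in\{1,2\}$, $t\in\mathbb Z$. Write $\varphi_s(t)=\mathbb I_{\{s,\dots,s+\ell_0-1\}}(t)$ and $w_\delta=\mathbb E\{V(0)^\alpha V(\delta)^\alpha\}$. Joint path-tail measure. The path-tail measure $\nu_{\mathrm{FV}}$ of $X$ is the measure on functions $\mathbb Z\to\mathbb R^2$ given, for Borel $F\ge0$, by $$\nu_{\mathrm{FV}}(F)=\sum_{\delta\in\mathbb Z}w_\delta\sum_{s\in\mathbb Z}\int_{(0,\infty)^2}F(r_1\varphi_s,r_2\varphi_{s+\delta})\prod_{i=1}^2\alpha r_i^{-\alpha-1}dr_i .$$ It is the limit of $u_1^\alpha u_2^\alpha\,\mathbb P\{(X_1/u_1,X_2/u_2)\in\cdot\}$ as $\min(u_1,u_2)\to\infty$ (arbitrary relative rates), tested against bounded continuous functions (pointwise-convergence topology) vanishing outside a set $\{f:\sup_{t\in K}|f_i(t)|>\varepsilon,\ i=1,2\}$ for some finite $K\subset\mathbb Z$, $\varepsilon>0$. Anchor masses: $p_{(0,\ell)}=\nu_{\mathrm{FV}}\{f:|f_1(0)|>1,|f_2(\ell)|>1\}$,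 $\ell\in\mathbb Z$. Scalar path-tail measure of row $i$: the limit $\nu_i^{\mathrm{sc}}$ of $u^\alpha\,\mathbb P\{X_i/u\in\cdot\}$ as $u\to\infty$, tested against bounded continuous functions of paths $\mathbb Z\to\mathbb R$ vanishing outside a set $\{f:\sup_{t\in K}|f(t)|>\varepsilon\}$ for some finite $K\subset\mathbb Z$, $\varepsilon>0$. Simultaneous-exceedance tail mass on $\{0,\dots,T-1\}$: $$H_2(T)=\lim_{\min(u_1,u_2)\to\infty}u_1^\alpha u_2^\alpha\,\mathbb P\{\exists\,0\le t<T:\ X_1(t)>u_1,\ X_2(t)>u_2\}.$$ A superscript $A$ or $B$ indicates the model with $V=V_A$ or $V=V_B$. *)

theory Defs
  imports "HOL-Probability.Probability"
begin

section \<open>The finite moving-average model\<close>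

definition rademacher_family :: "'a measure \<Rightarrow> (int \<Rightarrow> 'a \<Rightarrow> real) \<Rightarrow> bool" where
  "rademacher_family M \<xi> \<longleftrightarrow>
     prob_space.indep_vars M (\<lambda>_. borel) \<xi> UNIV \<and>
     (\<forall>t. measure M {\<omega> \<in> space M. \<xi> t \<omega> = 1} = 1 / 2 \<and>
          measure M {\<omega> \<in> space M. \<xi> t \<omega> = -1} = 1 / 2)"

text \<open>The rows are the indices 1 and 2; values of \<open>\<eta>\<close> at other row indices are irrelevant.\<close>

definition pareto_innovations :: "'a measure \<Rightarrow> real \<Rightarrow> (nat \<Rightarrow> int \<Rightarrow> 'a \<Rightarrow> real) \<Rightarrow> bool" where
  "pareto_innovations M \<alpha> \<eta> \<longleftrightarrow>
     prob_space.indep_vars M (\<lambda>_. borel) (\<lambda>(i, s). \<eta> i s) ({1, 2} \<times> UNIV) \<and>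
     (\<forall>i\<in>{1, 2}. \<forall>s. \<forall>x\<ge>1. measure M {\<omega> \<in> space M. \<eta> i s \<omega> > x} = x powr (- \<alpha>))"

text \<open>Independence of the process \<open>Y\<close> and the whole innovation field, as independence of
  the sigma-algebras on the sample space generated by the two families.\<close>

definition indep_of_innovations ::
    "'a measure \<Rightarrow> (int \<Rightarrow> 'a \<Rightarrow> real) \<Rightarrow> (nat \<Rightarrow> int \<Rightarrow> 'a \<Rightarrow> real) \<Rightarrow> bool" where
  "indep_of_innovations M Y \<eta> \<longleftrightarrow>
     prob_space.indep_set M
       (sets (vimage_algebra (space M) (\<lambda>\<omega> t. Y t \<omega>) (\<Pi>\<^sub>M t\<in>UNIV. borel)))
       (sets (vimage_algebra (space M) (\<lambda>\<omega>. \<lambda>(i, s)\<in>{1, 2} \<times> UNIV. \<eta> i s \<omega>)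
                (\<Pi>\<^sub>M p\<in>{1, 2} \<times> UNIV. borel)))"

definition strictly_stationary :: "'a measure \<Rightarrow> (int \<Rightarrow> 'a \<Rightarrow> real) \<Rightarrow> bool" where
  "strictly_stationary M V \<longleftrightarrow>
     (\<forall>t. V t \<in> borel_measurable M) \<and>
     (\<forall>h. distr M (\<Pi>\<^sub>M t\<in>UNIV. borel) (\<lambda>\<omega> t. V (t + h) \<omega>) =
          distr M (\<Pi>\<^sub>M t\<in>UNIV. borel) (\<lambda>\<omega> t. V t \<omega>))"

definition volatility :: "'a measure \<Rightarrow> real \<Rightarrow> (int \<Rightarrow> 'a \<Rightarrow> real) \<Rightarrow> bool" where
  "volatility M \<alpha> V \<longleftrightarrow>
     (AE \<omega> in M. \<forall>t. V t \<omega> > 0) \<and>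
     strictly_stationary M V \<and>
     (\<integral>\<^sup>+\<omega>. ennreal (V 0 \<omega> powr \<alpha>) \<partial>M) = 1 \<and>
     (\<integral>\<^sup>+\<omega>. ennreal (V 0 \<omega> powr (2 * \<alpha>)) \<partial>M) < \<infinity>"

definition row ::
    "nat \<Rightarrow> (int \<Rightarrow> 'a \<Rightarrow> real) \<Rightarrow> (nat \<Rightarrow> int \<Rightarrow> 'a \<Rightarrow> real) \<Rightarrow> nat \<Rightarrow> int \<Rightarrow> 'a \<Rightarrow> real" where
  "row l0 V \<eta> i t \<omega> = (\<Sum>j<l0. V (t - int j) \<omega> * \<eta> i (t - int j) \<omega>)"

section \<open>Tail measures\<close>

definition window :: "nat \<Rightarrow> int \<Rightarrow> int \<Rightarrow> real" where
  "window l0 s = indicator {s..<s + int l0}"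

definition pareto_intensity :: "real \<Rightarrow> real measure" where
  "pareto_intensity \<alpha> =
     density lborel (\<lambda>r. indicator {0<..} r * ennreal (\<alpha> * r powr (- \<alpha> - 1)))"

definition lag_weight :: "'a measure \<Rightarrow> real \<Rightarrow> (int \<Rightarrow> 'a \<Rightarrow> real) \<Rightarrow> int \<Rightarrow> ennreal" where
  "lag_weight M \<alpha> V \<delta> = (\<integral>\<^sup>+\<omega>. ennreal (V 0 \<omega> powr \<alpha> * V \<delta> \<omega> powr \<alpha>) \<partial>M)"

text \<open>Sums of nonnegative extended reals over the integers are integrals over counting measure.\<close>

definition nu_FV_integral ::
    "'a measure \<Rightarrow> real \<Rightarrow> nat \<Rightarrow> (int \<Rightarrow> 'a \<Rightarrow> real) \<Rightarrow>
     ((int \<Rightarrow> real \<times> real) \<Rightarrow> ennreal) \<Rightarrow> ennreal" where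
  "nu_FV_integral M \<alpha> l0 V F =
     (\<integral>\<^sup>+\<delta>. lag_weight M \<alpha> V \<delta> *
        (\<integral>\<^sup>+s. (\<integral>\<^sup>+(r1, r2). F (\<lambda>t. (r1 * window l0 s t, r2 * window l0 (s + \<delta>) t))
                  \<partial>(pareto_intensity \<alpha> \<Otimes>\<^sub>M pareto_intensity \<alpha>))
          \<partial>count_space UNIV)
      \<partial>count_space UNIV)"

text \<open>Here and below, \<open>borel\<close> on a path space is the Borel sigma-algebra of the topology of
  pointwise convergence.\<close>

definition nu_FV ::
    "'a measure \<Rightarrow> real \<Rightarrow> nat \<Rightarrow> (int \<Rightarrow> 'a \<Rightarrow> real) \<Rightarrow> (int \<Rightarrow> real \<times> real) measure" where
  "nu_FV M \<alpha> l0 V =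
     measure_of UNIV (sets borel) (\<lambda>S. nu_FV_integral M \<alpha> l0 V (indicator S))"

text \<open>The set function in this definition is countably additive on Borel sets:\<close>

lemma measurable_window_path [measurable]:
  "(\<lambda>x. \<lambda>t. (fst x * window l0 s t, snd x * window l0 s' t))
     \<in> borel_measurable (pareto_intensity \<alpha> \<Otimes>\<^sub>M pareto_intensity \<alpha>)"
  unfolding pareto_intensity_def
  by (rule measurable_coordinatewise_then_product) measurable

lemma nu_FV_integral_suminf:
  assumes "\<And>n. F n \<in> borel_measurable borel"
  shows "nu_FV_integral M \<alpha> l0 V (\<lambda>f. \<Sum>n. F n f) = (\<Sum>n. nu_FV_integral M \<alpha> l0 V (F n))"
proof -
  note [measurable] = assms
  have "(\<lambda>x. F n (\<lambda>t. (fst x * window l0 s t, snd x * window l0 s' t)))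
     \<in> borel_measurable (pareto_intensity \<alpha> \<Otimes>\<^sub>M pareto_intensity \<alpha>)" for n s s'
    by measurable
  then have *: "nu_FV_integral M \<alpha> l0 V (\<lambda>f. \<Sum>n. F n f) =
     (\<integral>\<^sup>+\<delta>. (\<Sum>n. lag_weight M \<alpha> V \<delta> *
        (\<integral>\<^sup>+s. (\<integral>\<^sup>+x. F n (\<lambda>t. (fst x * window l0 s t, snd x * window l0 (s + \<delta>) t))
                  \<partial>(pareto_intensity \<alpha> \<Otimes>\<^sub>M pareto_intensity \<alpha>))
          \<partial>count_space UNIV))
      \<partial>count_space UNIV)"
    unfolding nu_FV_integral_def case_prod_unfold
    by (simp add: nn_integral_suminf)
  show ?thesis
    unfolding * unfolding nu_FV_integral_def case_prod_unfold
    by (rule nn_integral_suminf) simp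
qed

lemma emeasure_nu_FV:
  assumes "S \<in> sets borel"
  shows "emeasure (nu_FV M \<alpha> l0 V) S = nu_FV_integral M \<alpha> l0 V (indicator S)"
proof (rule emeasure_measure_of[OF nu_FV_def])
  show "positive (sets (nu_FV M \<alpha> l0 V)) (\<lambda>S. nu_FV_integral M \<alpha> l0 V (indicator S))"
    unfolding positive_def nu_FV_integral_def case_prod_unfold by simp
  show "countably_additive (sets (nu_FV M \<alpha> l0 V)) (\<lambda>S. nu_FV_integral M \<alpha> l0 V (indicator S))"
  proof (rule countably_additiveI)
    fix A :: "nat \<Rightarrow> (int \<Rightarrow> real \<times> real) set"
    assume A: "range A \<subseteq> sets (nu_FV M \<alpha> l0 V)" "disjoint_family A"
    have [measurable]: "A n \<in> sets borel" for n
      using A(1) sigma_algebra.sigma_sets_eq[OF sets.sigma_algebra_axioms[of borel]]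
      by (auto simp: nu_FV_def)
    have "indicator (\<Union>n. A n) = (\<lambda>f. \<Sum>n. indicator (A n) f :: ennreal)"
      using suminf_indicator[OF A(2)] by (auto simp: fun_eq_iff)
    then show "(\<Sum>n. nu_FV_integral M \<alpha> l0 V (indicator (A n))) =
        nu_FV_integral M \<alpha> l0 V (indicator (\<Union>n. A n))"
      by (simp add: nu_FV_integral_suminf)
  qed
qed (use assms in \<open>auto simp: nu_FV_def\<close>)

text \<open>Extended-real valued: a finite positive difference of two such masses forces both to be
  finite, so truncated subtraction then agrees with subtraction of reals.\<close>

definition anchor_mass ::
    "'a measure \<Rightarrow> real \<Rightarrow> nat \<Rightarrow> (int \<Rightarrow> 'a \<Rightarrow> real) \<Rightarrow> int \<Rightarrow> ennreal" where
  "anchor_mass M \<alpha> l0 V l =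
     emeasure (nu_FV M \<alpha> l0 V) {f. \<bar>fst (f 0)\<bar> > 1 \<and> \<bar>snd (f l)\<bar> > 1}"

definition exceed_set :: "int set \<Rightarrow> real \<Rightarrow> (int \<Rightarrow> real) set" where
  "exceed_set K \<epsilon> = {f. \<exists>t\<in>K. \<bar>f t\<bar> > \<epsilon>}"

text \<open>\<open>\<nu>\<close> is the limit of \<open>u\<^sup>\<alpha> P(Y/u \<in> \<cdot>)\<close>. The test functions do not see the zero path, so
  the usual normalisation that \<open>\<nu>\<close> has no mass there is part of the definition, as is local
  finiteness (which makes the test integrals exist).\<close>

definition scalar_path_tail_measure ::
    "'a measure \<Rightarrow> real \<Rightarrow> (int \<Rightarrow> 'a \<Rightarrow> real) \<Rightarrow> (int \<Rightarrow> real) measure \<Rightarrow> bool" where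
  "scalar_path_tail_measure M \<alpha> Y \<nu> \<longleftrightarrow>
     sets \<nu> = sets borel \<and>
     emeasure \<nu> {\<lambda>_. 0} = 0 \<and>
     (\<forall>K \<epsilon>. finite K \<longrightarrow> \<epsilon> > 0 \<longrightarrow> emeasure \<nu> (exceed_set K \<epsilon>) < \<infinity>) \<and>
     (\<forall>F :: (int \<Rightarrow> real) \<Rightarrow> real.
        continuous_on UNIV F \<longrightarrow> bounded (range F) \<longrightarrow>
        (\<exists>K \<epsilon>. finite K \<and> \<epsilon> > 0 \<and> (\<forall>f. f \<notin> exceed_set K \<epsilon> \<longrightarrow> F f = 0)) \<longrightarrow>
        ((\<lambda>u. u powr \<alpha> * (\<integral>\<omega>. F (\<lambda>t. Y t \<omega> / u) \<partial>M)) \<longlongrightarrow> (\<integral>f. F f \<partial>\<nu>)) at_top)"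

definition has_simultaneous_tail_mass ::
    "'a measure \<Rightarrow> real \<Rightarrow> (nat \<Rightarrow> int \<Rightarrow> 'a \<Rightarrow> real) \<Rightarrow> nat \<Rightarrow> real \<Rightarrow> bool" where
  "has_simultaneous_tail_mass M \<alpha> X T h \<longleftrightarrow>
     ((\<lambda>(u1, u2). u1 powr \<alpha> * u2 powr \<alpha> *
         measure M {\<omega> \<in> space M. \<exists>t\<in>{0..<int T}. X 1 t \<omega> > u1 \<and> X 2 t \<omega> > u2})
      \<longlongrightarrow> h) (filtercomap (\<lambda>(u1, u2). min u1 u2) at_top)"

section \<open>The two volatility processes\<close>

definition V\<^sub>A :: "real \<Rightarrow> real \<Rightarrow> (int \<Rightarrow> 'a \<Rightarrow> real) \<Rightarrow> int \<Rightarrow> 'a \<Rightarrow> real" where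
  "V\<^sub>A \<alpha> c \<xi> t \<omega> =
     (1 + c * (2 * \<xi> (t - 1) \<omega> + \<xi> (t - 2) \<omega> + 4 * \<xi> (t - 3) \<omega>)) powr (1 / \<alpha>)"

definition V\<^sub>B :: "real \<Rightarrow> real \<Rightarrow> (int \<Rightarrow> 'a \<Rightarrow> real) \<Rightarrow> int \<Rightarrow> 'a \<Rightarrow> real" where
  "V\<^sub>B \<alpha> c \<xi> t \<omega> =
     (1 + c * (\<xi> t \<omega> + 4 * \<xi> (t - 2) \<omega> + 2 * \<xi> (t - 3) \<omega>)) powr (1 / \<alpha>)"

end

theory Submission
  imports Defs
begin

text \<open>Conditionally on the volatility the two rows are independent, and a scaled row exceeds a level
  essentially because of one large innovation, at an index \<open>s\<close>, which contributes the window path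
  started at \<open>s\<close> with weight \<open>V(s)\<^sup>\<alpha>\<close>. For one row only \<open>E V(s)\<^sup>\<alpha> = 1\<close> survives, so the scalar tail
  measure does not depend on \<open>V\<close> at all. For two rows the pair of jumps at \<open>s\<close> and \<open>s + \<delta>\<close> has weight
  \<open>w\<^sub>\<delta> = 1 + c\<^sup>2 \<gamma>(\<delta>)\<close>, where \<open>\<gamma>\<close> is the autocorrelation of the coefficients. Two windows at distance
  \<open>\<bar>\<delta>\<bar> < l0\<close> meet \<open>{0..<T}\<close> simultaneously for \<open>T - 1 + l0 - \<bar>\<delta>\<bar>\<close> values of \<open>s\<close>, so the simultaneous tail
  mass sees \<open>\<gamma>\<close> only through linear functionals that agree for the autocorrelations \<open>(21, 6, 8, 0)\<close> and
  \<open>(21, 8, 4, 2)\<close> of the two models, whereas the anchor mass at lag 2 weights \<open>\<gamma>(\<delta>)\<close> by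
  \<open>max 0 (l0 - \<bar>2 - \<delta>\<bar>)\<close> and separates them.\<close>

section \<open>The Pareto law\<close>

text \<open>The coefficients 2, 1, 4 sit at lags 1, 2, 3 in model A, and 1, 4, 2 at lags 0, 2, 3 in
  model B. Being the same numbers, they give one one-time law, the variance 1 + 4 + 16 = 21 and the
  total autocorrelation 7^2 = 49; their positions are chosen so that the pairwise products weighted
  by distance also agree, 2 + 4 + 16 = 8 + 8 + 6 = 22. This is the origin of 49 and of 44 = 2 * 22,
  while c < 1/7 says that 1 - 7c is positive. The analytic obstacle is that u1 and u2 grow at
  arbitrary relative rates and that a simultaneous exceedance is not a product of row events. The
  event is therefore cut into pairs of exact exceedance patterns, one per row. For a frozen
  volatility path each pair factorises and each factor absorbs its own power of u, so the two rates
  never interact. Passing to the limit under the volatility law then needs an integrable bound built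
  from products V(s)^\<alpha> V(s')^\<alpha>, which is what the moment of order 2\<alpha>
  provides.\<close>

definition pareto_law :: "real \<Rightarrow> real measure" where
  "pareto_law \<alpha> = density (pareto_intensity \<alpha>) (indicator {1<..})"

lemma sets_pareto_intensity [measurable_cong, simp]: "sets (pareto_intensity \<alpha>) = sets borel"
  by (simp add: pareto_intensity_def)

lemma space_pareto_intensity [simp]: "space (pareto_intensity \<alpha>) = UNIV"
  by (simp add: pareto_intensity_def)

lemma sets_pareto_law [measurable_cong, simp]: "sets (pareto_law \<alpha>) = sets borel"
  by (simp add: pareto_law_def)

lemma space_pareto_law [simp]: "space (pareto_law \<alpha>) = UNIV"
  by (simp add: pareto_law_def)

lemma sigma_finite_pareto_intensity: "sigma_finite_measure (pareto_intensity \<alpha>)"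
  unfolding pareto_intensity_def
  by (subst sigma_finite_measure.sigma_finite_iff_density_finite[OF sigma_finite_lborel])
     (auto simp: indicator_def)

lemma AE_pareto_intensity_pos: "AE r in pareto_intensity \<alpha>. 0 < r"
  unfolding pareto_intensity_def by (subst AE_density) (auto simp: indicator_def)

lemma AE_pareto_intensity_neq: "AE r in pareto_intensity \<alpha>. r \<noteq> x"
  unfolding pareto_intensity_def
  using AE_lborel_singleton[of x] by (subst AE_density) (auto elim: eventually_mono)

lemma emeasure_pareto_intensity_greaterThan:
  assumes "\<alpha> > 0" "x > 0"
  shows "emeasure (pareto_intensity \<alpha>) {x<..} = ennreal (x powr (- \<alpha>))"
proof -
  have "emeasure (pareto_intensity \<alpha>) {x<..} =
      (\<integral>\<^sup>+r. indicator {0<..} r * ennreal (\<alpha> * r powr (- \<alpha> - 1)) * indicator {x<..} r \<partial>lborel)"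
    unfolding pareto_intensity_def by (subst emeasure_density) auto
  also have "\<dots> = (\<integral>\<^sup>+r. ennreal (\<alpha> * r powr (- \<alpha> - 1)) * indicator {x..} r \<partial>lborel)"
    using AE_lborel_singleton[of x] \<open>x > 0\<close>
    by (intro nn_integral_cong_AE) (auto simp: indicator_def)
  also have "\<dots> = ennreal (0 - (- (x powr (- \<alpha>))))"
  proof (rule nn_integral_FTC_atLeast)
    show "((\<lambda>r. - (r powr (- \<alpha>))) \<longlongrightarrow> 0) at_top"
      using tendsto_minus[OF tendsto_neg_powr[OF _ filterlim_ident, of "- \<alpha>"]] \<open>\<alpha> > 0\<close> by simp
  qed (use assms in \<open>auto intro!: derivative_eq_intros\<close>)
  finally show ?thesis by simp
qed

lemma emeasure_pareto_law_greaterThan: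
  assumes "\<alpha> > 0"
  shows "emeasure (pareto_law \<alpha>) {x<..} = ennreal ((max 1 x) powr (- \<alpha>))"
proof -
  have "emeasure (pareto_law \<alpha>) {x<..} = (\<integral>\<^sup>+r. indicator {max 1 x<..} r \<partial>pareto_intensity \<alpha>)"
    unfolding pareto_law_def
    by (subst emeasure_density, simp, simp, intro nn_integral_cong) (simp split: split_indicator)
  then show ?thesis
    using emeasure_pareto_intensity_greaterThan[of \<alpha> "max 1 x"] assms by simp
qed

lemma AE_pareto_law: "AE r in pareto_law \<alpha>. 1 < r"
  unfolding pareto_law_def by (subst AE_density) (auto simp: indicator_def)

lemma prob_space_pareto_law:
  assumes "\<alpha> > 0"
  shows "prob_space (pareto_law \<alpha>)"
proof
  have "emeasure (pareto_law \<alpha>) UNIV = emeasure (pareto_law \<alpha>) {1<..}"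
    using AE_pareto_law by (intro emeasure_eq_AE) auto
  then show "emeasure (pareto_law \<alpha>) (space (pareto_law \<alpha>)) = 1"
    using emeasure_pareto_law_greaterThan[OF assms, of 1] by simp
qed

text \<open>Equality holds for x at least 1 and the left side is at most 1 below. Having the bound
  for every x > 0 makes the later domination uniform in the level u, not just valid for large
  u.\<close>

lemma measure_pareto_law_le:
  assumes "\<alpha> > 0" "x > 0"
  shows "measure (pareto_law \<alpha>) {x<..} \<le> x powr (- \<alpha>)"
proof -
  have "max 1 x powr (- \<alpha>) \<le> x powr (- \<alpha>)"
    using assms by (intro powr_mono2') auto
  then show ?thesis
    using emeasure_pareto_law_greaterThan[OF assms(1), of x] by (simp add: measure_def)
qed

text \<open>The tail at 1 is already the whole mass, so the tails below 1 are forced by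
  monotonicity, and open right tails determine a finite measure on the line.\<close>

lemma pareto_law_unique:
  assumes "prob_space N" and [simp]: "sets N = sets borel" and "\<alpha> > 0"
    and tail: "\<And>x. x \<ge> 1 \<Longrightarrow> measure N {x<..} = x powr (- \<alpha>)"
  shows "N = pareto_law \<alpha>"
proof -
  interpret prob_space N by fact
  have [simp]: "space N = UNIV" using sets_eq_imp_space_eq[of N borel] by simp
  have "measure N {x<..} = max 1 x powr (- \<alpha>)" for x
  proof (cases "x \<ge> 1")
    case False
    then have "measure N {1<..} \<le> measure N {x<..}" by (intro finite_measure_mono) auto
    then show ?thesis using tail[of 1] False by (simp add: antisym)
  qed (simp add: tail max_def)
  then show ?thesis
    using \<open>\<alpha> > 0\<close>
    by (intro measure_eqI_lessThan) (simp_all add: emeasure_eq_measure emeasure_pareto_law_greaterThan)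
qed

text \<open>On \<open>(\<epsilon>, \<infinity>)\<close> the Pareto law is exactly regularly varying: no limit is involved
  once the threshold exceeds the left end point of the scaled law.\<close>

lemma pareto_law_scaling:
  fixes g :: "real \<Rightarrow> real"
  assumes "\<alpha> > 0" "v > 0" "u > 0" "\<epsilon> > 0" "v \<le> \<epsilon> * u" and [measurable]: "g \<in> borel_measurable borel"
  shows "(\<integral>r. u powr \<alpha> * indicator {\<epsilon><..} (v * r / u) * g (v * r / u) \<partial>pareto_law \<alpha>) =
         (\<integral>r. v powr \<alpha> * indicator {\<epsilon><..} r * g r \<partial>pareto_intensity \<alpha>)"
proof -
  \<comment> \<open>The identity for all g is one equality of measures. Both are finite and carried
    by (\<epsilon>, \<infinity>), so comparing open right tails suffices.\<close>
  let ?N1 = "density (distr (pareto_law \<alpha>) borel (\<lambda>r. v * r / u)) (\<lambda>r. ennreal (u powr \<alpha> * indicator {\<epsilon><..} r))"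
  let ?N2 = "density (pareto_intensity \<alpha>) (\<lambda>r. ennreal (v powr \<alpha> * indicator {\<epsilon><..} r))"
  have N1: "emeasure ?N1 {x<..} = ennreal ((v / max \<epsilon> x) powr \<alpha>)" for x
  proof -
    have "emeasure ?N1 {x<..} =
        (\<integral>\<^sup>+r. ennreal (u powr \<alpha>) * indicator {u * max \<epsilon> x / v<..} r \<partial>pareto_law \<alpha>)"
    proof (subst emeasure_density, simp, simp, subst nn_integral_distr, simp, simp, intro nn_integral_cong)
      fix r
      have "\<epsilon> < v * r / u \<and> x < v * r / u \<longleftrightarrow> u * max \<epsilon> x / v < r"
        unfolding max_less_iff_conj[symmetric] using assms by (simp add: field_simps del: max_less_iff_conj)
      then show "ennreal (u powr \<alpha> * indicator {\<epsilon><..} (v * r / u)) * indicator {x<..} (v * r / u) =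
          ennreal (u powr \<alpha>) * indicator {u * max \<epsilon> x / v<..} r"
        by (auto split: split_indicator)
    qed
    also have "\<dots> = ennreal (u powr \<alpha>) * ennreal (max 1 (u * max \<epsilon> x / v) powr (- \<alpha>))"
      using emeasure_pareto_law_greaterThan[OF \<open>\<alpha> > 0\<close>, of "u * max \<epsilon> x / v"]
      by (simp add: nn_integral_cmult_indicator)
    \<comment> \<open>The hypothesis v \<le> \<epsilon> u acts here: the rescaled threshold is at
      least 1, the range where the Pareto tail is an exact power.\<close>
    also have "max 1 (u * max \<epsilon> x / v) = u * max \<epsilon> x / v"
    proof -
      have "v \<le> u * max \<epsilon> x"
        by (rule order_trans[OF \<open>v \<le> \<epsilon> * u\<close>]) (use \<open>u > 0\<close> in simp)
      then show ?thesis using assms by (simp add: max_def)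
    qed
    also have "ennreal (u powr \<alpha>) * ennreal ((u * max \<epsilon> x / v) powr (- \<alpha>)) =
        ennreal ((v / max \<epsilon> x) powr \<alpha>)"
      using assms by (simp add: ennreal_mult[symmetric] powr_mult powr_divide powr_minus field_simps)
    finally show ?thesis .
  qed
  have N2: "emeasure ?N2 {x<..} = ennreal ((v / max \<epsilon> x) powr \<alpha>)" for x
  proof -
    have "emeasure ?N2 {x<..} =
        (\<integral>\<^sup>+r. ennreal (v powr \<alpha>) * indicator {max \<epsilon> x<..} r \<partial>pareto_intensity \<alpha>)"
      by (subst emeasure_density) (auto simp: indicator_def intro!: nn_integral_cong)
    also have "\<dots> = ennreal (v powr \<alpha>) * ennreal (max \<epsilon> x powr (- \<alpha>))"
      using emeasure_pareto_intensity_greaterThan[OF \<open>\<alpha> > 0\<close>, of "max \<epsilon> x"] assms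
      by (simp add: nn_integral_cmult_indicator)
    also have "\<dots> = ennreal ((v / max \<epsilon> x) powr \<alpha>)"
      using assms by (simp add: ennreal_mult[symmetric] powr_divide powr_minus field_simps)
    finally show ?thesis .
  qed
  have "?N1 = ?N2"
    by (rule measure_eqI_lessThan) (auto simp: N1 N2)
  then have "(\<integral>r. g r \<partial>?N1) = (\<integral>r. g r \<partial>?N2)" by simp
  also have "(\<integral>r. g r \<partial>?N2) = (\<integral>r. v powr \<alpha> * indicator {\<epsilon><..} r * g r \<partial>pareto_intensity \<alpha>)"
    by (subst integral_real_density) auto
  also have "(\<integral>r. g r \<partial>?N1) = (\<integral>r. u powr \<alpha> * indicator {\<epsilon><..} r * g r \<partial>distr (pareto_law \<alpha>) borel (\<lambda>r. v * r / u))"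
    by (subst integral_real_density) auto
  also have "\<dots> = (\<integral>r. u powr \<alpha> * indicator {\<epsilon><..} (v * r / u) * g (v * r / u) \<partial>pareto_law \<alpha>)"
    by (subst integral_distr) auto
  finally show ?thesis .
qed

section \<open>One big jump\<close>

definition pareto_field :: "real \<Rightarrow> (int \<Rightarrow> real) measure" where
  "pareto_field \<alpha> = (\<Pi>\<^sub>M k\<in>UNIV. pareto_law \<alpha>)"

lemma sets_pareto_field [measurable_cong, simp]: "sets (pareto_field \<alpha>) = sets borel"
proof -
  have "sets (pareto_field \<alpha>) = sets (\<Pi>\<^sub>M k\<in>(UNIV::int set). (borel :: real measure))"
    unfolding pareto_field_def by (intro sets_PiM_cong) auto
  then show ?thesis by (simp add: sets_PiM_equal_borel)
qed

lemma space_pareto_field [simp]: "space (pareto_field \<alpha>) = UNIV"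
  by (simp add: pareto_field_def space_PiM)

lemma prob_space_pareto_field: "\<alpha> > 0 \<Longrightarrow> prob_space (pareto_field \<alpha>)"
  unfolding pareto_field_def by (intro prob_space_PiM prob_space_pareto_law)

lemma measurable_coordinate [measurable]:
  "(\<lambda>x :: 'i :: countable \<Rightarrow> real. x k) \<in> borel_measurable borel"
  by (rule measurable_product_coordinates)

lemma measurable_path:
  fixes f :: "'a \<Rightarrow> 'i :: countable \<Rightarrow> real"
  assumes "\<And>k. (\<lambda>x. f x k) \<in> borel_measurable N"
  shows "f \<in> borel_measurable N"
  using assms by (rule measurable_coordinatewise_then_product)

lemma AE_pareto_field:
  assumes "\<alpha> > 0"
  shows "AE x in pareto_field \<alpha>. \<forall>k. 1 < x k"
  unfolding pareto_field_def
  by (subst AE_all_countable)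
     (auto intro!: AE_PiM_component AE_pareto_law prob_space_pareto_law assms)

lemma integral_pareto_field_coordinate:
  fixes f :: "real \<Rightarrow> real"
  assumes "\<alpha> > 0" and [measurable]: "f \<in> borel_measurable borel"
  shows "(\<integral>x. f (x k) \<partial>pareto_field \<alpha>) = (\<integral>r. f r \<partial>pareto_law \<alpha>)"
proof -
  have "pareto_law \<alpha> = distr (pareto_field \<alpha>) (pareto_law \<alpha>) (\<lambda>x. x k)"
    unfolding pareto_field_def
    by (rule distr_PiM_component[symmetric]) (auto intro: prob_space_pareto_law assms)
  then have "(\<integral>r. f r \<partial>pareto_law \<alpha>) = (\<integral>r. f r \<partial>distr (pareto_field \<alpha>) (pareto_law \<alpha>) (\<lambda>x. x k))"
    by (rule arg_cong)
  then show ?thesis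
    by (subst (asm) integral_distr) (auto simp: measurable_cong_sets[OF sets_pareto_field sets_pareto_law]
      measurable_cong_sets[OF sets_pareto_law refl])
qed

text \<open>Overwriting coordinate s of an iid field by an independent copy leaves its law
  unchanged. Fubini then isolates the coordinate of the big jump in an inner integral while the rest
  of the field is frozen.\<close>

lemma integral_pareto_field_resample:
  fixes G :: "(int \<Rightarrow> real) \<Rightarrow> real"
  assumes "\<alpha> > 0" and [measurable]: "G \<in> borel_measurable borel" and bd: "\<And>x. \<bar>G x\<bar> \<le> B"
  shows "(\<integral>x. G x \<partial>pareto_field \<alpha>) = (\<integral>y. (\<integral>r. G (y(s := r)) \<partial>pareto_law \<alpha>) \<partial>pareto_field \<alpha>)"
proof -
  interpret P: prob_space "pareto_law \<alpha>" by (rule prob_space_pareto_law) fact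
  interpret Q: prob_space "pareto_field \<alpha>" by (rule prob_space_pareto_field) fact
  interpret PQ: pair_prob_space "pareto_law \<alpha>" "pareto_field \<alpha>" ..
  have [measurable]: "(\<lambda>(r, y). y(s := r)) \<in> borel_measurable (pareto_law \<alpha> \<Otimes>\<^sub>M pareto_field \<alpha>)"
  proof (rule measurable_path)
    fix k
    have "(\<lambda>x. case x of (r, y) \<Rightarrow> (y(s := r)) k) = (\<lambda>x. if k = s then fst x else snd x k)"
      by (auto simp: fun_eq_iff)
    moreover have "(\<lambda>x. if k = s then fst x else snd x k) \<in> borel_measurable (pareto_law \<alpha> \<Otimes>\<^sub>M pareto_field \<alpha>)"
      by measurable
    ultimately show "(\<lambda>x. (case x of (r, y) \<Rightarrow> y(s := r)) k) \<in> borel_measurable (pareto_law \<alpha> \<Otimes>\<^sub>M pareto_field \<alpha>)"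
      by (simp add: case_prod_unfold)
  qed
  have [measurable]: "(\<lambda>(r, y). y(s := r)) \<in> measurable (pareto_law \<alpha> \<Otimes>\<^sub>M pareto_field \<alpha>) (pareto_field \<alpha>)"
    using measurable_cong_sets[OF refl sets_pareto_field[of \<alpha>]] by measurable
  have eq: "distr (pareto_law \<alpha> \<Otimes>\<^sub>M pareto_field \<alpha>) (pareto_field \<alpha>) (\<lambda>(r, y). y(s := r)) = pareto_field \<alpha>"
    using distr_pair_PiM_eq_PiM[of UNIV "\<lambda>_. pareto_law \<alpha>" s] P.prob_space_axioms
    by (simp add: pareto_field_def)
  have "(\<integral>x. G x \<partial>pareto_field \<alpha>) = (\<integral>(r, y). G (y(s := r)) \<partial>(pareto_law \<alpha> \<Otimes>\<^sub>M pareto_field \<alpha>))"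
    by (subst (1) eq[symmetric], subst integral_distr) (auto simp: case_prod_unfold)
  also have "\<dots> = (\<integral>y. (\<integral>r. G (y(s := r)) \<partial>pareto_law \<alpha>) \<partial>pareto_field \<alpha>)"
    by (rule PQ.integral_snd[symmetric], rule PQ.P.integrable_const_bound[of _ B])
       (auto simp: bd case_prod_unfold)
  finally show ?thesis .
qed

lemma measurable_fun_upd_value: "(\<lambda>r. z(s := r)) \<in> borel_measurable borel"
  for z :: "int \<Rightarrow> real"
proof (rule measurable_path)
  show "(\<lambda>r. (z(s := r)) k) \<in> borel_measurable borel" for k
    by (cases "k = s") simp_all
qed

text \<open>Coordinate s is resampled and its law is scaled exactly, which absorbs the factor
  \<open>U n powr \<alpha>\<close>; all other coordinates are divided by \<open>U n\<close> and
  vanish. This is why \<open>lim\<close> keeps coordinate s fixed at r along the sequence. The limit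
  g is separate from G because the functional used later also demands that s be the first large
  index, a condition that disappears in the limit.\<close>

lemma single_jump_limit:
  fixes G :: "(int \<Rightarrow> real) \<Rightarrow> real"
  assumes \<alpha>: "\<alpha> > 0" and v: "\<And>k. v k > 0" and U: "filterlim U at_top sequentially" and "\<epsilon> > 0"
    and [measurable]: "G \<in> borel_measurable borel" "g \<in> borel_measurable borel"
    and bd: "\<And>z. \<bar>G z\<bar> \<le> B"
    and zero: "\<And>z. z s \<le> \<epsilon> \<Longrightarrow> G z = 0"
    and lim: "AE r in pareto_intensity \<alpha>. \<forall>Z. (\<forall>n. Z n s = r) \<longrightarrow>
                (\<forall>k. k \<noteq> s \<longrightarrow> (\<lambda>n. Z n k) \<longlonglongrightarrow> 0) \<longrightarrow> (\<lambda>n. G (Z n)) \<longlonglongrightarrow> g r"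
  shows "(\<lambda>n. U n powr \<alpha> * (\<integral>x. G (\<lambda>k. v k * x k / U n) \<partial>pareto_field \<alpha>))
           \<longlonglongrightarrow> v s powr \<alpha> * (\<integral>r. g r \<partial>pareto_intensity \<alpha>)"
proof -
  interpret P: prob_space "pareto_law \<alpha>" by (rule prob_space_pareto_law) fact
  interpret Q: prob_space "pareto_field \<alpha>" by (rule prob_space_pareto_field) fact
  interpret PI: sigma_finite_measure "pareto_intensity \<alpha>" by (rule sigma_finite_pareto_intensity)
  \<comment> \<open>After the change of variable, coordinate s holds r itself; only the other
    coordinates still depend on \<open>U n\<close>.\<close>
  define h where "h n y r = v s powr \<alpha> * indicator {\<epsilon><..} r * G ((\<lambda>k. v k * y k / U n)(s := r))" for n y r
  have [measurable]: "(\<lambda>x. (\<lambda>k. v k * x k / U n)) \<in> borel_measurable borel" for n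
    by (rule measurable_path) measurable
  have "(\<lambda>x. (\<lambda>k. v k * fst x k / U n)(s := snd x)) \<in> borel_measurable (pareto_field \<alpha> \<Otimes>\<^sub>M pareto_intensity \<alpha>)" for n
  proof (rule measurable_path)
    fix k
    show "(\<lambda>x. ((\<lambda>k. v k * fst x k / U n)(s := snd x)) k) \<in> borel_measurable (pareto_field \<alpha> \<Otimes>\<^sub>M pareto_intensity \<alpha>)"
      by (cases "k = s") simp_all
  qed
  from measurable_compose[OF this \<open>G \<in> borel_measurable borel\<close>]
  have [measurable]: "case_prod (h n) \<in> borel_measurable (pareto_field \<alpha> \<Otimes>\<^sub>M pareto_intensity \<alpha>)" for n
    unfolding h_def case_prod_unfold by measurable
  have h_meas: "h n y \<in> borel_measurable (pareto_intensity \<alpha>)" for n y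
    using measurable_compose[OF measurable_Pair1'[of y "pareto_field \<alpha>" "pareto_intensity \<alpha>"], of "case_prod (h n)" borel]
    by simp
  have B: "B \<ge> 0" using bd[of undefined] by linarith
  \<comment> \<open>The intensity has infinite mass near 0. Cutting at \<epsilon>, allowed because G
    vanishes when coordinate s is at most \<epsilon>, is what makes a constant multiple of an
    indicator an integrable bound.\<close>
  have fin: "emeasure (pareto_intensity \<alpha>) {\<epsilon><..} < \<infinity>"
    using emeasure_pareto_intensity_greaterThan[OF \<alpha> \<open>\<epsilon> > 0\<close>] by simp
  have dom: "integrable (pareto_intensity \<alpha>) (\<lambda>r. v s powr \<alpha> * B * indicator {\<epsilon><..} r)"
    using fin by (intro integrable_mult_right integrable_real_indicator) auto
  have h_le: "norm (h n y r) \<le> v s powr \<alpha> * B * indicator {\<epsilon><..} r" for n y r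
    unfolding h_def using bd by (auto simp: abs_mult split: split_indicator intro!: mult_left_mono)
  have U0: "\<forall>\<^sub>F n in sequentially. 0 < U n \<and> v s \<le> \<epsilon> * U n"
    using filterlim_at_top_dense[THEN iffD1, OF U, rule_format, of 0]
      filterlim_at_top[THEN iffD1, OF U, rule_format, of "v s / \<epsilon>"]
    by eventually_elim (use \<open>\<epsilon> > 0\<close> in \<open>simp add: field_simps\<close>)
  have eq: "U n powr \<alpha> * (\<integral>x. G (\<lambda>k. v k * x k / U n) \<partial>pareto_field \<alpha>) =
      (\<integral>y. (\<integral>r. h n y r \<partial>pareto_intensity \<alpha>) \<partial>pareto_field \<alpha>)"
    if n: "0 < U n \<and> v s \<le> \<epsilon> * U n" for n
  proof -
    have "U n powr \<alpha> * (\<integral>x. G (\<lambda>k. v k * x k / U n) \<partial>pareto_field \<alpha>) =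
        (\<integral>y. U n powr \<alpha> * (\<integral>r. G (\<lambda>k. v k * (y(s := r)) k / U n) \<partial>pareto_law \<alpha>) \<partial>pareto_field \<alpha>)"
      using integral_pareto_field_resample[OF \<alpha>, of "\<lambda>x. G (\<lambda>k. v k * x k / U n)" B s] bd
      by simp
    also have "\<dots> = (\<integral>y. (\<integral>r. h n y r \<partial>pareto_intensity \<alpha>) \<partial>pareto_field \<alpha>)"
    proof (rule Bochner_Integration.integral_cong[OF refl])
      fix y :: "int \<Rightarrow> real"
      have "(\<lambda>k. v k * (y(s := r)) k / U n) = (\<lambda>k. v k * y k / U n)(s := v s * r / U n)" for r
        by auto
      \<comment> \<open>The indicator is inserted for free, since G is zero off it, and brings the
        integrand to the shape of \<open>pareto_law_scaling\<close>.\<close>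
      then have "U n powr \<alpha> * (\<integral>r. G (\<lambda>k. v k * (y(s := r)) k / U n) \<partial>pareto_law \<alpha>) =
         (\<integral>r. U n powr \<alpha> * indicator {\<epsilon><..} (v s * r / U n) *
            G ((\<lambda>k. v k * y k / U n)(s := v s * r / U n)) \<partial>pareto_law \<alpha>)"
        by (subst integral_mult_right_zero[symmetric], intro Bochner_Integration.integral_cong refl)
           (auto simp: zero split: split_indicator)
      also have "\<dots> = (\<integral>r. h n y r \<partial>pareto_intensity \<alpha>)"
        unfolding h_def using n v \<alpha> \<open>\<epsilon> > 0\<close>
        by (intro pareto_law_scaling measurable_compose[OF measurable_fun_upd_value]) auto
      finally show "U n powr \<alpha> * (\<integral>r. G (\<lambda>k. v k * (y(s := r)) k / U n) \<partial>pareto_law \<alpha>) =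
         (\<integral>r. h n y r \<partial>pareto_intensity \<alpha>)" .
    qed
    finally show ?thesis .
  qed
  have inner: "(\<lambda>n. \<integral>r. h n y r \<partial>pareto_intensity \<alpha>) \<longlonglongrightarrow> (\<integral>r. v s powr \<alpha> * g r \<partial>pareto_intensity \<alpha>)" for y
  proof (rule integral_dominated_convergence[OF _ _ dom])
    have small: "(\<lambda>n. v k * y k / U n) \<longlonglongrightarrow> 0" for k
      by (rule tendsto_divide_0[OF tendsto_const filterlim_at_top_imp_at_infinity[OF U]])
    show "AE r in pareto_intensity \<alpha>. (\<lambda>n. h n y r) \<longlonglongrightarrow> v s powr \<alpha> * g r"
      using lim
    proof eventually_elim
      case (elim r)
      have "(\<lambda>n. G ((\<lambda>k. v k * y k / U n)(s := r))) \<longlonglongrightarrow> g r"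
        by (rule elim[rule_format]) (auto simp: small)
      moreover have *: "indicator {\<epsilon><..} r * G ((\<lambda>k. v k * y k / U n)(s := r)) = G ((\<lambda>k. v k * y k / U n)(s := r))" for n
        by (auto simp: zero split: split_indicator)
      ultimately show ?case
        unfolding h_def mult.assoc * by (intro tendsto_mult_left)
    qed
    show "h n y \<in> borel_measurable (pareto_intensity \<alpha>)" for n
      by (rule h_meas)
    show "AE r in pareto_intensity \<alpha>. norm (h n y r) \<le> v s powr \<alpha> * B * indicator {\<epsilon><..} r" for n
      by (rule AE_I2) (rule h_le)
    show "(\<lambda>r. v s powr \<alpha> * g r) \<in> borel_measurable (pareto_intensity \<alpha>)"
      unfolding measurable_cong_sets[OF sets_pareto_intensity refl]
      using \<open>g \<in> borel_measurable borel\<close> by (rule borel_measurable_const[THEN borel_measurable_times])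
  qed
  have "(\<lambda>n. \<integral>y. (\<integral>r. h n y r \<partial>pareto_intensity \<alpha>) \<partial>pareto_field \<alpha>)
      \<longlonglongrightarrow> (\<integral>y. (\<integral>r. v s powr \<alpha> * g r \<partial>pareto_intensity \<alpha>) \<partial>pareto_field \<alpha>)"
  proof (rule integral_dominated_convergence)
    show "(\<lambda>y. \<integral>r. h n y r \<partial>pareto_intensity \<alpha>) \<in> borel_measurable (pareto_field \<alpha>)" for n
      by (rule PI.borel_measurable_lebesgue_integral) measurable
    show "AE y in pareto_field \<alpha>. norm (\<integral>r. h n y r \<partial>pareto_intensity \<alpha>) \<le>
        (\<integral>r. v s powr \<alpha> * B * indicator {\<epsilon><..} r \<partial>pareto_intensity \<alpha>)" for n
      by (intro AE_I2 Bochner_Integration.integral_norm_bound_integral[OF _ dom] Bochner_Integration.integrable_bound[OF dom] h_meas)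
         (use h_le in \<open>auto intro: order_trans[OF _ abs_ge_self]\<close>)
    show "AE y in pareto_field \<alpha>. (\<lambda>n. \<integral>r. h n y r \<partial>pareto_intensity \<alpha>) \<longlonglongrightarrow> (\<integral>r. v s powr \<alpha> * g r \<partial>pareto_intensity \<alpha>)"
      by (rule AE_I2) (rule inner)
  qed simp_all
  also have "(\<integral>y. (\<integral>r. v s powr \<alpha> * g r \<partial>pareto_intensity \<alpha>) \<partial>pareto_field \<alpha>) =
      v s powr \<alpha> * (\<integral>r. g r \<partial>pareto_intensity \<alpha>)"
    by (simp add: Q.prob_space[simplified])
  finally show ?thesis
    by (rule Lim_transform_eventually) (rule eventually_mono[OF U0 eq[symmetric]])
qed

text \<open>Splitting according to the first index at which the threshold is exceeded is an exact
  identity, so no estimate for the event of two big jumps is needed.\<close>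

theorem one_big_jump:
  fixes G :: "(int \<Rightarrow> real) \<Rightarrow> real"
  assumes \<alpha>: "\<alpha> > 0" and v: "\<And>k. v k > 0" and U: "filterlim U at_top sequentially" and "\<epsilon> > 0"
    and "finite S"
    and [measurable]: "G \<in> borel_measurable borel"
    and bd: "\<And>z. \<bar>G z\<bar> \<le> B"
    and zero: "\<And>z. (\<And>k. 0 \<le> z k) \<Longrightarrow> (\<And>s. s \<in> S \<Longrightarrow> z s \<le> \<epsilon>) \<Longrightarrow> G z = 0"
    and lim: "\<And>s. s \<in> S \<Longrightarrow> AE r in pareto_intensity \<alpha>. \<forall>Z. (\<forall>n. Z n s = r) \<longrightarrow>
                (\<forall>k. k \<noteq> s \<longrightarrow> (\<lambda>n. Z n k) \<longlonglongrightarrow> 0) \<longrightarrow> (\<lambda>n. G (Z n)) \<longlonglongrightarrow> G ((\<lambda>_. 0)(s := r))"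
  shows "(\<lambda>n. U n powr \<alpha> * (\<integral>x. G (\<lambda>k. v k * x k / U n) \<partial>pareto_field \<alpha>))
           \<longlonglongrightarrow> (\<Sum>s\<in>S. v s powr \<alpha> * (\<integral>r. G ((\<lambda>_. 0)(s := r)) \<partial>pareto_intensity \<alpha>))"
proof -
  interpret Q: prob_space "pareto_field \<alpha>" by (rule prob_space_pareto_field) fact
  define first where "first s z \<longleftrightarrow> z s > \<epsilon> \<and> (\<forall>s'\<in>S. s' < s \<longrightarrow> z s' \<le> \<epsilon>)" for s and z :: "int \<Rightarrow> real"
  define G' where "G' s z = (if first s z then G z else 0)" for s z
  note [measurable] = \<open>finite S\<close>[THEN countable_finite]
  have [measurable]: "Measurable.pred borel (first s)" for s
    unfolding first_def by measurable
  have [measurable]: "G' s \<in> borel_measurable borel" for s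
    unfolding G'_def by measurable
  have [measurable]: "(\<lambda>x. (\<lambda>k. v k * x k / U n)) \<in> borel_measurable borel" for n
    by (rule measurable_path) measurable
  have first_unique: "s = s'" if "first s z" "first s' z" "s \<in> S" "s' \<in> S" for s s' z
    using that by (meson first_def linorder_neqE not_le)
  have first_exists: "\<exists>s\<in>S. first s z" if "\<exists>s\<in>S. z s > \<epsilon>" for z
  proof -
    let ?A = "{s \<in> S. z s > \<epsilon>}"
    have A: "finite ?A" "?A \<noteq> {}" using \<open>finite S\<close> that by auto
    have "z s' \<le> \<epsilon>" if "s' \<in> S" "s' < Min ?A" for s'
      using that Min_le[OF A(1), of s'] by force
    then show ?thesis using Min_in[OF A] unfolding first_def by blast
  qed
  have sum_G': "G z = (\<Sum>s\<in>S. G' s z)" if "\<And>k. 0 \<le> z k" for z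
  proof (cases "\<exists>s\<in>S. z s > \<epsilon>")
    case True
    then obtain s where s: "s \<in> S" "first s z" using first_exists by blast
    have "(\<Sum>s\<in>S. G' s z) = (\<Sum>s'\<in>S. if s' = s then G z else 0)"
    proof (intro sum.cong refl)
      fix s' assume "s' \<in> S"
      then show "G' s' z = (if s' = s then G z else 0)"
        using first_unique[of s' z s] s by (cases "first s' z") (auto simp: G'_def)
    qed
    then show ?thesis using s \<open>finite S\<close> by simp
  next
    case False
    then have "G z = 0" using that by (intro zero) auto
    moreover have "G' s z = 0" if "s \<in> S" for s
      using False that by (auto simp: G'_def first_def)
    ultimately show ?thesis by simp
  qed
  have bd': "\<bar>G' s z\<bar> \<le> \<bar>B\<bar>" for s z
    using bd[of z] by (auto simp: G'_def)
  have int: "integrable (pareto_field \<alpha>) (\<lambda>x. G' s (\<lambda>k. v k * x k / U n))" for s n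
    by (rule Q.integrable_const_bound[of _ "\<bar>B\<bar>"]) (auto simp: bd')
  have U0: "\<forall>\<^sub>F n in sequentially. 0 < U n"
    using filterlim_at_top_dense[THEN iffD1, OF U, rule_format, of 0] .
  have "(\<lambda>n. U n powr \<alpha> * (\<integral>x. G' s (\<lambda>k. v k * x k / U n) \<partial>pareto_field \<alpha>))
           \<longlonglongrightarrow> v s powr \<alpha> * (\<integral>r. G ((\<lambda>_. 0)(s := r)) \<partial>pareto_intensity \<alpha>)" if "s \<in> S" for s
  proof (rule single_jump_limit[OF \<alpha> v U \<open>\<epsilon> > 0\<close>])
    show "AE r in pareto_intensity \<alpha>. \<forall>Z. (\<forall>n. Z n s = r) \<longrightarrow>
        (\<forall>k. k \<noteq> s \<longrightarrow> (\<lambda>n. Z n k) \<longlonglongrightarrow> 0) \<longrightarrow> (\<lambda>n. G' s (Z n)) \<longlonglongrightarrow> G ((\<lambda>_. 0)(s := r))"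
      using lim[OF that] AE_pareto_intensity_pos
    proof eventually_elim
      case (elim r)
      show ?case
      proof (intro allI impI)
        fix Z :: "nat \<Rightarrow> int \<Rightarrow> real"
        assume Z: "\<forall>n. Z n s = r" "\<forall>k. k \<noteq> s \<longrightarrow> (\<lambda>n. Z n k) \<longlonglongrightarrow> 0"
        show "(\<lambda>n. G' s (Z n)) \<longlonglongrightarrow> G ((\<lambda>_. 0)(s := r))"
        proof (cases "r > \<epsilon>")
          \<comment> \<open>The spike is above the threshold and every other index of S eventually
            lies below it, so s is eventually the first large index and \<open>G'\<close> agrees
            with G.\<close>
          case True
          have "\<forall>\<^sub>F n in sequentially. \<forall>s'\<in>S - {s}. Z n s' < \<epsilon>"
            using Z(2) \<open>\<epsilon> > 0\<close> \<open>finite S\<close>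
            by (intro eventually_ball_finite) (auto intro: order_tendstoD(2))
          then have "\<forall>\<^sub>F n in sequentially. G (Z n) = G' s (Z n)"
            by eventually_elim (use True Z(1) in \<open>force simp: G'_def first_def\<close>)
          then show ?thesis
            using elim(1) Z by (blast intro: Lim_transform_eventually)
        next
          case False
          then have "G ((\<lambda>_. 0)(s := r)) = 0"
            using elim(2) \<open>\<epsilon> > 0\<close> by (intro zero) auto
          then show ?thesis using False Z(1) by (simp add: G'_def first_def)
        qed
      qed
    qed
    show "\<bar>G' s z\<bar> \<le> \<bar>B\<bar>" for z by (rule bd')
    show "(\<lambda>r. G ((\<lambda>_. 0)(s := r))) \<in> borel_measurable borel"
      by (rule measurable_compose[OF measurable_fun_upd_value]) simp
  qed (auto simp: G'_def first_def)
  then have lim_sum: "(\<lambda>n. \<Sum>s\<in>S. U n powr \<alpha> * (\<integral>x. G' s (\<lambda>k. v k * x k / U n) \<partial>pareto_field \<alpha>))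
           \<longlonglongrightarrow> (\<Sum>s\<in>S. v s powr \<alpha> * (\<integral>r. G ((\<lambda>_. 0)(s := r)) \<partial>pareto_intensity \<alpha>))"
    by (rule tendsto_sum)
  have sum_eq: "(\<Sum>s\<in>S. U n powr \<alpha> * (\<integral>x. G' s (\<lambda>k. v k * x k / U n) \<partial>pareto_field \<alpha>)) =
      U n powr \<alpha> * (\<integral>x. G (\<lambda>k. v k * x k / U n) \<partial>pareto_field \<alpha>)" if "0 < U n" for n
  proof -
    have "(\<integral>x. G (\<lambda>k. v k * x k / U n) \<partial>pareto_field \<alpha>) =
        (\<integral>x. (\<Sum>s\<in>S. G' s (\<lambda>k. v k * x k / U n)) \<partial>pareto_field \<alpha>)"
    proof (rule integral_cong_AE)
      \<comment> \<open>Pareto coordinates exceed 1 almost surely, so the scaled coordinates are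
        nonnegative, as the hypothesis \<open>zero\<close> requires.\<close>
      show "AE x in pareto_field \<alpha>. G (\<lambda>k. v k * x k / U n) = (\<Sum>s\<in>S. G' s (\<lambda>k. v k * x k / U n))"
        using AE_pareto_field[OF \<alpha>]
      proof eventually_elim
        case (elim x)
        have "0 \<le> v k * x k / U n" for k
          using elim[rule_format, of k] v[of k] that by simp
        then show ?case by (rule sum_G')
      qed
    qed measurable
    then show ?thesis
      by (simp add: int sum_distrib_left)
  qed
  show ?thesis
    by (rule Lim_transform_eventually[OF lim_sum eventually_mono[OF U0 sum_eq]])
qed

text \<open>A union bound over S: if G is nonzero, some scaled innovation in S exceeds \<epsilon>.
  The bound does not depend on u and is linear in the weights \<open>v s powr \<alpha>\<close>, so
  it can dominate the limit under the volatility law; for two rows the product of two such bounds is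
  quadratic in these weights.\<close>

lemma one_big_jump_bound:
  fixes G :: "(int \<Rightarrow> real) \<Rightarrow> real"
  assumes \<alpha>: "\<alpha> > 0" and v: "\<And>k. v k > 0" and u: "u > 0" and "\<epsilon> > 0" and "finite S"
    and [measurable]: "G \<in> borel_measurable borel"
    and bd: "\<And>z. \<bar>G z\<bar> \<le> B"
    and zero: "\<And>z. (\<And>k. 0 \<le> z k) \<Longrightarrow> (\<And>s. s \<in> S \<Longrightarrow> z s \<le> \<epsilon>) \<Longrightarrow> G z = 0"
  shows "\<bar>u powr \<alpha> * (\<integral>x. G (\<lambda>k. v k * x k / u) \<partial>pareto_field \<alpha>)\<bar>
           \<le> B * \<epsilon> powr (- \<alpha>) * (\<Sum>s\<in>S. v s powr \<alpha>)"
proof -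
  interpret P: prob_space "pareto_law \<alpha>" by (rule prob_space_pareto_law) fact
  interpret Q: prob_space "pareto_field \<alpha>" by (rule prob_space_pareto_field) fact
  have B: "B \<ge> 0" using bd[of undefined] by linarith
  have [measurable]: "(\<lambda>x. (\<lambda>k. v k * x k / u)) \<in> borel_measurable borel"
    by (rule measurable_path) measurable
  let ?I = "\<lambda>x. \<Sum>s\<in>S. B * indicator {\<epsilon> * u / v s<..} (x s)"
  have ind: "integrable (pareto_field \<alpha>) (\<lambda>x. indicator {a<..} (x s) :: real)" for a s
    by (rule Q.integrable_const_bound[of _ 1]) auto
  have "\<bar>\<integral>x. G (\<lambda>k. v k * x k / u) \<partial>pareto_field \<alpha>\<bar> \<le> (\<integral>x. ?I x \<partial>pareto_field \<alpha>)"
  proof (rule order_trans[OF integral_abs_bound integral_mono_AE])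
    show "integrable (pareto_field \<alpha>) (\<lambda>x. \<bar>G (\<lambda>k. v k * x k / u)\<bar>)"
      by (rule Q.integrable_const_bound[of _ B]) (auto simp: bd)
    show "integrable (pareto_field \<alpha>) ?I"
      by (intro Bochner_Integration.integrable_sum integrable_mult_right ind)
    show "AE x in pareto_field \<alpha>. \<bar>G (\<lambda>k. v k * x k / u)\<bar> \<le> ?I x"
      using AE_pareto_field[OF \<alpha>]
    proof eventually_elim
      case (elim x)
      have pos: "0 \<le> v k * x k / u" for k
        using elim[rule_format, of k] v[of k] u by simp
      show ?case
      proof (cases "\<exists>s\<in>S. v s * x s / u > \<epsilon>")
        case True
        then obtain s where s: "s \<in> S" "v s * x s / u > \<epsilon>" by blast
        then have "B = B * indicator {\<epsilon> * u / v s<..} (x s)"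
          using v[of s] u by (simp add: field_simps)
        also have "\<dots> \<le> ?I x"
          using s \<open>finite S\<close> B by (intro member_le_sum) (auto split: split_indicator)
        finally show ?thesis using bd[of "\<lambda>k. v k * x k / u"] by simp
      next
        case False
        then have "G (\<lambda>k. v k * x k / u) = 0" using pos by (intro zero) auto
        then show ?thesis using B by (auto intro!: sum_nonneg split: split_indicator)
      qed
    qed
  qed
  also have "\<dots> = (\<Sum>s\<in>S. B * measure (pareto_law \<alpha>) {\<epsilon> * u / v s<..})"
    using integral_pareto_field_coordinate[OF \<alpha>, of "indicator _"]
    by (simp add: ind)
  also have "\<dots> \<le> (\<Sum>s\<in>S. B * (\<epsilon> * u / v s) powr (- \<alpha>))"
    using B u v \<open>\<epsilon> > 0\<close> \<alpha> by (intro sum_mono mult_left_mono measure_pareto_law_le) auto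
  also have "\<dots> = u powr (- \<alpha>) * (B * \<epsilon> powr (- \<alpha>) * (\<Sum>s\<in>S. v s powr \<alpha>))"
    using u v \<open>\<epsilon> > 0\<close>
    by (simp add: sum_distrib_left powr_mult powr_divide powr_minus field_simps less_imp_le)
  finally have "u powr \<alpha> * \<bar>\<integral>x. G (\<lambda>k. v k * x k / u) \<partial>pareto_field \<alpha>\<bar> \<le>
      u powr \<alpha> * (u powr (- \<alpha>) * (B * \<epsilon> powr (- \<alpha>) * (\<Sum>s\<in>S. v s powr \<alpha>)))"
    by (rule mult_left_mono) simp
  also have "\<dots> = B * \<epsilon> powr (- \<alpha>) * (\<Sum>s\<in>S. v s powr \<alpha>)"
    using u by (simp add: powr_minus)
  finally show ?thesis by (simp add: abs_mult)
qed

section \<open>The joint law of volatility and innovations\<close>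

locale volatility_model = prob_space M
  for M :: "'a measure" and \<alpha> :: real and V :: "int \<Rightarrow> 'a \<Rightarrow> real" and \<eta> :: "nat \<Rightarrow> int \<Rightarrow> 'a \<Rightarrow> real" +
  assumes \<alpha>_pos: "\<alpha> > 0" and volatility: "volatility M \<alpha> V"
    and pareto: "pareto_innovations M \<alpha> \<eta>" and indep: "indep_of_innovations M V \<eta>"
begin

lemma measurable_V [measurable]: "V t \<in> borel_measurable M"
  using volatility by (simp add: volatility_def strictly_stationary_def)

lemma AE_V_pos: "AE \<omega> in M. \<forall>t. V t \<omega> > 0"
  using volatility by (simp add: volatility_def)

lemma measurable_V_path [measurable]: "(\<lambda>\<omega> t. V t \<omega>) \<in> borel_measurable M"
  by (rule measurable_path) measurable

lemma measurable_\<eta>: "i \<in> {1, 2} \<Longrightarrow> \<eta> i s \<in> borel_measurable M"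
  using pareto unfolding pareto_innovations_def indep_vars_def by fastforce

lemma measurable_\<eta>_path: "i \<in> {1, 2} \<Longrightarrow> (\<lambda>\<omega> s. \<eta> i s \<omega>) \<in> borel_measurable M"
  by (rule measurable_path) (rule measurable_\<eta>)

abbreviation "innovation_index \<equiv> ({1, 2} :: nat set) \<times> (UNIV :: int set)"

abbreviation "innovation_field \<omega> \<equiv> (\<lambda>p\<in>innovation_index. (case p of (i, s) \<Rightarrow> \<eta> i s) \<omega>)"

lemma measurable_innovation_field:
  "innovation_field \<in> measurable M (\<Pi>\<^sub>M p\<in>innovation_index. borel)"
  by (rule measurable_restrict) (use measurable_\<eta> in \<open>auto simp: case_prod_unfold\<close>)

lemma distr_\<eta>: "i \<in> {1, 2} \<Longrightarrow> distr M borel (\<eta> i s) = pareto_law \<alpha>"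
proof (rule pareto_law_unique)
  assume i: "i \<in> {1, 2}"
  note [measurable] = measurable_\<eta>[OF i]
  show "prob_space (distr M borel (\<eta> i s))"
    by (rule prob_space_distr) measurable
  fix x :: real assume "x \<ge> 1"
  have "measure (distr M borel (\<eta> i s)) {x<..} = measure M {\<omega> \<in> space M. \<eta> i s \<omega> > x}"
    by (subst measure_distr) (auto simp: vimage_def Int_def conj_commute)
  then show "measure (distr M borel (\<eta> i s)) {x<..} = x powr (- \<alpha>)"
    using pareto i \<open>x \<ge> 1\<close> unfolding pareto_innovations_def by auto
qed (use \<alpha>_pos in auto)

lemma distr_innovation_field:
  "distr M (\<Pi>\<^sub>M p\<in>innovation_index. borel) innovation_field = (\<Pi>\<^sub>M p\<in>innovation_index. pareto_law \<alpha>)"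
proof -
  have "distr M (\<Pi>\<^sub>M p\<in>innovation_index. borel) innovation_field =
      (\<Pi>\<^sub>M p\<in>innovation_index. distr M borel (case p of (i, s) \<Rightarrow> \<eta> i s))"
    using pareto measurable_\<eta> unfolding pareto_innovations_def
    by (subst indep_vars_iff_distr_eq_PiM'[symmetric]) auto
  also have "\<dots> = (\<Pi>\<^sub>M p\<in>innovation_index. pareto_law \<alpha>)"
    by (intro PiM_cong) (auto simp: distr_\<eta>)
  finally show ?thesis .
qed

lemma measurable_field_row:
  "i \<in> {1, 2} \<Longrightarrow> A \<subseteq> innovation_index \<Longrightarrow> {i} \<times> UNIV \<subseteq> A \<Longrightarrow>
    (\<lambda>x s. x (i, s)) \<in> borel_measurable (\<Pi>\<^sub>M p\<in>A. borel :: real measure)"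
  by (intro measurable_path measurable_component_singleton) auto

lemma distr_row:
  assumes i: "i \<in> {1, 2}"
  shows "distr M borel (\<lambda>\<omega> s. \<eta> i s \<omega>) = pareto_field \<alpha>"
proof -
  have "distr M borel (\<lambda>\<omega> s. \<eta> i s \<omega>) =
      distr (distr M (\<Pi>\<^sub>M p\<in>innovation_index. borel) innovation_field) borel (\<lambda>x s. x (i, s))"
    using i by (subst distr_distr[OF measurable_field_row measurable_innovation_field])
      (auto simp: comp_def)
  also have "\<dots> = distr (\<Pi>\<^sub>M p\<in>innovation_index. pareto_law \<alpha>) (\<Pi>\<^sub>M s\<in>UNIV. pareto_law \<alpha>) (\<lambda>x. \<lambda>s\<in>UNIV. x (i, s))"
    unfolding distr_innovation_field
    by (intro distr_cong) (auto simp: pareto_field_def[symmetric])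
  also have "\<dots> = pareto_field \<alpha>"
    unfolding pareto_field_def
    by (rule distr_PiM_reindex[of _ "\<lambda>_. pareto_law \<alpha>" "\<lambda>s. (i, s)"])
       (use i \<alpha>_pos in \<open>auto simp: inj_on_def intro: prob_space_pareto_law\<close>)
  finally show ?thesis .
qed

text \<open>The two rows are functions of disjoint blocks of one independent family, hence
  independent of each other.\<close>

lemma distr_rows:
  "distr M (borel \<Otimes>\<^sub>M borel) (\<lambda>\<omega>. (\<lambda>s. \<eta> 1 s \<omega>, \<lambda>s. \<eta> 2 s \<omega>)) = pareto_field \<alpha> \<Otimes>\<^sub>M pareto_field \<alpha>"
proof -
  have ind: "indep_var (\<Pi>\<^sub>M p\<in>{1} \<times> UNIV. borel) (\<lambda>\<omega>. \<lambda>p\<in>{1} \<times> UNIV. (case p of (i, s) \<Rightarrow> \<eta> i s) \<omega>)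
      (\<Pi>\<^sub>M p\<in>{2} \<times> UNIV. borel) (\<lambda>\<omega>. \<lambda>p\<in>{2} \<times> UNIV. (case p of (i, s) \<Rightarrow> \<eta> i s) \<omega>)"
    using pareto unfolding pareto_innovations_def
    by (intro indep_var_restrict[where I = innovation_index]) auto
  have row: "(\<lambda>x s. x (i, s)) \<in> borel_measurable (\<Pi>\<^sub>M p\<in>{i} \<times> (UNIV :: int set). borel :: real measure)"
    if "i \<in> {1, 2}" for i :: nat
    by (rule measurable_field_row) (use that in auto)
  have "indep_var borel (\<lambda>\<omega> s. \<eta> 1 s \<omega>) borel (\<lambda>\<omega> s. \<eta> 2 s \<omega>)"
    using indep_var_compose[OF ind row row] by (simp add: comp_def)
  then show ?thesis
    by (simp add: indep_var_distribution_eq distr_row)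
qed

abbreviation "volatility_law \<equiv> distr M borel (\<lambda>\<omega> t. V t \<omega>)"

text \<open>Independence is assumed for generated sigma-algebras, so it passes to every measurable
  function f of the whole field. The general f covers both uses: projection to one row and to the
  pair of rows.\<close>

lemma distr_volatility_innovations:
  assumes f: "f \<in> measurable (\<Pi>\<^sub>M p\<in>innovation_index. borel) N"
  shows "distr M (borel \<Otimes>\<^sub>M N) (\<lambda>\<omega>. (\<lambda>t. V t \<omega>, f (innovation_field \<omega>))) =
    volatility_law \<Otimes>\<^sub>M distr M N (\<lambda>\<omega>. f (innovation_field \<omega>))"
proof (rule pair_measure_eqI[symmetric])
  have Y [measurable]: "(\<lambda>\<omega>. f (innovation_field \<omega>)) \<in> measurable M N"
    by (rule measurable_compose[OF measurable_innovation_field f])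
  have YV: "(\<lambda>\<omega>. (\<lambda>t. V t \<omega>, f (innovation_field \<omega>))) \<in> measurable M (borel \<Otimes>\<^sub>M N)"
    by (rule measurable_Pair[OF measurable_V_path Y])
  interpret L: prob_space volatility_law by (rule prob_space_distr) measurable
  interpret K: prob_space "distr M N (\<lambda>\<omega>. f (innovation_field \<omega>))" by (rule prob_space_distr) measurable
  show "sigma_finite_measure volatility_law" "sigma_finite_measure (distr M N (\<lambda>\<omega>. f (innovation_field \<omega>)))"
    by unfold_locales
  fix A B
  assume "A \<in> sets volatility_law" "B \<in> sets (distr M N (\<lambda>\<omega>. f (innovation_field \<omega>)))"
  then have [measurable]: "A \<in> sets borel" "B \<in> sets N" by auto
  have AB: "A \<times> B \<in> sets (borel \<Otimes>\<^sub>M N)" by measurable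
  let ?A = "(\<lambda>\<omega> t. V t \<omega>) -` A \<inter> space M" and ?B = "(\<lambda>\<omega>. f (innovation_field \<omega>)) -` B \<inter> space M"
  have "?A \<in> sets (vimage_algebra (space M) (\<lambda>\<omega> t. V t \<omega>) (\<Pi>\<^sub>M t\<in>UNIV. borel))"
    by (rule in_vimage_algebra) (simp add: sets_PiM_equal_borel)
  moreover have "?B \<in> sets (vimage_algebra (space M) innovation_field (\<Pi>\<^sub>M p\<in>innovation_index. borel))"
  proof -
    \<comment> \<open>Pulling B back through f first exhibits the event as one in the sigma-algebra
      generated by the innovation field.\<close>
    have "?B = innovation_field -` (f -` B \<inter> space (\<Pi>\<^sub>M p\<in>innovation_index. borel)) \<inter> space M"
      using measurable_space[OF measurable_innovation_field] by auto
    then show ?thesis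
      using measurable_sets[OF f \<open>B \<in> sets N\<close>] by (metis in_vimage_algebra)
  qed
  moreover have "innovation_field = (\<lambda>\<omega>. \<lambda>(i, s)\<in>innovation_index. \<eta> i s \<omega>)"
    by (auto simp: fun_eq_iff restrict_def)
  ultimately have "prob (?A \<inter> ?B) = prob ?A * prob ?B"
    using indep unfolding indep_of_innovations_def by (intro indep_setD) auto
  moreover have "(\<lambda>\<omega>. (\<lambda>t. V t \<omega>, f (innovation_field \<omega>))) -` (A \<times> B) \<inter> space M = ?A \<inter> ?B"
    by auto
  ultimately show "emeasure volatility_law A * emeasure (distr M N (\<lambda>\<omega>. f (innovation_field \<omega>))) B =
      emeasure (distr M (borel \<Otimes>\<^sub>M N) (\<lambda>\<omega>. (\<lambda>t. V t \<omega>, f (innovation_field \<omega>)))) (A \<times> B)"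
    unfolding emeasure_distr[OF YV AB] emeasure_distr[OF Y \<open>B \<in> sets N\<close>]
      emeasure_distr[OF measurable_V_path \<open>A \<in> sets borel\<close>]
    by (simp only: emeasure_eq_measure ennreal_mult[symmetric] measure_nonneg)
qed simp

lemma distr_volatility_row:
  assumes "i \<in> {1, 2}"
  shows "distr M (borel \<Otimes>\<^sub>M borel) (\<lambda>\<omega>. (\<lambda>t. V t \<omega>, \<lambda>s. \<eta> i s \<omega>)) = volatility_law \<Otimes>\<^sub>M pareto_field \<alpha>"
  using distr_volatility_innovations[OF measurable_field_row[of i]] distr_row[of i] assms by auto

lemma distr_volatility_rows:
  "distr M (borel \<Otimes>\<^sub>M (borel \<Otimes>\<^sub>M borel)) (\<lambda>\<omega>. (\<lambda>t. V t \<omega>, (\<lambda>s. \<eta> 1 s \<omega>, \<lambda>s. \<eta> 2 s \<omega>))) =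
    volatility_law \<Otimes>\<^sub>M (pareto_field \<alpha> \<Otimes>\<^sub>M pareto_field \<alpha>)"
proof -
  have "(\<lambda>x. (\<lambda>s. x (1, s), \<lambda>s. x (2, s))) \<in> measurable (\<Pi>\<^sub>M p\<in>innovation_index. borel)
      ((borel :: (int \<Rightarrow> real) measure) \<Otimes>\<^sub>M (borel :: (int \<Rightarrow> real) measure))"
    by (intro measurable_Pair measurable_field_row) auto
  from distr_volatility_innovations[OF this] show ?thesis
    using distr_rows by simp
qed

lemma nn_integral_V_powr: "(\<integral>\<^sup>+\<omega>. ennreal (V s \<omega> powr p) \<partial>M) = (\<integral>\<^sup>+\<omega>. ennreal (V 0 \<omega> powr p) \<partial>M)"
proof -
  let ?f = "\<lambda>x :: int \<Rightarrow> real. ennreal (x 0 powr p)"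
  have [measurable]: "(\<lambda>\<omega> t. V (t + h) \<omega>) \<in> measurable M (\<Pi>\<^sub>M t\<in>UNIV. borel)" for h
    by (rule measurable_PiM_single') auto
  have "(\<integral>\<^sup>+x. ?f x \<partial>distr M (\<Pi>\<^sub>M t\<in>UNIV. borel) (\<lambda>\<omega> t. V (t + h) \<omega>)) = (\<integral>\<^sup>+\<omega>. ennreal (V h \<omega> powr p) \<partial>M)" for h
    by (subst nn_integral_distr) auto
  from this[of s] this[of 0] show ?thesis
    using volatility by (simp add: volatility_def strictly_stationary_def)
qed

lemma integrable_V_powr: "integrable M (\<lambda>\<omega>. V s \<omega> powr \<alpha>)"
  and integral_V_powr: "(\<integral>\<omega>. V s \<omega> powr \<alpha> \<partial>M) = 1"
proof -
  have *: "(\<integral>\<^sup>+\<omega>. ennreal (V s \<omega> powr \<alpha>) \<partial>M) = ennreal 1"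
    using volatility nn_integral_V_powr[of s \<alpha>] by (simp add: volatility_def)
  then show "integrable M (\<lambda>\<omega>. V s \<omega> powr \<alpha>)"
    by (intro integrableI_nn_integral_finite[of _ _ 1]) auto
  show "(\<integral>\<omega>. V s \<omega> powr \<alpha> \<partial>M) = 1"
    by (subst integral_eq_nn_integral) (auto simp: *)
qed

text \<open>By ab \<le> a^2 + b^2 the mixed moment is controlled by moments of order 2\<alpha>,
  which stationarity makes finite at every time.\<close>

lemma integrable_V_powr_mult: "integrable M (\<lambda>\<omega>. V s \<omega> powr \<alpha> * V s' \<omega> powr \<alpha>)"
proof -
  have sq: "integrable M (\<lambda>\<omega>. V s \<omega> powr (2 * \<alpha>))" for s
    using volatility nn_integral_V_powr[of s "2 * \<alpha>"]
    by (intro integrableI_bounded) (auto simp: volatility_def)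
  show ?thesis
  proof (rule Bochner_Integration.integrable_bound[OF Bochner_Integration.integrable_add[OF sq[of s] sq[of s']]])
    have "V s \<omega> powr \<alpha> * V s' \<omega> powr \<alpha> \<le> V s \<omega> powr (2 * \<alpha>) + V s' \<omega> powr (2 * \<alpha>)" for \<omega>
    proof -
      have "a * b \<le> a\<^sup>2 + b\<^sup>2" if "a \<ge> 0" "b \<ge> 0" for a b :: real
        using sum_squares_bound[of a b] mult_nonneg_nonneg[OF that] by linarith
      moreover have "(V t \<omega> powr \<alpha>)\<^sup>2 = V t \<omega> powr (2 * \<alpha>)" for t
        by (simp add: power2_eq_square powr_add[symmetric])
      ultimately show ?thesis by (metis powr_ge_zero)
    qed
    then show "AE \<omega> in M. norm (V s \<omega> powr \<alpha> * V s' \<omega> powr \<alpha>) \<le> norm (V s \<omega> powr (2 * \<alpha>) + V s' \<omega> powr (2 * \<alpha>))"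
      by auto
  qed auto
qed

end

section \<open>The scalar path-tail measure\<close>

text \<open>Dominated convergence works along sequences, whereas the limits here run along filters.
  With g the minimum of the two levels, the sequences range over all relative rates of
  growth.\<close>

lemma tendsto_filtercomap_at_topI:
  fixes f :: "'b \<Rightarrow> 'c :: metric_space" and g :: "'b \<Rightarrow> real"
  assumes "\<And>X. (\<And>n. g (X n) > 0) \<Longrightarrow> filterlim (\<lambda>n. g (X n)) at_top sequentially \<Longrightarrow> (\<lambda>n. f (X n)) \<longlonglongrightarrow> L"
  shows "(f \<longlongrightarrow> L) (filtercomap g at_top)"
proof (rule tendstoI, rule ccontr)
  fix e :: real assume "e > 0" and neg: "\<not> (\<forall>\<^sub>F x in filtercomap g at_top. dist (f x) L < e)"
  \<comment> \<open>\<open>Suc n\<close> instead of n makes the level of every chosen point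
    positive, including the first.\<close>
  have "\<exists>x. g x \<ge> real (Suc n) \<and> \<not> dist (f x) L < e" for n
    using neg unfolding eventually_filtercomap eventually_at_top_linorder by blast
  then obtain X where X: "\<And>n. g (X n) \<ge> real (Suc n)" "\<And>n. \<not> dist (f (X n)) L < e" by metis
  have "(\<lambda>n. f (X n)) \<longlonglongrightarrow> L"
  proof (rule assms)
    show "g (X n) > 0" for n using X(1)[of n] by simp
    show "filterlim (\<lambda>n. g (X n)) at_top sequentially"
      by (rule filterlim_at_top_mono[OF filterlim_compose[OF filterlim_real_sequentially filterlim_Suc]])
         (use X(1) in auto)
  qed
  from tendstoD[OF this \<open>e > 0\<close>] show False
    using X(2) by (auto simp: eventually_sequentially)
qed

lemma tendsto_path:
  fixes f :: "'b \<Rightarrow> 'i \<Rightarrow> real"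
  assumes "\<And>k. ((\<lambda>x. f x k) \<longlongrightarrow> l k) F"
  shows "(f \<longlongrightarrow> l) F"
proof -
  have "limitin (product_topology (\<lambda>_. euclidean) UNIV) f l F"
    using assms by (simp add: limitin_componentwise)
  then show ?thesis
    by (simp add: euclidean_product_topology)
qed

section \<open>Rows as a functional of the scaled jumps\<close>

definition moving_sum :: "nat \<Rightarrow> (int \<Rightarrow> real) \<Rightarrow> int \<Rightarrow> real" where
  "moving_sum l0 z t = (\<Sum>j<l0. z (t - int j))"

text \<open>The scaled products V \<eta> / u become the only input, so a functional of a row path
  has the form needed in \<open>one_big_jump\<close>.\<close>

lemma row_eq_moving_sum: "row l0 V \<eta> i t \<omega> / u = moving_sum l0 (\<lambda>k. V k \<omega> * \<eta> i k \<omega> / u) t"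
  by (simp add: row_def moving_sum_def sum_divide_distrib)

lemma moving_sum_spike: "moving_sum l0 ((\<lambda>_. 0)(s := r)) t = r * window l0 s t"
proof -
  have "moving_sum l0 ((\<lambda>_. 0)(s := r)) t = (\<Sum>j<l0. if int j = t - s then r else 0)"
    unfolding moving_sum_def by (intro sum.cong) auto
  \<comment> \<open>The guard s \<le> t is essential: \<open>nat\<close> sends a negative difference
    to 0, which would wrongly select j = 0.\<close>
  also have "\<dots> = (\<Sum>j<l0. if j = nat (t - s) \<and> s \<le> t then r else 0)"
    by (intro sum.cong) auto
  also have "\<dots> = r * window l0 s t"
    by (cases "s \<le> t") (auto simp: window_def indicator_def sum.delta nat_less_iff)
  finally show ?thesis .
qed

lemma measurable_moving_sum [measurable]: "moving_sum l0 \<in> borel_measurable borel"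
  by (rule measurable_path) (simp add: moving_sum_def)

text \<open>Only innovations at these indices influence the row at times in K; they form the finite
  index set S to which the one-big-jump theorem is applied.\<close>

definition window_support :: "nat \<Rightarrow> int set \<Rightarrow> int set" where
  "window_support l0 K = {s. \<exists>t\<in>K. t \<in> {s..<s + int l0}}"

lemma finite_window_support:
  assumes "finite K"
  shows "finite (window_support l0 K)"
proof (rule finite_subset)
  show "window_support l0 K \<subseteq> (\<Union>t\<in>K. {t - int l0<..t})"
    by (auto simp: window_support_def)
  show "finite (\<Union>t\<in>K. {t - int l0<..t})"
    using assms by auto
qed

text \<open>A moving sum has l0 terms, so jumps of at most \<epsilon> / (l0 + 1) cannot add up to
  more than \<epsilon>. The extra 1 keeps the quotient meaningful for l0 = 0.\<close>

lemma moving_sum_le: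
  assumes "\<And>k. 0 \<le> z k" "\<And>s. s \<in> window_support l0 K \<Longrightarrow> z s \<le> \<epsilon> / (real l0 + 1)" "t \<in> K" "\<epsilon> > 0"
  shows "\<bar>moving_sum l0 z t\<bar> \<le> \<epsilon>"
proof -
  have "moving_sum l0 z t \<le> (\<Sum>j<l0. \<epsilon> / (real l0 + 1))"
    unfolding moving_sum_def using assms(3)
    by (intro sum_mono assms(2)) (auto simp: window_support_def intro!: bexI[of _ t])
  also have "\<dots> \<le> \<epsilon>" using \<open>\<epsilon> > 0\<close> by (simp add: field_simps)
  finally show ?thesis
    using assms(1) by (simp add: moving_sum_def sum_nonneg)
qed

text \<open>The superposition over all starts s of the images of the intensity under r -> r
  \<phi>_s. Each start has weight E V(s)^\<alpha> = 1, so only \<alpha> and l0 remain and the same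
  measure serves both models.\<close>

definition window_tail_measure :: "real \<Rightarrow> nat \<Rightarrow> (int \<Rightarrow> real) measure" where
  "window_tail_measure \<alpha> l0 =
     distr (count_space UNIV \<Otimes>\<^sub>M pareto_intensity \<alpha>) borel (\<lambda>(s, r) t. r * window l0 s t)"

lemma measurable_scaled_window [measurable]:
  "(\<lambda>(s, r) t. r * window l0 s t) \<in> borel_measurable (count_space UNIV \<Otimes>\<^sub>M pareto_intensity \<alpha>)"
proof -
  have "(\<lambda>x t. snd x * window l0 (fst x) t) \<in> borel_measurable (count_space UNIV \<Otimes>\<^sub>M pareto_intensity \<alpha>)"
    by (rule measurable_path) measurable
  then show ?thesis by (simp add: case_prod_unfold)
qed

lemma pair_sigma_finite_count_pareto:
  "pair_sigma_finite (count_space (UNIV :: int set)) (pareto_intensity \<alpha>)"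
  by (intro pair_sigma_finite.intro sigma_finite_measure_count_space sigma_finite_pareto_intensity)

lemma emeasure_pareto_intensity_abs:
  assumes "\<alpha> > 0" "\<epsilon> > 0"
  shows "emeasure (pareto_intensity \<alpha>) {r. \<bar>r\<bar> > \<epsilon>} = ennreal (\<epsilon> powr (- \<alpha>))"
proof -
  have "emeasure (pareto_intensity \<alpha>) {r. \<bar>r\<bar> > \<epsilon>} = emeasure (pareto_intensity \<alpha>) {\<epsilon><..}"
    using AE_pareto_intensity_pos[of \<alpha>] by (intro emeasure_eq_AE) (auto elim!: eventually_mono)
  then show ?thesis using emeasure_pareto_intensity_greaterThan[OF assms] by simp
qed

lemma exceed_set_window:
  "(\<lambda>t. r * window l0 s t) \<in> exceed_set K \<epsilon> \<Longrightarrow> \<epsilon> > 0 \<Longrightarrow> s \<in> window_support l0 K \<and> \<bar>r\<bar> > \<epsilon>"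
  by (auto simp: exceed_set_def window_def window_support_def abs_mult split: split_indicator_asm)

lemma emeasure_support_box:
  assumes "\<alpha> > 0" "\<epsilon> > 0" "finite S"
  shows "emeasure (count_space UNIV \<Otimes>\<^sub>M pareto_intensity \<alpha>) (S \<times> {r. \<bar>r\<bar> > \<epsilon>}) < \<infinity>"
proof -
  interpret PI: sigma_finite_measure "pareto_intensity \<alpha>" by (rule sigma_finite_pareto_intensity)
  show ?thesis
    using assms by (subst PI.emeasure_pair_measure_Times)
      (auto simp: emeasure_pareto_intensity_abs ennreal_mult_less_top of_nat_less_top)
qed

lemma sets_exceed_set [measurable]: "finite K \<Longrightarrow> exceed_set K \<epsilon> \<in> sets borel"
proof -
  assume "finite K"
  then have [measurable]: "countable K" by (rule countable_finite)
  have "{f \<in> space (borel :: (int \<Rightarrow> real) measure). \<exists>t\<in>K. \<bar>f t\<bar> > \<epsilon>} \<in> sets borel" by measurable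
  then show ?thesis by (simp add: exceed_set_def)
qed

lemma emeasure_window_tail_measure_exceed_set:
  assumes "\<alpha> > 0" "\<epsilon> > 0" "finite K"
  shows "emeasure (window_tail_measure \<alpha> l0) (exceed_set K \<epsilon>) < \<infinity>"
proof -
  note [measurable] = sets_exceed_set[OF assms(3)]
  have "emeasure (window_tail_measure \<alpha> l0) (exceed_set K \<epsilon>) \<le>
      emeasure (count_space UNIV \<Otimes>\<^sub>M pareto_intensity \<alpha>) (window_support l0 K \<times> {r. \<bar>r\<bar> > \<epsilon>})"
    unfolding window_tail_measure_def using assms exceed_set_window
    by (subst emeasure_distr) (auto intro!: emeasure_mono)
  also have "\<dots> < \<infinity>"
    using assms by (intro emeasure_support_box finite_window_support)
  finally show ?thesis .
qed

text \<open>For l0 \<ge> 1 the path r \<phi>_s takes the value r at time s. It is therefore the zero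
  path only for r = 0, a null set of the intensity for each of the countably many starts.\<close>

lemma emeasure_window_tail_measure_zero:
  assumes "l0 \<ge> 1"
  shows "emeasure (window_tail_measure \<alpha> l0) {\<lambda>_. 0} = 0"
proof -
  interpret PI: sigma_finite_measure "pareto_intensity \<alpha>" by (rule sigma_finite_pareto_intensity)
  have "r = 0" if "(\<lambda>t. r * window l0 s t) = (\<lambda>_. 0)" for r s
    using fun_cong[OF that, of s] assms by (simp add: window_def)
  then have "(\<lambda>(s, r) t. r * window l0 s t) -` {\<lambda>_. 0} \<subseteq> (UNIV :: int set) \<times> {0}"
    by auto
  moreover have box: "(UNIV :: int set) \<times> {0} \<in> sets (count_space UNIV \<Otimes>\<^sub>M pareto_intensity \<alpha>)"
    by (intro pair_measureI) auto
  moreover have "{\<lambda>_. 0} \<in> sets (borel :: (int \<Rightarrow> real) measure)"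
    by (rule borel_singleton) simp
  ultimately have "emeasure (window_tail_measure \<alpha> l0) {\<lambda>_. 0} \<le>
      emeasure (count_space UNIV \<Otimes>\<^sub>M pareto_intensity \<alpha>) ((UNIV :: int set) \<times> {0})"
    unfolding window_tail_measure_def
    by (subst emeasure_distr) (auto intro!: le_infI1 box emeasure_mono[of _ "(UNIV :: int set) \<times> {0}"])
  also have "\<dots> = 0"
  proof -
    have "emeasure (pareto_intensity \<alpha>) {0} = emeasure (pareto_intensity \<alpha>) {}"
      using AE_pareto_intensity_pos[of \<alpha>] by (intro emeasure_eq_AE) (auto elim!: eventually_mono)
    then show ?thesis by (subst PI.emeasure_pair_measure_Times) auto
  qed
  finally show ?thesis by simp
qed

text \<open>The support of F leaves finitely many starts and \<bar>r\<bar> > \<epsilon>, a set of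
  finite mass. Fubini then yields the same finite sum over starts as the one-big-jump limit.\<close>

lemma integral_window_tail_measure:
  fixes F :: "(int \<Rightarrow> real) \<Rightarrow> real"
  assumes "\<alpha> > 0" "\<epsilon> > 0" "finite K" and [measurable]: "F \<in> borel_measurable borel"
    and bd: "\<And>f. \<bar>F f\<bar> \<le> B" and zero: "\<And>f. f \<notin> exceed_set K \<epsilon> \<Longrightarrow> F f = 0"
  shows "(\<integral>f. F f \<partial>window_tail_measure \<alpha> l0) =
    (\<Sum>s\<in>window_support l0 K. \<integral>r. F (\<lambda>t. r * window l0 s t) \<partial>pareto_intensity \<alpha>)"
proof -
  interpret pair_sigma_finite "count_space (UNIV :: int set)" "pareto_intensity \<alpha>"
    by (rule pair_sigma_finite_count_pareto)
  let ?S = "window_support l0 K" and ?N = "count_space UNIV \<Otimes>\<^sub>M pareto_intensity \<alpha>"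
  let ?f = "\<lambda>x :: int \<times> real. F (\<lambda>t. snd x * window l0 (fst x) t)"
  have [measurable]: "(\<lambda>x t. snd x * window l0 (fst x) t) \<in> borel_measurable ?N"
    using measurable_scaled_window by (simp add: case_prod_unfold)
  have supp: "F (\<lambda>t. r * window l0 s t) = 0" if "\<not> (s \<in> ?S \<and> \<bar>r\<bar> > \<epsilon>)" for s r
    using that exceed_set_window[OF _ \<open>\<epsilon> > 0\<close>] by (blast intro: zero)
  have supp_int: "(\<integral>r. F (\<lambda>t. r * window l0 s t) \<partial>pareto_intensity \<alpha>) = 0" if "s \<notin> ?S" for s
    using that by (simp add: supp)
  have int: "integrable ?N ?f"
  proof (rule Bochner_Integration.integrable_bound)
    show "integrable ?N (\<lambda>x. B * indicator (?S \<times> {r. \<bar>r\<bar> > \<epsilon>}) x)"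
      using emeasure_support_box[OF assms(1,2) finite_window_support[OF assms(3)], of l0]
      by (intro integrable_mult_right integrable_real_indicator) auto
    show "AE x in ?N. norm (?f x) \<le> norm (B * indicator (?S \<times> {r. \<bar>r\<bar> > \<epsilon>}) x)"
    proof (rule AE_I2)
      fix x
      have "\<bar>?f x\<bar> \<le> \<bar>B\<bar>" using bd[of "\<lambda>t. snd x * window l0 (fst x) t"] by linarith
      then show "norm (?f x) \<le> norm (B * indicator (?S \<times> {r. \<bar>r\<bar> > \<epsilon>}) x)"
        using supp[of "fst x" "snd x"] by (cases x) (auto simp: indicator_def)
    qed
  qed measurable
  have "(\<integral>f. F f \<partial>window_tail_measure \<alpha> l0) = (\<integral>x. ?f x \<partial>?N)"
    unfolding window_tail_measure_def
    by (subst integral_distr) (auto simp: case_prod_unfold)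
  also have "\<dots> = (\<integral>s. (\<integral>r. F (\<lambda>t. r * window l0 s t) \<partial>pareto_intensity \<alpha>) \<partial>count_space UNIV)"
    using integral_fst'[OF int] by simp
  also have "\<dots> = (\<Sum>s | s \<in> UNIV \<and> (\<integral>r. F (\<lambda>t. r * window l0 s t) \<partial>pareto_intensity \<alpha>) \<noteq> 0.
      \<integral>r. F (\<lambda>t. r * window l0 s t) \<partial>pareto_intensity \<alpha>)"
    using finite_window_support[OF assms(3), of l0]
    by (intro lebesgue_integral_count_space_finite_support) (use supp_int in \<open>blast intro: finite_subset\<close>)
  also have "\<dots> = (\<Sum>s\<in>?S. \<integral>r. F (\<lambda>t. r * window l0 s t) \<partial>pareto_intensity \<alpha>)"
    using finite_window_support[OF assms(3), of l0]
    by (intro sum.mono_neutral_left) (use supp_int in blast)+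
  finally show ?thesis .
qed

section \<open>Convergence of a single row\<close>

context volatility_model
begin

theorem scalar_path_tail_measure_row:
  assumes i: "i \<in> {1, 2}" and "l0 \<ge> 1"
  shows "scalar_path_tail_measure M \<alpha> (row l0 V \<eta> i) (window_tail_measure \<alpha> l0)"
  unfolding scalar_path_tail_measure_def
proof (intro conjI allI impI)
  fix F :: "(int \<Rightarrow> real) \<Rightarrow> real"
  assume cont: "continuous_on UNIV F" and "bounded (range F)"
    and "\<exists>K \<epsilon>. finite K \<and> \<epsilon> > 0 \<and> (\<forall>f. f \<notin> exceed_set K \<epsilon> \<longrightarrow> F f = 0)"
  then obtain B K \<epsilon> where bd: "\<And>f. \<bar>F f\<bar> \<le> B" and "finite K" "\<epsilon> > 0"
    and zero: "\<And>f. f \<notin> exceed_set K \<epsilon> \<Longrightarrow> F f = 0"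
    by (auto simp: bounded_iff)
  have [measurable]: "F \<in> borel_measurable borel"
    using cont by (rule borel_measurable_continuous_onI)
  interpret Q: prob_space "pareto_field \<alpha>" by (rule prob_space_pareto_field[OF \<alpha>_pos])
  interpret L: prob_space volatility_law by (rule prob_space_distr) measurable
  interpret LQ: pair_prob_space volatility_law "pareto_field \<alpha>" ..
  \<comment> \<open>If all jumps in \<open>?S\<close> are at most \<epsilon> / (l0 + 1), the row
    stays within \<epsilon> on K and F vanishes. Hence the jump threshold \<open>?\<epsilon>\<close>
    is smaller than the path threshold.\<close>
  define G where "G z = F (moving_sum l0 z)" for z
  let ?S = "window_support l0 K" and ?\<epsilon> = "\<epsilon> / (real l0 + 1)"
  let ?I = "\<lambda>s. \<integral>r. F (\<lambda>t. r * window l0 s t) \<partial>pareto_intensity \<alpha>"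
  note fin = finite_window_support[OF \<open>finite K\<close>, of l0]
  have [measurable]: "G \<in> borel_measurable borel" unfolding G_def by measurable
  have bdG: "\<bar>G z\<bar> \<le> B" for z by (simp add: G_def bd)
  have zeroG: "G z = 0" if "\<And>k. 0 \<le> z k" "\<And>s. s \<in> ?S \<Longrightarrow> z s \<le> ?\<epsilon>" for z
    unfolding G_def using moving_sum_le[OF that _ \<open>\<epsilon> > 0\<close>]
    by (intro zero) (auto simp: exceed_set_def not_less)
  have spike: "G ((\<lambda>_. 0)(s := r)) = F (\<lambda>t. r * window l0 s t)" for s r
    by (simp add: G_def moving_sum_spike[abs_def])
  have limG: "(\<lambda>n. G (Z n)) \<longlonglongrightarrow> G z" if "\<And>k. (\<lambda>n. Z n k) \<longlonglongrightarrow> z k" for Z z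
  proof -
    have "(\<lambda>n. moving_sum l0 (Z n)) \<longlonglongrightarrow> moving_sum l0 z"
      by (rule tendsto_path) (unfold moving_sum_def, intro tendsto_sum that)
    then show ?thesis
      unfolding G_def using continuous_on_tendsto_compose[OF cont] by auto
  qed
  have pos: "AE v in volatility_law. \<forall>k. v k > 0"
    using AE_V_pos by (subst AE_distr_iff) auto
  have [measurable]: "(\<lambda>x :: (int \<Rightarrow> real) \<times> (int \<Rightarrow> real). (\<lambda>k. fst x k * snd x k / u)) \<in> borel_measurable (borel \<Otimes>\<^sub>M borel)" for u
    by (rule measurable_path) measurable
  \<comment> \<open>The product law lets the volatility path be frozen: the inner integral is over
    innovations only.\<close>
  have transfer: "(\<integral>\<omega>. F (\<lambda>t. row l0 V \<eta> i t \<omega> / u) \<partial>M) =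
      (\<integral>v. (\<integral>x. G (\<lambda>k. v k * x k / u) \<partial>pareto_field \<alpha>) \<partial>volatility_law)" for u
  proof -
    have "(\<integral>\<omega>. F (\<lambda>t. row l0 V \<eta> i t \<omega> / u) \<partial>M) =
        (\<integral>x. G (\<lambda>k. fst x k * snd x k / u) \<partial>distr M (borel \<Otimes>\<^sub>M borel) (\<lambda>\<omega>. (\<lambda>t. V t \<omega>, \<lambda>s. \<eta> i s \<omega>)))"
      using measurable_\<eta>_path[OF i]
      by (subst integral_distr) (auto simp: row_eq_moving_sum G_def)
    also have "\<dots> = (\<integral>x. G (\<lambda>k. fst x k * snd x k / u) \<partial>(volatility_law \<Otimes>\<^sub>M pareto_field \<alpha>))"
      using distr_volatility_row[OF i] by simp
    also have "\<dots> = (\<integral>v. (\<integral>x. G (\<lambda>k. v k * x k / u) \<partial>pareto_field \<alpha>) \<partial>volatility_law)"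
      by (subst LQ.integral_fst'[symmetric])
         (auto intro!: LQ.P.integrable_const_bound[of _ B] simp: bdG)
    finally show ?thesis .
  qed
  have intL: "integrable volatility_law (\<lambda>v. v s powr \<alpha>)" for s
    using integrable_V_powr by (subst integrable_distr_eq) auto
  \<comment> \<open>The filter is written as a preimage under the identity so that the passage to
    sequences applies.\<close>
  have "((\<lambda>u. u powr \<alpha> * (\<integral>\<omega>. F (\<lambda>t. row l0 V \<eta> i t \<omega> / u) \<partial>M)) \<longlongrightarrow>
      (\<integral>f. F f \<partial>window_tail_measure \<alpha> l0)) (filtercomap (\<lambda>u. u) at_top)"
  proof (rule tendsto_filtercomap_at_topI)
    fix U :: "nat \<Rightarrow> real" assume U: "\<And>n. U n > 0" "filterlim U at_top sequentially"
    have "(\<lambda>n. \<integral>v. U n powr \<alpha> * (\<integral>x. G (\<lambda>k. v k * x k / U n) \<partial>pareto_field \<alpha>) \<partial>volatility_law)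
        \<longlonglongrightarrow> (\<integral>v. (\<Sum>s\<in>?S. v s powr \<alpha> * ?I s) \<partial>volatility_law)"
    proof (rule integral_dominated_convergence)
      show "integrable volatility_law (\<lambda>v. B * ?\<epsilon> powr (- \<alpha>) * (\<Sum>s\<in>?S. v s powr \<alpha>))"
        by (intro integrable_mult_right Bochner_Integration.integrable_sum intL)
      show "AE v in volatility_law. (\<lambda>n. U n powr \<alpha> * (\<integral>x. G (\<lambda>k. v k * x k / U n) \<partial>pareto_field \<alpha>))
          \<longlonglongrightarrow> (\<Sum>s\<in>?S. v s powr \<alpha> * ?I s)"
        using pos
      proof eventually_elim
        case (elim v)
        have "(\<lambda>n. U n powr \<alpha> * (\<integral>x. G (\<lambda>k. v k * x k / U n) \<partial>pareto_field \<alpha>))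
          \<longlonglongrightarrow> (\<Sum>s\<in>?S. v s powr \<alpha> * (\<integral>r. G ((\<lambda>_. 0)(s := r)) \<partial>pareto_intensity \<alpha>))"
        proof (rule one_big_jump[where \<epsilon> = ?\<epsilon>, OF \<alpha>_pos _ U(2) _ fin _ bdG zeroG])
          fix s
          show "AE r in pareto_intensity \<alpha>. \<forall>Z. (\<forall>n. Z n s = r) \<longrightarrow>
              (\<forall>k. k \<noteq> s \<longrightarrow> (\<lambda>n. Z n k) \<longlonglongrightarrow> 0) \<longrightarrow> (\<lambda>n. G (Z n)) \<longlonglongrightarrow> G ((\<lambda>_. 0)(s := r))"
            by (intro AE_I2 allI impI limG) auto
        qed (use elim \<open>\<epsilon> > 0\<close> in auto)
        then show ?case by (simp add: spike)
      qed
      show "AE v in volatility_law. norm (U n powr \<alpha> * (\<integral>x. G (\<lambda>k. v k * x k / U n) \<partial>pareto_field \<alpha>))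
          \<le> B * ?\<epsilon> powr (- \<alpha>) * (\<Sum>s\<in>?S. v s powr \<alpha>)" for n
        using pos
      proof eventually_elim
        case (elim v)
        then show ?case unfolding real_norm_def
          by (intro one_big_jump_bound[where \<epsilon> = ?\<epsilon>, OF \<alpha>_pos _ U(1) _ fin _ bdG zeroG]) (use \<open>\<epsilon> > 0\<close> in auto)
      qed
      have "(\<lambda>v. \<integral>x. G (\<lambda>k. fst (v, x) k * snd (v, x) k / U n) \<partial>pareto_field \<alpha>) \<in> borel_measurable borel" for n
        by (rule Q.borel_measurable_lebesgue_integral) (simp add: case_prod_unfold)
      then show "(\<lambda>v. U n powr \<alpha> * (\<integral>x. G (\<lambda>k. v k * x k / U n) \<partial>pareto_field \<alpha>)) \<in> borel_measurable volatility_law" for n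
        by simp
    qed auto
    \<comment> \<open>Here the volatility leaves the limit: each weight is integrated to E
      V(s)^\<alpha> = 1.\<close>
    also have "(\<integral>v. (\<Sum>s\<in>?S. v s powr \<alpha> * ?I s) \<partial>volatility_law) = (\<Sum>s\<in>?S. ?I s)"
    proof -
      have "(\<integral>v. v s powr \<alpha> \<partial>volatility_law) = 1" for s
        using integral_V_powr by (subst integral_distr) auto
      then show ?thesis by (simp add: intL)
    qed
    also have "\<dots> = (\<integral>f. F f \<partial>window_tail_measure \<alpha> l0)"
      by (rule integral_window_tail_measure[OF \<alpha>_pos \<open>\<epsilon> > 0\<close> \<open>finite K\<close> _ bd zero, symmetric]) auto
    finally show "(\<lambda>n. U n powr \<alpha> * (\<integral>\<omega>. F (\<lambda>t. row l0 V \<eta> i t \<omega> / U n) \<partial>M)) \<longlonglongrightarrow>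
        (\<integral>f. F f \<partial>window_tail_measure \<alpha> l0)"
      by (simp add: transfer)
  qed
  then show "((\<lambda>u. u powr \<alpha> * (\<integral>\<omega>. F (\<lambda>t. row l0 V \<eta> i t \<omega> / u) \<partial>M)) \<longlongrightarrow>
      (\<integral>f. F f \<partial>window_tail_measure \<alpha> l0)) at_top"
    by (simp add: filtercomap_ident)
qed (use assms \<alpha>_pos emeasure_window_tail_measure_zero emeasure_window_tail_measure_exceed_set in
     \<open>auto simp: window_tail_measure_def\<close>)

end

section \<open>Simultaneous exceedances\<close>

text \<open>Prescribing the exact set J of exceedance times in K, and not merely requiring
  exceedances on J, makes different patterns disjoint. Events for two rows then split into products
  without inclusion-exclusion.\<close>

definition exceedance_pattern :: "nat \<Rightarrow> int set \<Rightarrow> int set \<Rightarrow> (int \<Rightarrow> real) \<Rightarrow> real" where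
  "exceedance_pattern l0 K J z = (if \<forall>t\<in>K. moving_sum l0 z t > 1 \<longleftrightarrow> t \<in> J then 1 else 0)"

lemma measurable_exceedance_pattern:
  assumes "finite K"
  shows "exceedance_pattern l0 K J \<in> borel_measurable borel"
proof -
  have [measurable]: "countable K" using assms by (rule countable_finite)
  have [measurable]: "(\<lambda>z. moving_sum l0 z t) \<in> borel_measurable borel" for t
    using measurable_moving_sum by measurable
  show ?thesis
    unfolding exceedance_pattern_def[abs_def] by measurable
qed

lemma abs_exceedance_pattern_le: "\<bar>exceedance_pattern l0 K J z\<bar> \<le> 1"
  by (simp add: exceedance_pattern_def)

lemma exceedance_pattern_eq_0:
  assumes "J \<noteq> {}" "J \<subseteq> K" "\<And>k. 0 \<le> z k" "\<And>s. s \<in> window_support l0 K \<Longrightarrow> z s \<le> 1 / (real l0 + 1)"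
  shows "exceedance_pattern l0 K J z = 0"
proof -
  obtain t where t: "t \<in> J" using assms(1) by blast
  then have "\<not> moving_sum l0 z t > 1"
    using moving_sum_le[of z l0 K 1 t] assms by auto
  then show ?thesis using t assms(2) by (auto simp: exceedance_pattern_def)
qed

text \<open>A spike above 1 exceeds exactly on its window and any other spike exceeds nowhere; the
  latter is excluded because J is nonempty.\<close>

lemma exceedance_pattern_spike:
  assumes "J \<noteq> {}" "J \<subseteq> K"
  shows "exceedance_pattern l0 K J ((\<lambda>_. 0)(s := r)) =
    (if {s..<s + int l0} \<inter> K = J then indicator {1<..} r else 0)"
  using assms unfolding exceedance_pattern_def moving_sum_spike window_def
  by (auto split: split_indicator)

text \<open>The pattern is locally constant wherever no moving sum equals the level 1. The moving
  sums of a spike take only the values 0 and r, so r = 1 is the sole exceptional size, and it is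
  null for the intensity.\<close>

lemma exceedance_pattern_limit:
  assumes "finite K" "r \<noteq> 1" "\<And>n. Z n s = r" "\<And>k. k \<noteq> s \<Longrightarrow> (\<lambda>n. Z n k) \<longlonglongrightarrow> 0"
  shows "(\<lambda>n. exceedance_pattern l0 K J (Z n)) \<longlonglongrightarrow> exceedance_pattern l0 K J ((\<lambda>_. 0)(s := r))"
proof -
  let ?z = "(\<lambda>_. 0)(s := r)"
  have Z: "(\<lambda>n. Z n k) \<longlonglongrightarrow> ?z k" for k
    using assms(3,4) by (cases "k = s") auto
  have "\<forall>\<^sub>F n in sequentially. (moving_sum l0 (Z n) t > 1) = (moving_sum l0 ?z t > 1)" for t
  proof -
    have lim: "(\<lambda>n. moving_sum l0 (Z n) t) \<longlonglongrightarrow> moving_sum l0 ?z t"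
      unfolding moving_sum_def by (intro tendsto_sum Z)
    have "moving_sum l0 ?z t \<noteq> 1"
      unfolding moving_sum_spike window_def using \<open>r \<noteq> 1\<close> by (auto split: split_indicator)
    then consider "moving_sum l0 ?z t > 1" | "moving_sum l0 ?z t < 1" by linarith
    then show ?thesis
    proof cases
      case 1
      from order_tendstoD(1)[OF lim this] show ?thesis by eventually_elim (use 1 in simp)
    next
      case 2
      from order_tendstoD(2)[OF lim this] show ?thesis by eventually_elim (use 2 in simp)
    qed
  qed
  then have "\<forall>\<^sub>F n in sequentially. \<forall>t\<in>K. (moving_sum l0 (Z n) t > 1) = (moving_sum l0 ?z t > 1)"
    by (intro eventually_ball_finite[OF assms(1)]) auto
  then have "\<forall>\<^sub>F n in sequentially. exceedance_pattern l0 K J ?z = exceedance_pattern l0 K J (Z n)"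
    by eventually_elim (simp add: exceedance_pattern_def)
  then show ?thesis
    by (rule Lim_transform_eventually[OF tendsto_const])
qed

section \<open>One pattern, for a frozen volatility path\<close>

context
  fixes \<alpha> :: real and v :: "int \<Rightarrow> real" and K J :: "int set"
  assumes \<alpha>: "\<alpha> > 0" and v: "\<And>k. v k > 0" and K: "finite K" and J: "J \<noteq> {}" "J \<subseteq> K"
begin

lemma exceedance_pattern_asymptotics:
  assumes U: "filterlim U at_top sequentially"
  shows "(\<lambda>n. U n powr \<alpha> * (\<integral>x. exceedance_pattern l0 K J (\<lambda>k. v k * x k / U n) \<partial>pareto_field \<alpha>))
    \<longlonglongrightarrow> (\<Sum>s\<in>window_support l0 K. if {s..<s + int l0} \<inter> K = J then v s powr \<alpha> else 0)"
proof -
  \<comment> \<open>The intensity of (1, \<infinity>) is 1, so a start with the right pattern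
    contributes exactly its weight.\<close>
  have weight: "v s powr \<alpha> * (\<integral>r. exceedance_pattern l0 K J ((\<lambda>_. 0)(s := r)) \<partial>pareto_intensity \<alpha>) =
      (if {s..<s + int l0} \<inter> K = J then v s powr \<alpha> else 0)" for s
    using emeasure_pareto_intensity_greaterThan[OF \<alpha>, of 1]
    by (simp add: exceedance_pattern_spike[OF J] measure_def)
  have "(\<lambda>n. U n powr \<alpha> * (\<integral>x. exceedance_pattern l0 K J (\<lambda>k. v k * x k / U n) \<partial>pareto_field \<alpha>))
    \<longlonglongrightarrow> (\<Sum>s\<in>window_support l0 K. v s powr \<alpha> *
           (\<integral>r. exceedance_pattern l0 K J ((\<lambda>_. 0)(s := r)) \<partial>pareto_intensity \<alpha>))"
  proof (rule one_big_jump[where \<epsilon> = "1 / (real l0 + 1)" and B = 1, OF \<alpha> v U])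
    fix s
    show "AE r in pareto_intensity \<alpha>. \<forall>Z. (\<forall>n. Z n s = r) \<longrightarrow> (\<forall>k. k \<noteq> s \<longrightarrow> (\<lambda>n. Z n k) \<longlonglongrightarrow> 0) \<longrightarrow>
        (\<lambda>n. exceedance_pattern l0 K J (Z n)) \<longlonglongrightarrow> exceedance_pattern l0 K J ((\<lambda>_. 0)(s := r))"
      using AE_pareto_intensity_neq[where x = 1 and \<alpha> = \<alpha>]
      by eventually_elim (auto intro: exceedance_pattern_limit[OF K])
  qed (use finite_window_support[OF K] measurable_exceedance_pattern[OF K] exceedance_pattern_eq_0[OF J]
         abs_exceedance_pattern_le in auto)
  then show ?thesis by (simp only: weight)
qed

lemma exceedance_pattern_bound:
  assumes "u > 0"
  shows "\<bar>u powr \<alpha> * (\<integral>x. exceedance_pattern l0 K J (\<lambda>k. v k * x k / u) \<partial>pareto_field \<alpha>)\<bar>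
    \<le> (1 / (real l0 + 1)) powr (- \<alpha>) * (\<Sum>s\<in>window_support l0 K. v s powr \<alpha>)"
  using one_big_jump_bound[where \<epsilon> = "1 / (real l0 + 1)" and B = 1, OF \<alpha> v assms _ finite_window_support[OF K]
      measurable_exceedance_pattern[OF K] abs_exceedance_pattern_le exceedance_pattern_eq_0[OF J]]
  by simp

end

definition meeting_pairs :: "int set \<Rightarrow> (int set \<times> int set) set" where
  "meeting_pairs K = {p \<in> Pow K \<times> Pow K. fst p \<inter> snd p \<noteq> {}}"

lemma finite_meeting_pairs: "finite K \<Longrightarrow> finite (meeting_pairs K)"
  by (simp add: meeting_pairs_def)

text \<open>Each pair of rows realises exactly one pair of patterns, and a simultaneous exceedance
  occurs precisely when these share a time. The event becomes a sum of products with one factor per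
  row.\<close>

lemma simultaneous_exceedance_eq_sum:
  assumes "finite K"
  shows "indicator {(y, z). \<exists>t\<in>K. moving_sum l0 y t > 1 \<and> moving_sum l0 z t > 1} x =
    (\<Sum>p\<in>meeting_pairs K. exceedance_pattern l0 K (fst p) (fst x) * exceedance_pattern l0 K (snd p) (snd x) :: real)"
proof -
  define A where "A y = {t \<in> K. moving_sum l0 y t > 1}" for y
  have pat: "exceedance_pattern l0 K J y = (if A y = J then 1 else 0)" if "J \<subseteq> K" for J y
    using that by (auto simp: exceedance_pattern_def A_def)
  have "(\<Sum>p\<in>meeting_pairs K. exceedance_pattern l0 K (fst p) (fst x) * exceedance_pattern l0 K (snd p) (snd x)) =
      (\<Sum>p\<in>meeting_pairs K. if p = (A (fst x), A (snd x)) then 1 else 0)"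
    by (intro sum.cong refl) (auto simp: meeting_pairs_def pat split: if_splits)
  also have "\<dots> = (if (A (fst x), A (snd x)) \<in> meeting_pairs K then 1 else 0)"
    using finite_meeting_pairs[OF assms] by simp
  also have "\<dots> = indicator {(y, z). \<exists>t\<in>K. moving_sum l0 y t > 1 \<and> moving_sum l0 z t > 1} x"
    by (cases x) (auto simp: meeting_pairs_def A_def indicator_def)
  finally show ?thesis by simp
qed

text \<open>This undoes the decomposition in the limit: after expanding the product, the starts s
  and s' contribute to the single pair (W s, W s').\<close>

lemma sum_meeting_pairs:
  fixes a :: "int \<Rightarrow> real"
  assumes "finite K" "finite S" "\<And>s. s \<in> S \<Longrightarrow> W s \<subseteq> K"
  shows "(\<Sum>p\<in>meeting_pairs K. (\<Sum>s\<in>S. if W s = fst p then a s else 0) * (\<Sum>s\<in>S. if W s = snd p then a s else 0)) =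
    (\<Sum>s\<in>S. \<Sum>s'\<in>S. if W s \<inter> W s' \<noteq> {} then a s * a s' else 0)"
proof -
  have "(\<Sum>p\<in>meeting_pairs K. (\<Sum>s\<in>S. if W s = fst p then a s else 0) * (\<Sum>s\<in>S. if W s = snd p then a s else 0)) =
      (\<Sum>p\<in>meeting_pairs K. \<Sum>s\<in>S. \<Sum>s'\<in>S. if p = (W s, W s') then a s * a s' else 0)"
    by (auto simp: sum_product intro!: sum.cong)
  also have "\<dots> = (\<Sum>s\<in>S. \<Sum>s'\<in>S. \<Sum>p\<in>meeting_pairs K. if p = (W s, W s') then a s * a s' else 0)"
    by (subst sum.swap, intro sum.cong refl, rule sum.swap)
  also have "\<dots> = (\<Sum>s\<in>S. \<Sum>s'\<in>S. if W s \<inter> W s' \<noteq> {} then a s * a s' else 0)"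
    using assms finite_meeting_pairs[OF assms(1)]
    by (intro sum.cong refl) (auto simp: meeting_pairs_def)
  finally show ?thesis .
qed

section \<open>Two rows, integrated over the volatility\<close>

context volatility_model
begin

text \<open>The limit is kept as a double sum over starts; \<open>sum_meeting_windows\<close> groups
  it by lag once the mixed moments are known to depend on s' - s only.\<close>

theorem has_simultaneous_tail_mass_row:
  fixes l0 T :: nat
  defines "K \<equiv> {0..<int T}"
  defines "S \<equiv> window_support l0 K" and "W \<equiv> \<lambda>s. {s..<s + int l0} \<inter> K"
  shows "has_simultaneous_tail_mass M \<alpha> (row l0 V \<eta>) T
    (\<Sum>s\<in>S. \<Sum>s'\<in>S. if W s \<inter> W s' \<noteq> {} then \<integral>\<omega>. V s \<omega> powr \<alpha> * V s' \<omega> powr \<alpha> \<partial>M else 0)"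
  unfolding has_simultaneous_tail_mass_def
proof (rule tendsto_filtercomap_at_topI)
  interpret Q: prob_space "pareto_field \<alpha>" by (rule prob_space_pareto_field[OF \<alpha>_pos])
  interpret QQ: pair_prob_space "pareto_field \<alpha>" "pareto_field \<alpha>" ..
  interpret L: prob_space volatility_law by (rule prob_space_distr) measurable
  interpret LQ: pair_prob_space volatility_law "pareto_field \<alpha> \<Otimes>\<^sub>M pareto_field \<alpha>" ..
  have K: "finite K" by (simp add: K_def)
  have S: "finite S" unfolding S_def by (rule finite_window_support[OF K])
  note [measurable] = measurable_exceedance_pattern[OF K]
  let ?E = "exceedance_pattern l0 K"
  let ?D = "meeting_pairs K"
  define I where "I J v u = (\<integral>x. ?E J (\<lambda>k. v k * x k / u) \<partial>pareto_field \<alpha>)" for J v u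
  have meas2 [measurable]: "(\<lambda>x :: (int \<Rightarrow> real) \<times> (int \<Rightarrow> real). (\<lambda>k. fst x k * snd x k / u)) \<in>
      borel_measurable (borel \<Otimes>\<^sub>M borel)" for u
    by (rule measurable_path) measurable
  have meas1 [measurable]: "(\<lambda>x :: int \<Rightarrow> real. (\<lambda>k. v k * x k / u)) \<in> borel_measurable borel" for v u
    by (rule measurable_path) measurable
  have I_meas: "(\<lambda>v. I J v u) \<in> borel_measurable borel" for J u
  proof -
    have "(\<lambda>x. ?E J (\<lambda>k. fst x k * snd x k / u)) \<in> borel_measurable (borel \<Otimes>\<^sub>M pareto_field \<alpha>)"
      by measurable
    then have "(\<lambda>v. \<integral>x. ?E J (\<lambda>k. fst (v, x) k * snd (v, x) k / u) \<partial>pareto_field \<alpha>) \<in> borel_measurable borel"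
      by (intro Q.borel_measurable_lebesgue_integral) (simp add: case_prod_unfold)
    then show ?thesis by (simp add: I_def)
  qed
  have transfer: "measure M {\<omega> \<in> space M. \<exists>t\<in>{0..<int T}. row l0 V \<eta> 1 t \<omega> > u1 \<and> row l0 V \<eta> 2 t \<omega> > u2} =
      (\<integral>v. (\<Sum>p\<in>?D. I (fst p) v u1 * I (snd p) v u2) \<partial>volatility_law)" if u: "u1 > 0" "u2 > 0" for u1 u2
  proof -
    let ?H = "\<lambda>x :: (int \<Rightarrow> real) \<times> (int \<Rightarrow> real) \<times> (int \<Rightarrow> real).
      \<Sum>p\<in>?D. ?E (fst p) (\<lambda>k. fst x k * fst (snd x) k / u1) * ?E (snd p) (\<lambda>k. fst x k * snd (snd x) k / u2)"
    have m1: "(\<lambda>x :: (int \<Rightarrow> real) \<times> (int \<Rightarrow> real) \<times> (int \<Rightarrow> real). (\<lambda>k. fst x k * fst (snd x) k / u1)) \<in>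
        borel_measurable (borel \<Otimes>\<^sub>M (borel \<Otimes>\<^sub>M borel))"
      by (rule measurable_path) measurable
    have m2: "(\<lambda>x :: (int \<Rightarrow> real) \<times> (int \<Rightarrow> real) \<times> (int \<Rightarrow> real). (\<lambda>k. fst x k * snd (snd x) k / u2)) \<in>
        borel_measurable (borel \<Otimes>\<^sub>M (borel \<Otimes>\<^sub>M borel))"
      by (rule measurable_path) measurable
    have H [measurable]: "?H \<in> borel_measurable (borel \<Otimes>\<^sub>M (borel \<Otimes>\<^sub>M borel))"
      by (intro borel_measurable_sum borel_measurable_times
            measurable_compose[OF m1 measurable_exceedance_pattern[OF K]]
            measurable_compose[OF m2 measurable_exceedance_pattern[OF K]])
    have m\<eta>: "(\<lambda>\<omega>. (\<lambda>t. V t \<omega>, (\<lambda>s. \<eta> 1 s \<omega>, \<lambda>s. \<eta> 2 s \<omega>))) \<in> measurable M (borel \<Otimes>\<^sub>M (borel \<Otimes>\<^sub>M borel))"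
      by (intro measurable_Pair measurable_\<eta>_path measurable_V_path) auto
    have HI: "?H x = indicator {(y, z). \<exists>t\<in>K. moving_sum l0 y t > 1 \<and> moving_sum l0 z t > 1}
       ((\<lambda>k. fst x k * fst (snd x) k / u1), (\<lambda>k. fst x k * snd (snd x) k / u2))" for x
      by (subst simultaneous_exceedance_eq_sum[OF K]) simp
    let ?A = "{\<omega> \<in> space M. \<exists>t\<in>{0..<int T}. row l0 V \<eta> 1 t \<omega> > u1 \<and> row l0 V \<eta> 2 t \<omega> > u2}"
    have row_gt: "row l0 V \<eta> i t \<omega> > u \<longleftrightarrow> moving_sum l0 (\<lambda>k. V k \<omega> * \<eta> i k \<omega> / u) t > 1" if "u > 0" for i t \<omega> u
      using that by (simp add: row_eq_moving_sum[symmetric] field_simps)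
    have eqA: "?H (\<lambda>t. V t \<omega>, (\<lambda>s. \<eta> 1 s \<omega>, \<lambda>s. \<eta> 2 s \<omega>)) = indicator ?A \<omega>" if "\<omega> \<in> space M" for \<omega>
      unfolding HI using that u by (auto simp: row_gt K_def indicator_def)
    have "?A \<inter> space M = ?A" by auto
    then have "measure M ?A = (\<integral>\<omega>. indicator ?A \<omega> \<partial>M)"
      by simp
    also have "\<dots> = (\<integral>\<omega>. ?H (\<lambda>t. V t \<omega>, (\<lambda>s. \<eta> 1 s \<omega>, \<lambda>s. \<eta> 2 s \<omega>)) \<partial>M)"
      by (intro Bochner_Integration.integral_cong refl eqA[symmetric])
    also have "\<dots> = (\<integral>x. ?H x \<partial>distr M (borel \<Otimes>\<^sub>M (borel \<Otimes>\<^sub>M borel)) (\<lambda>\<omega>. (\<lambda>t. V t \<omega>, (\<lambda>s. \<eta> 1 s \<omega>, \<lambda>s. \<eta> 2 s \<omega>))))"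
      by (rule integral_distr[OF m\<eta> H, symmetric])
    also have "\<dots> = (\<integral>x. ?H x \<partial>(volatility_law \<Otimes>\<^sub>M (pareto_field \<alpha> \<Otimes>\<^sub>M pareto_field \<alpha>)))"
      unfolding distr_volatility_rows ..
    also have "\<dots> = (\<integral>v. (\<integral>x. ?H (v, x) \<partial>(pareto_field \<alpha> \<Otimes>\<^sub>M pareto_field \<alpha>)) \<partial>volatility_law)"
    proof (rule LQ.integral_fst'[symmetric], rule LQ.P.integrable_const_bound)
      show "AE x in volatility_law \<Otimes>\<^sub>M (pareto_field \<alpha> \<Otimes>\<^sub>M pareto_field \<alpha>). norm (?H x) \<le> 1"
        unfolding HI by (auto split: split_indicator)
      show "?H \<in> borel_measurable (volatility_law \<Otimes>\<^sub>M (pareto_field \<alpha> \<Otimes>\<^sub>M pareto_field \<alpha>))"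
        using H by measurable
    qed
    also have "\<dots> = (\<integral>v. (\<Sum>p\<in>?D. I (fst p) v u1 * I (snd p) v u2) \<partial>volatility_law)"
    proof (rule Bochner_Integration.integral_cong[OF refl])
      fix v :: "int \<Rightarrow> real"
      let ?f = "\<lambda>J u x. ?E J (\<lambda>k. v k * x k / u)"
      \<comment> \<open>Given the volatility path the rows are independent, so Fubini factorises the
        mixed pattern integral.\<close>
      have prod: "(\<integral>x. ?f J u1 (fst x) * ?f J' u2 (snd x) \<partial>(pareto_field \<alpha> \<Otimes>\<^sub>M pareto_field \<alpha>)) = I J v u1 * I J' v u2"
        and prod_int: "integrable (pareto_field \<alpha> \<Otimes>\<^sub>M pareto_field \<alpha>) (\<lambda>x. ?f J u1 (fst x) * ?f J' u2 (snd x))" for J J'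
      proof -
        show int: "integrable (pareto_field \<alpha> \<Otimes>\<^sub>M pareto_field \<alpha>) (\<lambda>x. ?f J u1 (fst x) * ?f J' u2 (snd x))"
          by (rule QQ.P.integrable_const_bound[of _ 1]) (auto simp: exceedance_pattern_def)
        show "(\<integral>x. ?f J u1 (fst x) * ?f J' u2 (snd x) \<partial>(pareto_field \<alpha> \<Otimes>\<^sub>M pareto_field \<alpha>)) = I J v u1 * I J' v u2"
          using QQ.integral_fst'[OF int] by (simp add: I_def)
      qed
      show "(\<integral>x. ?H (v, x) \<partial>(pareto_field \<alpha> \<Otimes>\<^sub>M pareto_field \<alpha>)) = (\<Sum>p\<in>?D. I (fst p) v u1 * I (snd p) v u2)"
        by (simp add: prod prod_int)
    qed
    finally show ?thesis .
  qed
  have pos: "AE v in volatility_law. \<forall>k. v k > 0"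
    using AE_V_pos by (subst AE_distr_iff) auto
  have intL: "integrable volatility_law (\<lambda>v. v s powr \<alpha> * v s' powr \<alpha>)" for s s'
    using integrable_V_powr_mult by (subst integrable_distr_eq) auto
  fix X :: "nat \<Rightarrow> real \<times> real"
  \<comment> \<open>Each level dominates the minimum and so tends to infinity by itself; nothing
    relates their speeds.\<close>
  assume X: "\<And>n. (case X n of (u1, u2) \<Rightarrow> min u1 u2) > 0"
    "filterlim (\<lambda>n. case X n of (u1, u2) \<Rightarrow> min u1 u2) at_top sequentially"
  define U1 U2 where "U1 n = fst (X n)" and "U2 n = snd (X n)" for n
  have U_pos: "U1 n > 0" "U2 n > 0" for n
    using X(1)[of n] by (auto simp: U1_def U2_def case_prod_unfold)
  have U: "filterlim U1 at_top sequentially" "filterlim U2 at_top sequentially"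
    by (rule filterlim_at_top_mono[OF X(2)]; simp add: U1_def U2_def case_prod_unfold)+
  \<comment> \<open>The normalisation is distributed, one power to each factor, so that each factor
    converges and is bounded separately.\<close>
  let ?J = "\<lambda>n v. \<Sum>p\<in>?D. (U1 n powr \<alpha> * I (fst p) v (U1 n)) * (U2 n powr \<alpha> * I (snd p) v (U2 n))"
  let ?a = "\<lambda>v J. \<Sum>s\<in>S. if W s = J then v s powr \<alpha> else 0"
  let ?c = "(1 / (real l0 + 1)) powr (- \<alpha>)"
  have D: "fst p \<noteq> {}" "fst p \<subseteq> K" "snd p \<noteq> {}" "snd p \<subseteq> K" if "p \<in> ?D" for p
    using that by (auto simp: meeting_pairs_def)
  have "(\<lambda>n. \<integral>v. ?J n v \<partial>volatility_law) \<longlonglongrightarrow> (\<integral>v. (\<Sum>p\<in>?D. ?a v (fst p) * ?a v (snd p)) \<partial>volatility_law)"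
  proof (rule integral_dominated_convergence)
    \<comment> \<open>Expanding the square of the sum turns the dominating function into products of
      two weights, which are integrable by \<open>intL\<close>.\<close>
    have "integrable volatility_law (\<lambda>v. \<Sum>p\<in>?D. ?c * ?c * (\<Sum>s\<in>S. \<Sum>s'\<in>S. v s powr \<alpha> * v s' powr \<alpha>))"
      by (intro Bochner_Integration.integrable_sum integrable_mult_right intL)
    then show "integrable volatility_law
        (\<lambda>v. \<Sum>p\<in>?D. (?c * (\<Sum>s\<in>S. v s powr \<alpha>)) * (?c * (\<Sum>s\<in>S. v s powr \<alpha>)))"
      by (simp only: sum_product[symmetric] mult.assoc mult.left_commute)
    show "AE v in volatility_law. (\<lambda>n. ?J n v) \<longlonglongrightarrow> (\<Sum>p\<in>?D. ?a v (fst p) * ?a v (snd p))"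
      using pos
    proof eventually_elim
      case (elim v)
      show ?case
        unfolding I_def W_def S_def
        by (intro tendsto_sum tendsto_mult exceedance_pattern_asymptotics \<alpha>_pos K U D) (use elim in auto)
    qed
    show "AE v in volatility_law. norm (?J n v) \<le>
        (\<Sum>p\<in>?D. (?c * (\<Sum>s\<in>S. v s powr \<alpha>)) * (?c * (\<Sum>s\<in>S. v s powr \<alpha>)))" for n
      using pos
    proof eventually_elim
      case (elim v)
      have "\<bar>U1 n powr \<alpha> * I (fst p) v (U1 n)\<bar> * \<bar>U2 n powr \<alpha> * I (snd p) v (U2 n)\<bar> \<le>
         (?c * (\<Sum>s\<in>S. v s powr \<alpha>)) * (?c * (\<Sum>s\<in>S. v s powr \<alpha>))" if p: "p \<in> ?D" for p
        unfolding I_def S_def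
        by (intro mult_mono exceedance_pattern_bound \<alpha>_pos K D[OF p] U_pos)
           (use elim in \<open>auto intro!: sum_nonneg mult_nonneg_nonneg\<close>)
      then show ?case
        unfolding real_norm_def abs_mult[symmetric] by (intro order_trans[OF sum_abs] sum_mono)
    qed
    show "?J n \<in> borel_measurable volatility_law" for n
      using I_meas by (intro borel_measurable_sum borel_measurable_times) auto
    show "(\<lambda>v. \<Sum>p\<in>?D. ?a v (fst p) * ?a v (snd p)) \<in> borel_measurable volatility_law"
      by measurable
  qed
  also have "(\<lambda>n. \<integral>v. ?J n v \<partial>volatility_law) = (\<lambda>n. case X n of (u1, u2) \<Rightarrow> u1 powr \<alpha> * u2 powr \<alpha> *
      measure M {\<omega> \<in> space M. \<exists>t\<in>{0..<int T}. row l0 V \<eta> 1 t \<omega> > u1 \<and> row l0 V \<eta> 2 t \<omega> > u2})"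
  proof
    fix n
    have J: "?J n v = U1 n powr \<alpha> * U2 n powr \<alpha> * (\<Sum>p\<in>?D. I (fst p) v (U1 n) * I (snd p) v (U2 n))" for v
      by (simp add: sum_distrib_left mult_ac)
    show "(\<integral>v. ?J n v \<partial>volatility_law) = (case X n of (u1, u2) \<Rightarrow> u1 powr \<alpha> * u2 powr \<alpha> *
      measure M {\<omega> \<in> space M. \<exists>t\<in>{0..<int T}. row l0 V \<eta> 1 t \<omega> > u1 \<and> row l0 V \<eta> 2 t \<omega> > u2})"
      unfolding case_prod_unfold U1_def[symmetric] U2_def[symmetric] transfer[OF U_pos] J by simp
  qed
  also have "(\<integral>v. (\<Sum>p\<in>?D. ?a v (fst p) * ?a v (snd p)) \<partial>volatility_law) =
      (\<integral>v. (\<Sum>s\<in>S. \<Sum>s'\<in>S. if W s \<inter> W s' \<noteq> {} then v s powr \<alpha> * v s' powr \<alpha> else 0) \<partial>volatility_law)"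
    by (subst sum_meeting_pairs[OF K S]) (auto simp: W_def)
  also have "\<dots> = (\<Sum>s\<in>S. \<Sum>s'\<in>S. if W s \<inter> W s' \<noteq> {} then \<integral>\<omega>. V s \<omega> powr \<alpha> * V s' \<omega> powr \<alpha> \<partial>M else 0)"
  proof -
    have int: "integrable volatility_law (\<lambda>v. if W s \<inter> W s' \<noteq> {} then v s powr \<alpha> * v s' powr \<alpha> else 0)" for s s'
      using intL by (cases "W s \<inter> W s' \<noteq> {}") auto
    have "(\<integral>v. (if W s \<inter> W s' \<noteq> {} then v s powr \<alpha> * v s' powr \<alpha> else 0) \<partial>volatility_law) =
        (if W s \<inter> W s' \<noteq> {} then \<integral>\<omega>. V s \<omega> powr \<alpha> * V s' \<omega> powr \<alpha> \<partial>M else 0)" for s s'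
      by (cases "W s \<inter> W s' \<noteq> {}") (auto simp: integral_distr)
    then show ?thesis
      using int by (simp add: Bochner_Integration.integral_sum Bochner_Integration.integrable_sum)
  qed
  finally show "(\<lambda>n. case X n of (u1, u2) \<Rightarrow> u1 powr \<alpha> * u2 powr \<alpha> *
      measure M {\<omega> \<in> space M. \<exists>t\<in>{0..<int T}. row l0 V \<eta> 1 t \<omega> > u1 \<and> row l0 V \<eta> 2 t \<omega> > u2}) \<longlonglongrightarrow>
    (\<Sum>s\<in>S. \<Sum>s'\<in>S. if W s \<inter> W s' \<noteq> {} then \<integral>\<omega>. V s \<omega> powr \<alpha> * V s' \<omega> powr \<alpha> \<partial>M else 0)" .
qed

end

section \<open>Volatilities driven by Rademacher variables\<close>

locale rademacher = prob_space M
  for M :: "'a measure" and \<xi> :: "int \<Rightarrow> 'a \<Rightarrow> real" +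
  assumes rademacher: "rademacher_family M \<xi>"
begin

lemma indep_vars_\<xi>: "indep_vars (\<lambda>_. borel) \<xi> UNIV"
  using rademacher by (simp add: rademacher_family_def)

lemma measurable_\<xi> [measurable]: "\<xi> t \<in> borel_measurable M"
  using indep_vars_\<xi> by (auto simp: indep_vars_def)

lemma prob_\<xi>: "prob {\<omega> \<in> space M. \<xi> t \<omega> = 1} = 1 / 2" "prob {\<omega> \<in> space M. \<xi> t \<omega> = -1} = 1 / 2"
  using rademacher by (auto simp: rademacher_family_def)

lemma AE_\<xi>: "AE \<omega> in M. \<forall>t. \<xi> t \<omega> = 1 \<or> \<xi> t \<omega> = -1"
proof (subst AE_all_countable, rule allI)
  fix t
  have "prob ({\<omega> \<in> space M. \<xi> t \<omega> = 1} \<union> {\<omega> \<in> space M. \<xi> t \<omega> = -1}) = 1"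
    by (subst finite_measure_Union) (auto simp: prob_\<xi>)
  from AE_prob_1[OF this] show "AE \<omega> in M. \<xi> t \<omega> = 1 \<or> \<xi> t \<omega> = -1"
    by eventually_elim auto
qed

lemma AE_\<xi>_sign: "AE \<omega> in M. \<xi> t \<omega> = 1 \<or> \<xi> t \<omega> = -1"
  using AE_\<xi> by eventually_elim auto

text \<open>The two atoms carry all the mass, so f(\<xi>) is almost surely a combination of two
  indicators. The common law, the mean and the second moment all come from this.\<close>

lemma integral_\<xi>_fun:
  fixes f :: "real \<Rightarrow> real"
  assumes [measurable]: "f \<in> borel_measurable borel"
  shows "(\<integral>\<omega>. f (\<xi> t \<omega>) \<partial>M) = (f 1 + f (-1)) / 2"
proof -
  have "(\<integral>\<omega>. f (\<xi> t \<omega>) \<partial>M) = (\<integral>\<omega>. f 1 * indicator {\<omega> \<in> space M. \<xi> t \<omega> = 1} \<omega> +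
      f (-1) * indicator {\<omega> \<in> space M. \<xi> t \<omega> = -1} \<omega> \<partial>M)"
  proof (rule integral_cong_AE)
    show "AE \<omega> in M. f (\<xi> t \<omega>) = f 1 * indicator {\<omega> \<in> space M. \<xi> t \<omega> = 1} \<omega> +
      f (-1) * indicator {\<omega> \<in> space M. \<xi> t \<omega> = -1} \<omega>"
      using AE_\<xi>_sign[of t] AE_space by eventually_elim (auto simp: indicator_def)
  qed measurable
  also have "\<dots> = f 1 * prob {\<omega> \<in> space M. \<xi> t \<omega> = 1} + f (-1) * prob {\<omega> \<in> space M. \<xi> t \<omega> = -1}"
    by (subst Bochner_Integration.integral_add)
       (auto simp: Int_def conj_commute intro!: integrable_mult_right integrable_real_indicator emeasure_finite[unfolded less_top])
  finally show ?thesis by (simp add: prob_\<xi> field_simps)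
qed

lemma distr_\<xi>: "distr M borel (\<xi> t) = distr M borel (\<xi> 0)"
proof (rule measure_eqI)
  fix A assume "A \<in> sets (distr M borel (\<xi> t))"
  then have [measurable]: "A \<in> sets borel" by simp
  have "prob (\<xi> s -` A \<inter> space M) = (indicator A 1 + indicator A (-1)) / 2" for s
  proof -
    have "prob (\<xi> s -` A \<inter> space M) = (\<integral>\<omega>. indicator (\<xi> s -` A \<inter> space M) \<omega> \<partial>M)"
      by simp
    also have "\<dots> = (\<integral>\<omega>. indicator A (\<xi> s \<omega>) \<partial>M)"
      by (intro Bochner_Integration.integral_cong) (auto simp: indicator_def)
    finally show ?thesis by (simp add: integral_\<xi>_fun)
  qed
  from this[of t] this[of 0]
  show "emeasure (distr M borel (\<xi> t)) A = emeasure (distr M borel (\<xi> 0)) A"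
    by (simp add: emeasure_distr emeasure_eq_measure)
qed simp

lemma measurable_\<xi>_path [measurable]: "(\<lambda>\<omega> t. \<xi> (h t) \<omega>) \<in> measurable M (\<Pi>\<^sub>M t\<in>UNIV. borel)"
  by (rule measurable_PiM_single') auto

text \<open>An iid family keeps its law under any injective relabelling. Shifts give stationarity of
  the volatility; a permutation of four indices identifies the one-time laws of the two
  models.\<close>

lemma distr_\<xi>_reindex:
  fixes h :: "int \<Rightarrow> int"
  assumes "inj h"
  shows "distr M (\<Pi>\<^sub>M t\<in>UNIV. borel) (\<lambda>\<omega> t. \<xi> (h t) \<omega>) = distr M (\<Pi>\<^sub>M t\<in>UNIV. borel) (\<lambda>\<omega> t. \<xi> t \<omega>)"
proof -
  let ?R = "distr M borel (\<xi> 0)"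
  have R: "prob_space ?R" by (rule prob_space_distr) measurable
  have law: "distr M (\<Pi>\<^sub>M t\<in>UNIV. borel) (\<lambda>\<omega> t. \<xi> t \<omega>) = (\<Pi>\<^sub>M t\<in>UNIV. ?R)"
  proof -
    have "distr M (\<Pi>\<^sub>M t\<in>UNIV. borel) (\<lambda>\<omega>. \<lambda>t\<in>UNIV. \<xi> t \<omega>) = (\<Pi>\<^sub>M t\<in>UNIV. distr M borel (\<xi> t))"
      using indep_vars_\<xi> by (subst indep_vars_iff_distr_eq_PiM[symmetric]) auto
    also have "\<dots> = (\<Pi>\<^sub>M t\<in>UNIV. ?R)" by (intro PiM_cong distr_\<xi> refl)
    finally show ?thesis by (simp only: restrict_UNIV)
  qed
  have "distr M (\<Pi>\<^sub>M t\<in>UNIV. borel) (\<lambda>\<omega> t. \<xi> (h t) \<omega>) =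
      distr (distr M (\<Pi>\<^sub>M t\<in>UNIV. borel) (\<lambda>\<omega> t. \<xi> t \<omega>)) (\<Pi>\<^sub>M t\<in>UNIV. borel) (\<lambda>x t. x (h t))"
    by (subst distr_distr) (auto simp: comp_def intro!: measurable_PiM_single' measurable_component_singleton)
  also have "\<dots> = distr (\<Pi>\<^sub>M t\<in>UNIV. ?R) (\<Pi>\<^sub>M t\<in>UNIV. ?R) (\<lambda>x. \<lambda>t\<in>UNIV. x (h t))"
    unfolding law by (intro distr_cong sets_PiM_cong) auto
  also have "\<dots> = (\<Pi>\<^sub>M t\<in>UNIV. ?R)"
    using distr_PiM_reindex[of UNIV "\<lambda>_. ?R" h UNIV] R assms by simp
  finally show ?thesis by (simp add: law)
qed

lemma integral_\<xi>: "(\<integral>\<omega>. \<xi> t \<omega> \<partial>M) = 0"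
  using integral_\<xi>_fun[of "\<lambda>x. x" t] by simp

lemma integrable_\<xi>: "integrable M (\<xi> t)"
  by (rule integrable_const_bound[of _ 1]) (use AE_\<xi>_sign[of t] in \<open>auto elim!: eventually_mono\<close>)

lemma integrable_\<xi>_mult: "integrable M (\<lambda>\<omega>. \<xi> s \<omega> * \<xi> t \<omega>)"
proof (rule integrable_const_bound[of _ 1])
  show "AE \<omega> in M. norm (\<xi> s \<omega> * \<xi> t \<omega>) \<le> 1"
    using AE_\<xi> by eventually_elim (metis abs_1 abs_minus abs_mult mult_1 order_refl real_norm_def)
qed measurable

lemma integral_\<xi>_mult: "(\<integral>\<omega>. \<xi> s \<omega> * \<xi> t \<omega> \<partial>M) = (if s = t then 1 else 0)"
proof (cases "s = t")
  case True
  then show ?thesis using integral_\<xi>_fun[of "\<lambda>x. x * x" t] by simp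
next
  case False
  have "(\<integral>\<omega>. (\<Prod>k\<in>{s, t}. \<xi> k \<omega>) \<partial>M) = (\<Prod>k\<in>{s, t}. \<integral>\<omega>. \<xi> k \<omega> \<partial>M)"
    by (intro indep_vars_lebesgue_integral indep_vars_subset[OF indep_vars_\<xi>] integrable_\<xi>) auto
  then show ?thesis using False by (simp add: integral_\<xi>)
qed

end

definition linear_volatility ::
    "real \<Rightarrow> real \<Rightarrow> (nat \<Rightarrow> real) \<Rightarrow> (int \<Rightarrow> 'a \<Rightarrow> real) \<Rightarrow> int \<Rightarrow> 'a \<Rightarrow> real" where
  "linear_volatility \<alpha> c a \<xi> t \<omega> = (1 + c * (\<Sum>k<4. a k * \<xi> (t - int k) \<omega>)) powr (1 / \<alpha>)"

text \<open>The aperiodic autocorrelation of the coefficient vector; c^2 times it is the covariance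
  of V^\<alpha> at lag \<delta>.\<close>

definition lag_covariance :: "(nat \<Rightarrow> real) \<Rightarrow> int \<Rightarrow> real" where
  "lag_covariance a \<delta> = (\<Sum>k<4. \<Sum>l<4. if \<delta> = int l - int k then a k * a l else 0)"

text \<open>The coefficient moduli add up to 7 in both models, so \<open>c_small\<close> becomes c <
  1/7. It keeps the base of the power strictly between 0 and 2.\<close>

locale rademacher_volatility = rademacher M \<xi>
  for M :: "'a measure" and \<xi> :: "int \<Rightarrow> 'a \<Rightarrow> real" +
  fixes \<alpha> c :: real and a :: "nat \<Rightarrow> real"
  assumes \<alpha>_pos: "\<alpha> > 0" and c_pos: "c > 0" and c_small: "c * (\<Sum>k<4. \<bar>a k\<bar>) < 1"
begin

abbreviation "V \<equiv> linear_volatility \<alpha> c a \<xi>"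

lemma measurable_V [measurable]: "V t \<in> borel_measurable M"
  unfolding linear_volatility_def[abs_def] by measurable

lemma AE_base: "AE \<omega> in M. \<forall>t. \<bar>c * (\<Sum>k<4. a k * \<xi> (t - int k) \<omega>)\<bar> < 1"
  using AE_\<xi>
proof eventually_elim
  case (elim \<omega>)
  show ?case
  proof
    fix t
    have "\<bar>a k * \<xi> (t - int k) \<omega>\<bar> = \<bar>a k\<bar>" for k
      using elim[rule_format, of "t - int k"] by (auto simp: abs_mult)
    then have "\<bar>\<Sum>k<4. a k * \<xi> (t - int k) \<omega>\<bar> \<le> (\<Sum>k<4. \<bar>a k\<bar>)"
      using sum_abs[of "\<lambda>k. a k * \<xi> (t - int k) \<omega>" "{..<4}"] by simp
    then have "c * \<bar>\<Sum>k<4. a k * \<xi> (t - int k) \<omega>\<bar> < 1"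
      using c_small mult_left_mono[of _ _ c] c_pos by (meson less_imp_le order_le_less_trans)
    then show "\<bar>c * (\<Sum>k<4. a k * \<xi> (t - int k) \<omega>)\<bar> < 1"
      using c_pos by (simp add: abs_mult)
  qed
qed

lemma AE_V_pos: "AE \<omega> in M. \<forall>t. V t \<omega> > 0"
  using AE_base
proof eventually_elim
  case (elim \<omega>)
  have "1 + c * (\<Sum>k<4. a k * \<xi> (t - int k) \<omega>) \<noteq> 0" for t
    using elim[rule_format, of t] by auto
  then show ?case by (simp add: linear_volatility_def)
qed

lemma AE_V_powr: "AE \<omega> in M. \<forall>t. V t \<omega> powr \<alpha> = 1 + c * (\<Sum>k<4. a k * \<xi> (t - int k) \<omega>)"
  using AE_base
proof eventually_elim
  case (elim \<omega>)
  have "0 < 1 + c * (\<Sum>k<4. a k * \<xi> (t - int k) \<omega>)" for t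
    using elim[rule_format, of t] by linarith
  then show ?case
    using \<alpha>_pos by (simp add: linear_volatility_def powr_powr less_imp_le)
qed

lemma AE_V_powr_le: "AE \<omega> in M. \<forall>t. V t \<omega> powr \<alpha> \<le> 2"
  using AE_base AE_V_powr
proof eventually_elim
  case (elim \<omega>)
  show ?case
  proof
    show "V t \<omega> powr \<alpha> \<le> 2" for t
      using elim(1)[rule_format, of t] elim(2)[rule_format, of t] by linarith
  qed
qed

lemma AE_V_bounded: "AE \<omega> in M. \<forall>t. \<bar>V t \<omega>\<bar> \<le> 2 powr (1 / \<alpha>)"
  using AE_V_powr_le AE_V_pos
proof eventually_elim
  case (elim \<omega>)
  show ?case
  proof
    fix t
    have "V t \<omega> = (V t \<omega> powr \<alpha>) powr (1 / \<alpha>)"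
      using elim(2)[rule_format, of t] \<alpha>_pos by (simp add: powr_powr)
    also have "\<dots> \<le> 2 powr (1 / \<alpha>)"
      using elim(1)[rule_format, of t] \<alpha>_pos by (intro powr_mono2) auto
    finally show "\<bar>V t \<omega>\<bar> \<le> 2 powr (1 / \<alpha>)"
      using elim(2)[rule_format, of t] by simp
  qed
qed

text \<open>The linear terms are centred, and in the quadratic term only coinciding innovations, s -
  k = t - l, survive.\<close>

lemma integral_V_powr_mult:
  "(\<integral>\<omega>. V s \<omega> powr \<alpha> * V t \<omega> powr \<alpha> \<partial>M) = 1 + c\<^sup>2 * lag_covariance a (t - s)"
proof -
  let ?L = "\<lambda>t \<omega>. \<Sum>k<4. a k * \<xi> (t - int k) \<omega>"
  have int: "integrable M (?L t)" for t
    by (intro Bochner_Integration.integrable_sum integrable_mult_right integrable_\<xi>)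
  have L0: "(\<integral>\<omega>. ?L t \<omega> \<partial>M) = 0" for t
    by (simp add: Bochner_Integration.integral_sum integrable_\<xi> integral_\<xi>)
  have prod: "?L s \<omega> * ?L t \<omega> = (\<Sum>k<4. \<Sum>l<4. (a k * a l) * (\<xi> (s - int k) \<omega> * \<xi> (t - int l) \<omega>))" for \<omega>
    by (simp only: sum_product mult_ac)
  have int2: "integrable M (\<lambda>\<omega>. ?L s \<omega> * ?L t \<omega>)"
    unfolding prod by (intro Bochner_Integration.integrable_sum integrable_mult_right integrable_\<xi>_mult)
  have "(\<integral>\<omega>. ?L s \<omega> * ?L t \<omega> \<partial>M) = (\<Sum>k<4. \<Sum>l<4. (a k * a l) * (if s - int k = t - int l then 1 else 0))"
    unfolding prod by (simp add: Bochner_Integration.integral_sum Bochner_Integration.integrable_sum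
        integrable_\<xi>_mult integral_\<xi>_mult)
  also have "\<dots> = lag_covariance a (t - s)"
    unfolding lag_covariance_def by (intro sum.cong refl) auto
  finally have L2: "(\<integral>\<omega>. ?L s \<omega> * ?L t \<omega> \<partial>M) = lag_covariance a (t - s)" .
  have "(\<integral>\<omega>. V s \<omega> powr \<alpha> * V t \<omega> powr \<alpha> \<partial>M) =
      (\<integral>\<omega>. 1 + c * ?L s \<omega> + c * ?L t \<omega> + c\<^sup>2 * (?L s \<omega> * ?L t \<omega>) \<partial>M)"
  proof (rule integral_cong_AE)
    show "AE \<omega> in M. V s \<omega> powr \<alpha> * V t \<omega> powr \<alpha> = 1 + c * ?L s \<omega> + c * ?L t \<omega> + c\<^sup>2 * (?L s \<omega> * ?L t \<omega>)"
      using AE_V_powr by eventually_elim (simp only: algebra_simps power2_eq_square)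
  qed measurable
  also have "\<dots> = 1 + c\<^sup>2 * lag_covariance a (t - s)"
    by (simp only: Bochner_Integration.integral_add Bochner_Integration.integrable_add int int2
        integrable_mult_right integrable_const integral_mult_right_zero L0 L2) (simp add: prob_space)
  finally show ?thesis .
qed

lemma integral_V_powr: "(\<integral>\<omega>. V t \<omega> powr \<alpha> \<partial>M) = 1"
proof -
  let ?L = "\<lambda>\<omega>. \<Sum>k<4. a k * \<xi> (t - int k) \<omega>"
  have int: "integrable M ?L"
    by (intro Bochner_Integration.integrable_sum integrable_mult_right integrable_\<xi>)
  have L0: "(\<integral>\<omega>. ?L \<omega> \<partial>M) = 0"
    by (simp add: Bochner_Integration.integral_sum integrable_\<xi> integral_\<xi>)
  have "(\<integral>\<omega>. V t \<omega> powr \<alpha> \<partial>M) = (\<integral>\<omega>. 1 + c * ?L \<omega> \<partial>M)"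
    by (rule integral_cong_AE) (use AE_V_powr in \<open>auto elim!: eventually_mono\<close>)
  also have "\<dots> = 1"
    by (simp only: Bochner_Integration.integral_add int integrable_mult_right integrable_const
        integral_mult_right_zero L0) (simp add: prob_space)
  finally show ?thesis .
qed

lemma lag_weight_V: "lag_weight M \<alpha> V \<delta> = ennreal (1 + c\<^sup>2 * lag_covariance a \<delta>)"
proof -
  have "AE \<omega> in M. norm (V 0 \<omega> powr \<alpha> * V \<delta> \<omega> powr \<alpha>) \<le> 4"
    using AE_V_powr_le
  proof eventually_elim
    case (elim \<omega>)
    have "V 0 \<omega> powr \<alpha> * V \<delta> \<omega> powr \<alpha> \<le> 2 * 2"
      using elim by (intro mult_mono) auto
    then show ?case by simp
  qed
  then have "lag_weight M \<alpha> V \<delta> = ennreal (\<integral>\<omega>. V 0 \<omega> powr \<alpha> * V \<delta> \<omega> powr \<alpha> \<partial>M)"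
    unfolding lag_weight_def by (intro nn_integral_eq_integral integrable_const_bound[of _ 4]) auto
  then show ?thesis by (simp add: integral_V_powr_mult)
qed

text \<open>One measurable map from the driving path to the volatility path: it commutes with
  shifts, which transfers stationarity, and it transfers independence of the innovations.\<close>

definition volatility_map :: "(int \<Rightarrow> real) \<Rightarrow> int \<Rightarrow> real" where
  "volatility_map x t = (1 + c * (\<Sum>k<4. a k * x (t - int k))) powr (1 / \<alpha>)"

lemma V_eq_volatility_map: "V t \<omega> = volatility_map (\<lambda>s. \<xi> s \<omega>) t"
  by (simp add: linear_volatility_def volatility_map_def)

lemma measurable_volatility_map [measurable]:
  "volatility_map \<in> measurable (\<Pi>\<^sub>M t\<in>UNIV. borel) (\<Pi>\<^sub>M t\<in>UNIV. borel)"
  by (rule measurable_PiM_single') (auto simp: volatility_map_def)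

lemma strictly_stationary_V: "strictly_stationary M V"
  unfolding strictly_stationary_def
proof (intro conjI allI)
  fix h
  have "volatility_map (\<lambda>t. \<xi> (t + h) \<omega>) = (\<lambda>t. V (t + h) \<omega>)" for h \<omega>
    by (simp add: fun_eq_iff linear_volatility_def volatility_map_def algebra_simps)
  then have "distr M (\<Pi>\<^sub>M t\<in>UNIV. borel) (\<lambda>\<omega> t. V (t + h) \<omega>) =
      distr (distr M (\<Pi>\<^sub>M t\<in>UNIV. borel) (\<lambda>\<omega> t. \<xi> (t + h) \<omega>)) (\<Pi>\<^sub>M t\<in>UNIV. borel) volatility_map" for h
    by (subst distr_distr) (auto simp: comp_def)
  from this[of h] this[of 0]
  show "distr M (\<Pi>\<^sub>M t\<in>UNIV. borel) (\<lambda>\<omega> t. V (t + h) \<omega>) = distr M (\<Pi>\<^sub>M t\<in>UNIV. borel) (\<lambda>\<omega> t. V t \<omega>)"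
    using distr_\<xi>_reindex[of "\<lambda>t. t + h"] by (simp add: inj_def)
qed measurable

lemma volatility_V: "volatility M \<alpha> V"
  unfolding volatility_def
proof (intro conjI AE_V_pos strictly_stationary_V)
  have bd: "AE \<omega> in M. norm (V 0 \<omega> powr \<alpha>) \<le> 2"
    using AE_V_powr_le by eventually_elim simp
  have "(\<integral>\<^sup>+\<omega>. ennreal (V 0 \<omega> powr \<alpha>) \<partial>M) = ennreal (\<integral>\<omega>. V 0 \<omega> powr \<alpha> \<partial>M)"
    using bd by (intro nn_integral_eq_integral integrable_const_bound[of _ 2]) auto
  then show "(\<integral>\<^sup>+\<omega>. ennreal (V 0 \<omega> powr \<alpha>) \<partial>M) = 1"
    by (simp add: integral_V_powr)
  have "(\<integral>\<^sup>+\<omega>. ennreal (V 0 \<omega> powr (2 * \<alpha>)) \<partial>M) = lag_weight M \<alpha> V 0"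
    unfolding lag_weight_def by (simp add: powr_add[symmetric])
  then show "(\<integral>\<^sup>+\<omega>. ennreal (V 0 \<omega> powr (2 * \<alpha>)) \<partial>M) < \<infinity>"
    by (simp add: lag_weight_V)
qed

lemma indep_of_innovations_V:
  assumes indep: "indep_of_innovations M \<xi> \<eta>"
  shows "indep_of_innovations M V \<eta>"
proof -
  have "sets (vimage_algebra (space M) (\<lambda>\<omega> t. V t \<omega>) (\<Pi>\<^sub>M t\<in>UNIV. borel)) \<subseteq>
      sets (vimage_algebra (space M) (\<lambda>\<omega> t. \<xi> t \<omega>) (\<Pi>\<^sub>M t\<in>UNIV. borel))"
  proof
    fix A assume "A \<in> sets (vimage_algebra (space M) (\<lambda>\<omega> t. V t \<omega>) (\<Pi>\<^sub>M t\<in>UNIV. borel))"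
    then obtain B where B: "B \<in> sets (\<Pi>\<^sub>M t\<in>(UNIV :: int set). (borel :: real measure))"
        and A: "A = (\<lambda>\<omega> t. V t \<omega>) -` B \<inter> space M"
      by (auto simp: sets_vimage_algebra2 space_PiM)
    have "A = (\<lambda>\<omega> t. \<xi> t \<omega>) -` (volatility_map -` B \<inter> space (\<Pi>\<^sub>M t\<in>UNIV. borel)) \<inter> space M"
      by (auto simp: A V_eq_volatility_map space_PiM)
    then show "A \<in> sets (vimage_algebra (space M) (\<lambda>\<omega> t. \<xi> t \<omega>) (\<Pi>\<^sub>M t\<in>UNIV. borel))"
      using measurable_sets[OF measurable_volatility_map B] by (metis in_vimage_algebra)
  qed
  then show ?thesis
    using indep unfolding indep_of_innovations_def indep_sets2_eq by blast
qed

end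

section \<open>The two models as linear volatilities\<close>

lemma V\<^sub>A_eq_linear_volatility: "V\<^sub>A \<alpha> c \<xi> = linear_volatility \<alpha> c (\<lambda>k. [0, 2, 1, 4] ! k) \<xi>"
  by (intro ext) (simp add: V\<^sub>A_def linear_volatility_def eval_nat_numeral)

lemma V\<^sub>B_eq_linear_volatility: "V\<^sub>B \<alpha> c \<xi> = linear_volatility \<alpha> c (\<lambda>k. [1, 0, 4, 2] ! k) \<xi>"
  by (intro ext) (simp add: V\<^sub>B_def linear_volatility_def eval_nat_numeral)

lemma (in rademacher) distr_V\<^sub>A_eq_V\<^sub>B: "distr M borel (V\<^sub>A \<alpha> c \<xi> t) = distr M borel (V\<^sub>B \<alpha> c \<xi> t)"
proof -
  \<comment> \<open>h carries the index of coefficient 2, 1 and 4 in model A to the index of the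
    same coefficient in model B. Sending t to t - 1 completes it to a permutation.\<close>
  define h where "h s = (if s = t - 1 then t - 3 else if s = t - 2 then t else if s = t - 3 then t - 2
     else if s = t then t - 1 else s)" for s
  define f where "f x = (1 + c * (2 * x (t - 1) + x (t - 2) + 4 * x (t - 3))) powr (1 / \<alpha>)" for x :: "int \<Rightarrow> real"
  have [measurable]: "f \<in> borel_measurable (\<Pi>\<^sub>M t\<in>UNIV. borel)"
    unfolding f_def[abs_def] by measurable
  have "inj h"
    by (rule injI) (simp add: h_def split: if_splits)
  have "distr M borel (V\<^sub>A \<alpha> c \<xi> t) = distr (distr M (\<Pi>\<^sub>M t\<in>UNIV. borel) (\<lambda>\<omega> t. \<xi> t \<omega>)) borel f"
    by (subst distr_distr) (auto simp: comp_def f_def V\<^sub>A_def[abs_def])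
  also have "\<dots> = distr (distr M (\<Pi>\<^sub>M t\<in>UNIV. borel) (\<lambda>\<omega> t. \<xi> (h t) \<omega>)) borel f"
    by (simp add: distr_\<xi>_reindex[OF \<open>inj h\<close>])
  also have "\<dots> = distr M borel (V\<^sub>B \<alpha> c \<xi> t)"
    by (subst distr_distr) (auto simp: comp_def f_def V\<^sub>B_def[abs_def] h_def algebra_simps)
  finally show ?thesis .
qed

section \<open>Anchor masses\<close>

lemma emeasure_unit_box:
  assumes "\<alpha> > 0"
  shows "emeasure (pareto_intensity \<alpha> \<Otimes>\<^sub>M pareto_intensity \<alpha>) ({r. \<bar>r\<bar> > 1} \<times> {r. \<bar>r\<bar> > 1}) = 1"
proof -
  interpret PI: sigma_finite_measure "pareto_intensity \<alpha>" by (rule sigma_finite_pareto_intensity)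
  show ?thesis
    using emeasure_pareto_intensity_abs[OF assms, of 1]
    by (subst PI.emeasure_pair_measure_Times) auto
qed

text \<open>The starts whose window covers 0, and those for which the window shifted by \<delta>
  covers l, form two intervals of length l0 displaced by l - \<delta>. \<open>nat\<close> returns 0
  when they are disjoint.\<close>

lemma card_overlapping_windows:
  "card {s. s \<in> {- int l0<..0} \<and> s + \<delta> \<in> {l - int l0<..l}} = nat (int l0 - \<bar>l - \<delta>\<bar>)"
proof -
  have "{s. s \<in> {- int l0<..0} \<and> s + \<delta> \<in> {l - int l0<..l}} = {max 0 (l - \<delta>) - int l0<..min 0 (l - \<delta>)}"
    by auto
  then have "card {s. s \<in> {- int l0<..0} \<and> s + \<delta> \<in> {l - int l0<..l}} =
      nat (min 0 (l - \<delta>) - (max 0 (l - \<delta>) - int l0))" by simp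
  also have "min 0 (l - \<delta>) - (max 0 (l - \<delta>) - int l0) = int l0 - \<bar>l - \<delta>\<bar>"
    by (simp add: max_def min_def)
  finally show ?thesis .
qed

lemma sets_anchor: "{f :: int \<Rightarrow> real \<times> real. \<bar>fst (f 0)\<bar> > 1 \<and> \<bar>snd (f l)\<bar> > 1} \<in> sets borel"
proof -
  have "open ({f :: int \<Rightarrow> real \<times> real. 1 < \<bar>fst (f 0)\<bar>} \<inter> {f. 1 < \<bar>snd (f l)\<bar>})"
    by (intro open_Int open_Collect_less continuous_intros continuous_on_product_coordinates)
  then show ?thesis by (simp add: Collect_conj_eq borel_open)
qed

text \<open>Both anchors are exceeded exactly when both windows cover them and both jumps exceed 1.
  That box of jumps has mass 1, so what remains for each lag is a count of starts.\<close>

theorem anchor_mass_eq_sum: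
  assumes "\<alpha> > 0"
  shows "anchor_mass M \<alpha> l0 V l =
    (\<Sum>\<delta>\<in>{l - int l0<..<l + int l0}. lag_weight M \<alpha> V \<delta> * ennreal (real l0 - real_of_int \<bar>l - \<delta>\<bar>))"
proof -
  let ?S = "{f :: int \<Rightarrow> real \<times> real. \<bar>fst (f 0)\<bar> > 1 \<and> \<bar>snd (f l)\<bar> > 1}"
  let ?P = "\<lambda>\<delta>. {s. s \<in> {- int l0<..0} \<and> s + \<delta> \<in> {l - int l0<..l}}"
  have box: "(\<integral>\<^sup>+(r1, r2). indicator ?S (\<lambda>t. (r1 * window l0 s t, r2 * window l0 (s + \<delta>) t))
      \<partial>(pareto_intensity \<alpha> \<Otimes>\<^sub>M pareto_intensity \<alpha>)) = indicator (?P \<delta>) s" for s \<delta>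
  proof -
    have pt: "(case x of (r1, r2) \<Rightarrow> indicator ?S (\<lambda>t. (r1 * window l0 s t, r2 * window l0 (s + \<delta>) t))) =
        (indicator (?P \<delta>) s * indicator ({r. \<bar>r\<bar> > 1} \<times> {r. \<bar>r\<bar> > 1}) x :: ennreal)" for x :: "real \<times> real"
      by (cases x) (auto simp: window_def indicator_def)
    have "{r. \<bar>r\<bar> > 1} \<times> {r. \<bar>r\<bar> > 1} \<in> sets (pareto_intensity \<alpha> \<Otimes>\<^sub>M pareto_intensity \<alpha>)"
      by (intro pair_measureI) auto
    then show ?thesis
      by (subst nn_integral_cong[OF pt])
         (simp add: nn_integral_cmult_indicator emeasure_unit_box[OF assms])
  qed
  have finP: "finite (?P \<delta>)" for \<delta>
    by (rule finite_subset[of _ "{- int l0<..0}"]) auto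
  have count: "(\<integral>\<^sup>+s. indicator (?P \<delta>) s \<partial>count_space UNIV) = ennreal (real (nat (int l0 - \<bar>l - \<delta>\<bar>)))" for \<delta>
    using card_overlapping_windows[of l0 \<delta> l] finP[of \<delta>]
    by (simp add: ennreal_of_nat_eq_real_of_nat)
  have "anchor_mass M \<alpha> l0 V l =
      (\<integral>\<^sup>+\<delta>. lag_weight M \<alpha> V \<delta> * ennreal (real (nat (int l0 - \<bar>l - \<delta>\<bar>))) \<partial>count_space UNIV)"
    unfolding anchor_mass_def emeasure_nu_FV[OF sets_anchor] nu_FV_integral_def box count ..
  also have "\<dots> = (\<Sum>\<delta>\<in>{l - int l0<..<l + int l0}. lag_weight M \<alpha> V \<delta> * ennreal (real (nat (int l0 - \<bar>l - \<delta>\<bar>))))"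
    by (intro nn_integral_count_space') auto
  also have "\<dots> = (\<Sum>\<delta>\<in>{l - int l0<..<l + int l0}. lag_weight M \<alpha> V \<delta> * ennreal (real l0 - real_of_int \<bar>l - \<delta>\<bar>))"
    by (intro sum.cong refl arg_cong2[where f = times] arg_cong[where f = ennreal]) auto
  finally show ?thesis .
qed

section \<open>Counting pairs of windows\<close>

text \<open>Passing from n to n + 1 raises each of the 2n - 1 old terms by 1 and adds two end terms
  equal to m + 1.\<close>

lemma sum_triangle: "(\<Sum>\<delta>\<in>{- int n<..<int n}. m + (real n - real_of_int \<bar>\<delta>\<bar>)) = (2 * real n - 1) * m + (real n)\<^sup>2"
  if "n \<ge> 1"
  using that
proof (induction n rule: nat_induct_at_least)
  case base
  have "{- int 1<..<int 1} = {0}" by auto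
  then show ?case by simp
next
  case (Suc n)
  have "{- int (Suc n)<..<int (Suc n)} = insert (int n) (insert (- int n) {- int n<..<int n})"
    using Suc(1) by auto
  then have "(\<Sum>\<delta>\<in>{- int (Suc n)<..<int (Suc n)}. m + (real (Suc n) - real_of_int \<bar>\<delta>\<bar>)) =
      (m + 1) + ((m + 1) + (\<Sum>\<delta>\<in>{- int n<..<int n}. 1 + (m + (real n - real_of_int \<bar>\<delta>\<bar>))))"
    using Suc(1) by (simp add: algebra_simps)
  also have "(\<Sum>\<delta>\<in>{- int n<..<int n}. 1 + (m + (real n - real_of_int \<bar>\<delta>\<bar>))) =
      real (card {- int n<..<int n}) + ((2 * real n - 1) * m + (real n)\<^sup>2)"
    by (simp only: sum.distrib[of "\<lambda>_. 1"] Suc(2)) simp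
  also have "real (card {- int n<..<int n}) = 2 * real n - 1"
    using Suc(1) by simp
  finally show ?case by (simp add: power2_eq_square algebra_simps)
qed

text \<open>The range of lags becomes independent of l0 and l; the \<open>max 0\<close> records
  which lags are cut off by the window length.\<close>

lemma sum_lags:
  fixes g :: "int \<Rightarrow> real"
  assumes "\<And>\<delta>. \<delta> \<notin> {-3..3} \<Longrightarrow> g \<delta> = 0"
  shows "(\<Sum>\<delta>\<in>{l - int l0<..<l + int l0}. g \<delta> * (real l0 - real_of_int \<bar>l - \<delta>\<bar>)) =
    (\<Sum>\<delta>\<in>{-3..3}. g \<delta> * max 0 (real l0 - real_of_int \<bar>l - \<delta>\<bar>))"
proof -
  have "(\<Sum>\<delta>\<in>{l - int l0<..<l + int l0}. g \<delta> * (real l0 - real_of_int \<bar>l - \<delta>\<bar>)) =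
      (\<Sum>\<delta>\<in>{l - int l0<..<l + int l0}. g \<delta> * max 0 (real l0 - real_of_int \<bar>l - \<delta>\<bar>))"
  proof (intro sum.cong refl)
    fix \<delta> assume "\<delta> \<in> {l - int l0<..<l + int l0}"
    then have "\<bar>l - \<delta>\<bar> \<le> int l0" by auto
    then have "real_of_int \<bar>l - \<delta>\<bar> \<le> real l0" by linarith
    then show "g \<delta> * (real l0 - real_of_int \<bar>l - \<delta>\<bar>) = g \<delta> * max 0 (real l0 - real_of_int \<bar>l - \<delta>\<bar>)" by simp
  qed
  also have "\<dots> = (\<Sum>\<delta>\<in>{l - int l0<..<l + int l0} \<union> {-3..3}. g \<delta> * max 0 (real l0 - real_of_int \<bar>l - \<delta>\<bar>))"
  proof (rule sum.mono_neutral_left)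
    show "\<forall>\<delta>\<in>({l - int l0<..<l + int l0} \<union> {-3..3}) - {l - int l0<..<l + int l0}.
        g \<delta> * max 0 (real l0 - real_of_int \<bar>l - \<delta>\<bar>) = 0"
    proof
      fix \<delta> assume "\<delta> \<in> ({l - int l0<..<l + int l0} \<union> {-3..3}) - {l - int l0<..<l + int l0}"
      then have "int l0 \<le> \<bar>l - \<delta>\<bar>" by auto
      then have "real l0 \<le> real_of_int \<bar>l - \<delta>\<bar>" by linarith
      then show "g \<delta> * max 0 (real l0 - real_of_int \<bar>l - \<delta>\<bar>) = 0" by simp
    qed
  qed auto
  also have "\<dots> = (\<Sum>\<delta>\<in>{-3..3}. g \<delta> * max 0 (real l0 - real_of_int \<bar>l - \<delta>\<bar>))"
    by (rule sum.mono_neutral_right) (use assms in auto)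
  finally show ?thesis .
qed

lemma sum_meeting_windows:
  fixes w :: "int \<Rightarrow> real" and l0 T :: nat
  assumes "l0 \<ge> 1" "T \<ge> 1"
  defines "K \<equiv> {0..<int T}"
  defines "S \<equiv> window_support l0 K" and "W \<equiv> \<lambda>s. {s..<s + int l0} \<inter> K"
  shows "(\<Sum>s\<in>S. \<Sum>s'\<in>S. if W s \<inter> W s' \<noteq> {} then w (s' - s) else 0) =
    (\<Sum>\<delta>\<in>{- int l0<..<int l0}. w \<delta> * (real T - 1 + (real l0 - real_of_int \<bar>\<delta>\<bar>)))"
proof -
  let ?D = "{- int l0<..<int l0}"
  \<comment> \<open>For lag \<delta> these are the starts for which both windows end after time 0
    and both begin before T.\<close>
  let ?L = "\<lambda>\<delta>. {max 0 (- \<delta>) - int l0<..int T - 1 - max 0 \<delta>}"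
  let ?P = "{p \<in> S \<times> S. W (fst p) \<inter> W (snd p) \<noteq> {}}"
  have fin: "finite S" unfolding S_def K_def by (intro finite_window_support) simp
  \<comment> \<open>Three intervals share an integer exactly when the largest left end lies below
    the smallest right end; the largest left end is then a common point.\<close>
  have meet: "W s \<inter> W s' \<noteq> {} \<longleftrightarrow> max s (max s' 0) < min (s + int l0) (min (s' + int l0) (int T))" for s s'
  proof
    assume "max s (max s' 0) < min (s + int l0) (min (s' + int l0) (int T))"
    then have "max s (max s' 0) \<in> W s \<inter> W s'" by (auto simp: W_def K_def)
    then show "W s \<inter> W s' \<noteq> {}" by blast
  qed (auto simp: W_def K_def)
  have inS: "s \<in> S \<and> s' \<in> S" if "W s \<inter> W s' \<noteq> {}" for s s'
    using that by (auto simp: S_def W_def window_support_def)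
  have P: "p \<in> ?P \<longleftrightarrow> snd p - fst p \<in> ?D \<and> fst p \<in> ?L (snd p - fst p)" for p
  proof -
    have "p \<in> ?P \<longleftrightarrow> W (fst p) \<inter> W (snd p) \<noteq> {}" using inS by (cases p) auto
    moreover have "s \<in> ?L \<delta> \<longleftrightarrow> - int l0 < s \<and> - \<delta> - int l0 < s \<and> s < int T \<and> s + \<delta> < int T" for s \<delta>
      by (auto simp: max_def)
    ultimately show ?thesis
      unfolding meet max_less_iff_conj min_less_iff_conj using assms(1,2) by simp linarith
  qed
  have "(\<Sum>s\<in>S. \<Sum>s'\<in>S. if W s \<inter> W s' \<noteq> {} then w (s' - s) else 0) = (\<Sum>p\<in>?P. w (snd p - fst p))"
    using fin by (simp add: sum.cartesian_product sum.inter_filter case_prod_unfold)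
  \<comment> \<open>Change of variables from (s, s') to (s' - s, s).\<close>
  also have "\<dots> = (\<Sum>q\<in>Sigma ?D ?L. w (fst q))"
    by (rule sum.reindex_bij_witness[of _ "\<lambda>q. (snd q, snd q + fst q)" "\<lambda>p. (snd p - fst p, fst p)"])
       (use P in \<open>auto simp del: mem_Collect_eq\<close>)
  also have "\<dots> = (\<Sum>\<delta>\<in>?D. \<Sum>s\<in>?L \<delta>. w \<delta>)"
    by (subst sum.Sigma) (auto simp: case_prod_unfold)
  also have "\<dots> = (\<Sum>\<delta>\<in>?D. w \<delta> * (real T - 1 + (real l0 - real_of_int \<bar>\<delta>\<bar>)))"
  proof (intro sum.cong refl)
    fix \<delta> assume "\<delta> \<in> ?D"
    then have "real (card (?L \<delta>)) = real T - 1 + (real l0 - real_of_int \<bar>\<delta>\<bar>)"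
      using assms(1,2) by (auto simp: max_def)
    then show "(\<Sum>s\<in>?L \<delta>. w \<delta>) = w \<delta> * (real T - 1 + (real l0 - real_of_int \<bar>\<delta>\<bar>))"
      by (simp add: mult.commute)
  qed
  finally show ?thesis .
qed

lemma lag_covariance_A:
  "lag_covariance (\<lambda>k. [0, 2, 1, 4] ! k) \<delta> =
    (if \<delta> = 0 then 21 else if \<bar>\<delta>\<bar> = 1 then 6 else if \<bar>\<delta>\<bar> = 2 then 8 else 0)"
  by (simp add: lag_covariance_def eval_nat_numeral) (auto simp: abs_if)

lemma lag_covariance_B:
  "lag_covariance (\<lambda>k. [1, 0, 4, 2] ! k) \<delta> =
    (if \<delta> = 0 then 21 else if \<bar>\<delta>\<bar> = 1 then 8 else if \<bar>\<delta>\<bar> = 2 then 4 else if \<bar>\<delta>\<bar> = 3 then 2 else 0)"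
  by (simp add: lag_covariance_def eval_nat_numeral) (auto simp: abs_if)

lemma lag_interval: "{-3..3 :: int} = {-3, -2, -1, 0, 1, 2, 3}"
  by auto

context
  fixes a :: "nat \<Rightarrow> real" and c :: real and l0 :: nat
  assumes supp: "\<And>\<delta>. \<delta> \<notin> {-3..3} \<Longrightarrow> lag_covariance a \<delta> = 0"
    and sym: "\<And>\<delta>. lag_covariance a (- \<delta>) = lag_covariance a \<delta>"
    and l0: "l0 \<ge> 4"
begin

text \<open>Besides the variance, only the sum and the first moment of the lag covariances enter; both
  agree for the two models.\<close>

lemma sum_lag_weights:
  assumes zero: "lag_covariance a 0 = 21"
    and total: "lag_covariance a 1 + lag_covariance a 2 + lag_covariance a 3 = 14"
    and moment: "lag_covariance a 1 + 2 * lag_covariance a 2 + 3 * lag_covariance a 3 = 22"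
  shows "(\<Sum>\<delta>\<in>{- int l0<..<int l0}. (1 + c\<^sup>2 * lag_covariance a \<delta>) * (m + (real l0 - real_of_int \<bar>\<delta>\<bar>))) =
    (real l0)\<^sup>2 + (49 * real l0 - 44) * c\<^sup>2 + m * (2 * real l0 - 1 + 49 * c\<^sup>2)"
proof -
  let ?g = "lag_covariance a" and ?D = "{- int l0<..<int l0}"
  have split: "(\<Sum>\<delta>\<in>?D. (1 + c\<^sup>2 * ?g \<delta>) * (m + (real l0 - real_of_int \<bar>\<delta>\<bar>))) =
      (\<Sum>\<delta>\<in>?D. m + (real l0 - real_of_int \<bar>\<delta>\<bar>)) + c\<^sup>2 * (\<Sum>\<delta>\<in>?D. ?g \<delta> * (m + (real l0 - real_of_int \<bar>\<delta>\<bar>)))"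
    by (simp add: sum_distrib_left sum.distrib[symmetric] algebra_simps)
  \<comment> \<open>Since l0 \<ge> 4, every lag with nonzero covariance lies strictly inside the
    window range, so nothing is truncated at anchor lag 0.\<close>
  have "(\<Sum>\<delta>\<in>?D. ?g \<delta> * (m + (real l0 - real_of_int \<bar>\<delta>\<bar>))) =
      (\<Sum>\<delta>\<in>{-3..3}. ?g \<delta> * (m + (real l0 - real_of_int \<bar>\<delta>\<bar>)))"
    by (rule sum.mono_neutral_right) (use l0 supp in auto)
  also have "\<dots> = ?g 0 * (m + real l0) + 2 * (?g 1 + ?g 2 + ?g 3) * (m + real l0)
      - 2 * (?g 1 + 2 * ?g 2 + 3 * ?g 3)"
    unfolding lag_interval using sym[of 1] sym[of 2] sym[of 3] by (simp add: algebra_simps)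
  \<comment> \<open>49 = 21 + 2 * 14 and 44 = 2 * 22; the factors 2 come from the two signs of the
    lag.\<close>
  also have "\<dots> = 49 * (m + real l0) - 44"
    unfolding zero total moment by simp
  finally have cov: "(\<Sum>\<delta>\<in>?D. ?g \<delta> * (m + (real l0 - real_of_int \<bar>\<delta>\<bar>))) = 49 * (m + real l0) - 44" .
  have n1: "l0 \<ge> 1" using l0 by simp
  show ?thesis
    unfolding split cov sum_triangle[OF n1] by (simp add: algebra_simps)
qed

end

text \<open>At \<bar>\<delta>\<bar> = 0, 1, 2, 3 the autocorrelations differ by 0, -2, 4, -2.
  Centring the triangular weight at 2 instead of 0 gives 4 for l0 \<ge> 5. For l0 = 4 the lag -3, at
  distance 5, is cut off; its untruncated contribution would have been (-2) * (4 - 5) = 2, so 2 is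
  left.\<close>

lemma lag_weight_sum_difference:
  fixes c :: real and l0 :: nat
  assumes "l0 \<ge> 4"
  defines "a \<equiv> \<lambda>k. [0, 2, 1, 4] ! k" and "b \<equiv> \<lambda>k. [1, 0, 4, 2] ! k"
  shows "(\<Sum>\<delta>\<in>{2 - int l0<..<2 + int l0}. (1 + c\<^sup>2 * lag_covariance a \<delta>) * (real l0 - real_of_int \<bar>2 - \<delta>\<bar>)) -
    (\<Sum>\<delta>\<in>{2 - int l0<..<2 + int l0}. (1 + c\<^sup>2 * lag_covariance b \<delta>) * (real l0 - real_of_int \<bar>2 - \<delta>\<bar>)) =
    (if l0 = 4 then 2 * c\<^sup>2 else 4 * c\<^sup>2)"
proof -
  let ?g = "\<lambda>\<delta>. c\<^sup>2 * (lag_covariance a \<delta> - lag_covariance b \<delta>)"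
  have "(\<Sum>\<delta>\<in>{2 - int l0<..<2 + int l0}. (1 + c\<^sup>2 * lag_covariance a \<delta>) * (real l0 - real_of_int \<bar>2 - \<delta>\<bar>)) -
    (\<Sum>\<delta>\<in>{2 - int l0<..<2 + int l0}. (1 + c\<^sup>2 * lag_covariance b \<delta>) * (real l0 - real_of_int \<bar>2 - \<delta>\<bar>)) =
    (\<Sum>\<delta>\<in>{2 - int l0<..<2 + int l0}. ?g \<delta> * (real l0 - real_of_int \<bar>2 - \<delta>\<bar>))"
    by (simp add: sum_subtractf[symmetric] algebra_simps)
  also have "\<dots> = (\<Sum>\<delta>\<in>{-3..3}. ?g \<delta> * max 0 (real l0 - real_of_int \<bar>2 - \<delta>\<bar>))"
    by (rule sum_lags) (auto simp: a_def b_def lag_covariance_A lag_covariance_B)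
  also have "\<dots> = (if l0 = 4 then 2 * c\<^sup>2 else 4 * c\<^sup>2)"
    unfolding lag_interval a_def b_def lag_covariance_A lag_covariance_B
    using assms(1) by (auto simp: max_def algebra_simps)
  finally show ?thesis .
qed

section \<open>The two models\<close>

lemma (in rademacher_volatility) anchor_mass_V:
  "anchor_mass M \<alpha> l0 V l = ennreal (\<Sum>\<delta>\<in>{l - int l0<..<l + int l0}.
     (1 + c\<^sup>2 * lag_covariance a \<delta>) * (real l0 - real_of_int \<bar>l - \<delta>\<bar>))"
  and anchor_sum_nonneg: "0 \<le> (\<Sum>\<delta>\<in>{l - int l0<..<l + int l0}.
     (1 + c\<^sup>2 * lag_covariance a \<delta>) * (real l0 - real_of_int \<bar>l - \<delta>\<bar>))"
proof -
  \<comment> \<open>Nonnegativity of the weight is read off from its meaning as the integral of a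
    nonnegative function; it permits moving the sum between real and extended nonnegative
    numbers.\<close>
  have w: "0 \<le> 1 + c\<^sup>2 * lag_covariance a \<delta>" for \<delta>
    using integral_V_powr_mult[of 0 \<delta>] Bochner_Integration.integral_nonneg[of M "\<lambda>\<omega>. V 0 \<omega> powr \<alpha> * V \<delta> \<omega> powr \<alpha>"]
    by simp
  have d: "0 \<le> real l0 - real_of_int \<bar>l - \<delta>\<bar>" if "\<delta> \<in> {l - int l0<..<l + int l0}" for \<delta>
  proof -
    have "\<bar>l - \<delta>\<bar> \<le> int l0" using that by auto
    then show ?thesis by linarith
  qed
  show "0 \<le> (\<Sum>\<delta>\<in>{l - int l0<..<l + int l0}.
     (1 + c\<^sup>2 * lag_covariance a \<delta>) * (real l0 - real_of_int \<bar>l - \<delta>\<bar>))"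
    by (intro sum_nonneg mult_nonneg_nonneg w d)
  have "anchor_mass M \<alpha> l0 V l = (\<Sum>\<delta>\<in>{l - int l0<..<l + int l0}.
     ennreal ((1 + c\<^sup>2 * lag_covariance a \<delta>) * (real l0 - real_of_int \<bar>l - \<delta>\<bar>)))"
    unfolding anchor_mass_eq_sum[OF \<alpha>_pos] lag_weight_V
    by (intro sum.cong refl ennreal_mult[symmetric] w d)
  also have "\<dots> = ennreal (\<Sum>\<delta>\<in>{l - int l0<..<l + int l0}.
     (1 + c\<^sup>2 * lag_covariance a \<delta>) * (real l0 - real_of_int \<bar>l - \<delta>\<bar>))"
    by (intro sum_ennreal mult_nonneg_nonneg w d)
  finally show "anchor_mass M \<alpha> l0 V l = ennreal (\<Sum>\<delta>\<in>{l - int l0<..<l + int l0}.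
     (1 + c\<^sup>2 * lag_covariance a \<delta>) * (real l0 - real_of_int \<bar>l - \<delta>\<bar>))" .
qed

lemma (in rademacher_volatility) has_simultaneous_tail_mass_V:
  assumes "pareto_innovations M \<alpha> \<eta>" "indep_of_innovations M \<xi> \<eta>" "l0 \<ge> 1" "T \<ge> 1"
  shows "has_simultaneous_tail_mass M \<alpha> (row l0 V \<eta>) T (\<Sum>\<delta>\<in>{- int l0<..<int l0}.
     (1 + c\<^sup>2 * lag_covariance a \<delta>) * (real T - 1 + (real l0 - real_of_int \<bar>\<delta>\<bar>)))"
proof -
  interpret model: volatility_model M \<alpha> V \<eta>
    by unfold_locales (use assms \<alpha>_pos volatility_V indep_of_innovations_V in auto)
  show ?thesis
    using model.has_simultaneous_tail_mass_row[of l0 T]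
      sum_meeting_windows[of l0 T "\<lambda>\<delta>. 1 + c\<^sup>2 * lag_covariance a \<delta>"] assms(3,4)
    by (simp only: integral_V_powr_mult)
qed

text \<open>In the last conjunct the probability space and the innovations stay fixed, so
  non-determination is shown already among volatilities living on one space.\<close>

theorem mainTheorem7:
  fixes M :: "'a measure" and \<alpha> c :: real and l0 :: nat
    and \<xi> :: "int \<Rightarrow> 'a \<Rightarrow> real" and \<eta> :: "nat \<Rightarrow> int \<Rightarrow> 'a \<Rightarrow> real"
  assumes "prob_space M"
    and "\<alpha> > 0" and "l0 \<ge> 4" and "0 < c" and "c < 1 / 7"
    and "rademacher_family M \<xi>"
    and "pareto_innovations M \<alpha> \<eta>"
    and "indep_of_innovations M \<xi> \<eta>"
  defines "VA \<equiv> V\<^sub>A \<alpha> c \<xi>" and "VB \<equiv> V\<^sub>B \<alpha> c \<xi>"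
  shows
    "\<comment> \<open>(a)\<close>
     (\<forall>V\<in>{VA, VB}. volatility M \<alpha> V \<and> (\<exists>C. AE \<omega> in M. \<forall>t. \<bar>V t \<omega>\<bar> \<le> C)) \<and>
     (\<forall>t. distr M borel (VA t) = distr M borel (VB t)) \<and>
     (\<forall>i\<in>{1, 2}. \<exists>\<nu>. scalar_path_tail_measure M \<alpha> (row l0 VA \<eta> i) \<nu> \<and>
                     scalar_path_tail_measure M \<alpha> (row l0 VB \<eta> i) \<nu>) \<and>
     \<comment> \<open>(b)\<close>
     (\<forall>V\<in>{VA, VB}. anchor_mass M \<alpha> l0 V 0 =
                     ennreal ((real l0)\<^sup>2 + (49 * real l0 - 44) * c\<^sup>2)) \<and>
     anchor_mass M \<alpha> l0 VA 2 - anchor_mass M \<alpha> l0 VB 2 =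
       ennreal (if l0 = 4 then 2 * c\<^sup>2 else 4 * c\<^sup>2) \<and>
     \<comment> \<open>(c)\<close>
     (\<forall>V\<in>{VA, VB}. \<forall>T\<ge>1. has_simultaneous_tail_mass M \<alpha> (row l0 V \<eta>) T
        ((real l0)\<^sup>2 + (49 * real l0 - 44) * c\<^sup>2
          + (real T - 1) * (2 * real l0 - 1 + 49 * c\<^sup>2))) \<and>
     \<comment> \<open>non-determination\<close>
     \<not> (\<exists>\<Phi> :: (int \<Rightarrow> real) measure \<Rightarrow> (int \<Rightarrow> real) measure \<Rightarrow> (nat \<Rightarrow> real) \<Rightarrow> int \<Rightarrow> ennreal.
          \<forall>V \<nu>1 \<nu>2 H.
            volatility M \<alpha> V \<and> indep_of_innovations M V \<eta> \<and>
            scalar_path_tail_measure M \<alpha> (row l0 V \<eta> 1) \<nu>1 \<and>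
            scalar_path_tail_measure M \<alpha> (row l0 V \<eta> 2) \<nu>2 \<and>
            (\<forall>T\<ge>1. has_simultaneous_tail_mass M \<alpha> (row l0 V \<eta>) T (H T)) \<longrightarrow>
            (\<forall>l. anchor_mass M \<alpha> l0 V l = \<Phi> \<nu>1 \<nu>2 H l))"
proof -
  define a b :: "nat \<Rightarrow> real" where "a = (\<lambda>k. [0, 2, 1, 4] ! k)" and "b = (\<lambda>k. [1, 0, 4, 2] ! k)"
  interpret R: rademacher M \<xi>
    by (intro rademacher.intro rademacher_axioms.intro) fact+
  interpret A: rademacher_volatility M \<xi> \<alpha> c a
    by unfold_locales (use assms in \<open>auto simp: a_def eval_nat_numeral\<close>)
  interpret B: rademacher_volatility M \<xi> \<alpha> c b
    by unfold_locales (use assms in \<open>auto simp: b_def eval_nat_numeral\<close>)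
  have VA: "VA = linear_volatility \<alpha> c a \<xi>"
    unfolding VA_def a_def by (rule V\<^sub>A_eq_linear_volatility)
  have VB: "VB = linear_volatility \<alpha> c b \<xi>"
    unfolding VB_def b_def by (rule V\<^sub>B_eq_linear_volatility)
  have vol: "volatility M \<alpha> V" and indep: "indep_of_innovations M V \<eta>" if "V \<in> {VA, VB}" for V
    using that A.volatility_V B.volatility_V A.indep_of_innovations_V B.indep_of_innovations_V assms
    by (auto simp: VA VB)
  have bounded: "\<exists>C. AE \<omega> in M. \<forall>t. \<bar>V t \<omega>\<bar> \<le> C" if "V \<in> {VA, VB}" for V
    using that A.AE_V_bounded B.AE_V_bounded by (auto simp: VA VB)
  have law: "distr M borel (VA t) = distr M borel (VB t)" for t
    unfolding VA_def VB_def by (rule R.distr_V\<^sub>A_eq_V\<^sub>B)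
  have scalar: "scalar_path_tail_measure M \<alpha> (row l0 V \<eta> i) (window_tail_measure \<alpha> l0)"
    if "V \<in> {VA, VB}" "i \<in> {1, 2}" for V i
  proof -
    interpret model: volatility_model M \<alpha> V \<eta>
      by unfold_locales (use assms vol[OF that(1)] indep[OF that(1)] in auto)
    show ?thesis
      using that(2) \<open>l0 \<ge> 4\<close> by (intro model.scalar_path_tail_measure_row) auto
  qed
  let ?h = "\<lambda>m. (real l0)\<^sup>2 + (49 * real l0 - 44) * c\<^sup>2 + m * (2 * real l0 - 1 + 49 * c\<^sup>2)"
  \<comment> \<open>The shift m = 0 yields the anchor mass at lag 0, and m = T - 1 the simultaneous
    tail mass.\<close>
  have sum_a: "(\<Sum>\<delta>\<in>{- int l0<..<int l0}. (1 + c\<^sup>2 * lag_covariance a \<delta>) * (m + (real l0 - real_of_int \<bar>\<delta>\<bar>))) = ?h m" for m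
    using \<open>l0 \<ge> 4\<close> by (intro sum_lag_weights) (auto simp: a_def lag_covariance_A)
  have sum_b: "(\<Sum>\<delta>\<in>{- int l0<..<int l0}. (1 + c\<^sup>2 * lag_covariance b \<delta>) * (m + (real l0 - real_of_int \<bar>\<delta>\<bar>))) = ?h m" for m
    using \<open>l0 \<ge> 4\<close> by (intro sum_lag_weights) (auto simp: b_def lag_covariance_B)
  have anchor_0: "anchor_mass M \<alpha> l0 V 0 = ennreal ((real l0)\<^sup>2 + (49 * real l0 - 44) * c\<^sup>2)"
    if "V \<in> {VA, VB}" for V
    using that sum_a[of 0] sum_b[of 0] A.anchor_mass_V[of l0 0] B.anchor_mass_V[of l0 0]
    by (auto simp: VA VB)
  have anchor_2: "anchor_mass M \<alpha> l0 VA 2 - anchor_mass M \<alpha> l0 VB 2 =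
      ennreal (if l0 = 4 then 2 * c\<^sup>2 else 4 * c\<^sup>2)"
    using lag_weight_sum_difference[OF \<open>l0 \<ge> 4\<close>, of c] B.anchor_sum_nonneg[where l = 2 and ?l0.0 = l0]
    unfolding VA VB A.anchor_mass_V B.anchor_mass_V a_def[symmetric] b_def[symmetric]
    by (simp only: ennreal_minus)
  have simultaneous: "has_simultaneous_tail_mass M \<alpha> (row l0 V \<eta>) T (?h (real T - 1))"
    if "V \<in> {VA, VB}" "T \<ge> 1" for V T
    using that A.has_simultaneous_tail_mass_V[of \<eta> l0 T] B.has_simultaneous_tail_mass_V[of \<eta> l0 T]
      \<open>l0 \<ge> 4\<close> assms
    unfolding sum_a sum_b by (auto simp: VA VB)
  have "anchor_mass M \<alpha> l0 VA 2 \<noteq> anchor_mass M \<alpha> l0 VB 2"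
  proof
    assume "anchor_mass M \<alpha> l0 VA 2 = anchor_mass M \<alpha> l0 VB 2"
    \<comment> \<open>The difference of equal extended numbers is 0 only when they are finite, which
      \<open>B.anchor_mass_V\<close> supplies.\<close>
    then have "anchor_mass M \<alpha> l0 VA 2 - anchor_mass M \<alpha> l0 VB 2 = 0"
      unfolding VB B.anchor_mass_V by simp
    then show False
      unfolding anchor_2 using \<open>0 < c\<close> by (simp add: ennreal_eq_0_iff split: if_splits)
  qed
  then have undetermined: False
    if \<Phi>: "\<forall>V \<nu>1 \<nu>2 H.
      volatility M \<alpha> V \<and> indep_of_innovations M V \<eta> \<and>
      scalar_path_tail_measure M \<alpha> (row l0 V \<eta> 1) \<nu>1 \<and>
      scalar_path_tail_measure M \<alpha> (row l0 V \<eta> 2) \<nu>2 \<and>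
      (\<forall>T\<ge>1. has_simultaneous_tail_mass M \<alpha> (row l0 V \<eta>) T (H T)) \<longrightarrow>
      (\<forall>l. anchor_mass M \<alpha> l0 V l = \<Phi> \<nu>1 \<nu>2 H l)"
    for \<Phi> :: "(int \<Rightarrow> real) measure \<Rightarrow> (int \<Rightarrow> real) measure \<Rightarrow> (nat \<Rightarrow> real) \<Rightarrow> int \<Rightarrow> ennreal"
  proof -
    let ?\<nu> = "window_tail_measure \<alpha> l0"
    \<comment> \<open>Both models present identical arguments to \<Phi>, so it would have to return
      one value at lag 2 for both.\<close>
    have "anchor_mass M \<alpha> l0 V 2 = \<Phi> ?\<nu> ?\<nu> (\<lambda>T. ?h (real T - 1)) 2" if "V \<in> {VA, VB}" for V
      by (rule \<Phi>[rule_format]) (use vol indep scalar simultaneous that in auto)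
    then show False
      using \<open>anchor_mass M \<alpha> l0 VA 2 \<noteq> anchor_mass M \<alpha> l0 VB 2\<close> by simp
  qed
  show ?thesis
  proof (intro conjI)
    show "\<forall>V\<in>{VA, VB}. volatility M \<alpha> V \<and> (\<exists>C. AE \<omega> in M. \<forall>t. \<bar>V t \<omega>\<bar> \<le> C)"
      by (intro ballI conjI vol bounded)
    show "\<forall>i\<in>{1, 2}. \<exists>\<nu>. scalar_path_tail_measure M \<alpha> (row l0 VA \<eta> i) \<nu> \<and>
        scalar_path_tail_measure M \<alpha> (row l0 VB \<eta> i) \<nu>"
      by (intro ballI exI[of _ "window_tail_measure \<alpha> l0"] conjI scalar) simp_all
    show "\<forall>V\<in>{VA, VB}. \<forall>T\<ge>1. has_simultaneous_tail_mass M \<alpha> (row l0 V \<eta>) T (?h (real T - 1))"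
      by (intro ballI allI impI simultaneous)
    show "\<forall>t. distr M borel (VA t) = distr M borel (VB t)"
      by (intro allI law)
    show "\<forall>V\<in>{VA, VB}. anchor_mass M \<alpha> l0 V 0 = ennreal ((real l0)\<^sup>2 + (49 * real l0 - 44) * c\<^sup>2)"
      by (intro ballI anchor_0)
    show "anchor_mass M \<alpha> l0 VA 2 - anchor_mass M \<alpha> l0 VB 2 =
        ennreal (if l0 = 4 then 2 * c\<^sup>2 else 4 * c\<^sup>2)"
      by (rule anchor_2)
  qed (rule notI, elim exE, rule undetermined)
qed

end
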